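(* (Generalized residue theorem for additive multi-valued functions.) Let $k$ be an algebraically closed field of characteristic $0$, $X$ an algebraic curve over $k$ of genus $g\ge1$, $D=P_1+\dots+P_g$ an effective non-special divisor of degree $g$ on $X$ with distinct points, and $t_i$ local uniformizers at $P_i$. Let $\mathcal{A}(X,D)\subset\mathbb{A}_X$ be the associated space of additive functions (see the context), and for $x,y\in\mathbb{A}_X$ let $c_X(x,y)=-\sum_{P\in X}\operatorname{Res}_P(x_P\,dy_P)$. Then $$c_X(a_1,a_2)=0\qquad\text{for all } a_1,a_2\in\mathcal{A}(X,D).$$
   Context: An algebraic curve $X$ over $k$ is an irreducible non-singular one-dimensional projective variety. $F=k(X)$; $v_P$ is the discrete valuation of $F$ at the closed point $P$; $F_P$ is the completion of $F$ with valuation ring $\mathcal{O}_P$. $\mathbb{A}_X=\{x=\{x_P\}\in\prod_P F_P: x_P\in\mathcal{O}_P\text{ for all but finitely many }P\}$, with $F$ embedded diagonally. $\Omega^1_{F/k}$ is the space of Kähler differentials, $\omega|_P$ the image of $\omega$ in the one-dimensional completed module of differentials of $F_P$ (equal to $k((t))\,dt$ for a uniformizer $t$); $d$ acts componentwise on adeles and $\operatorname{Res}_P$ is the usual residue. For a divisor $D$, $\Omega^1_{F/k}(D)=\{\omega:v_P(\omega)\ge -v_P(D)\ \forall P\}$, where $v_P(D)$ is the coefficient of $P$ in $D$. An effective divisor $D$ is non-special if $h^0(K-D)=0$, $K$ being the canonical class. $\Omega^{(\mathrm{2nd})}=\{\omega\in\Omega^1_{F/k}:\operatorname{Res}_P\omega=0\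 \forall P\}$. For $D=P_1+\dots+P_g$ as in the claim, $\omega_j\in\Omega^{(\mathrm{2nd})}\cap\Omega^1_{F/k}(2D)$ ($j=1,\dots,g$) is the unique differential with $v_{P_i}(\omega_j-\delta_{ij}t_i^{-2}dt_i)>0$ for $i=1,\dots,g$. Fix $\eta_i\in\mathbb{A}_X$ with $d\eta_i=\omega_i$, i.e. $d\eta_{i,P}=\omega_i|_P$ for all $P$ (any fixed choice of additive constants in $k$ at all points $P$). Then $\mathcal{A}(X,D)=k\eta_1\oplus\dots\oplus k\eta_g\oplus F\subset\mathbb{A}_X$. *)

theory Defs
  imports
    "HOL-Computational_Algebra.Computational_Algebra"
    "HOL-Library.Poly_Mapping"
begin

section \<open>Projective varieties\<close>

text \<open>Homogeneous coordinates are indexed by a finite type \<open>'n\<close>, so that the ambient space is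
  projective space of dimension \<open>CARD('n) - 1\<close>.\<close>

type_synonym ('n, 'k) mpol = "('n \<Rightarrow>\<^sub>0 nat) \<Rightarrow>\<^sub>0 'k"

text \<open>A point is the set of all its homogeneous coordinate vectors.\<close>
type_synonym ('n, 'k) ppoint = "('n \<Rightarrow> 'k) set"

definition mpol_eval :: "('n \<Rightarrow> 'k) \<Rightarrow> ('n, 'k::comm_ring_1) mpol \<Rightarrow> 'k" where
  "mpol_eval a p = (\<Sum>m\<in>Poly_Mapping.keys p.
     Poly_Mapping.lookup p m * (\<Prod>i\<in>Poly_Mapping.keys m. a i ^ Poly_Mapping.lookup m i))"

definition homogeneous :: "nat \<Rightarrow> ('n, 'k::zero) mpol \<Rightarrow> bool" where
  "homogeneous e p \<longleftrightarrow> (\<forall>m\<in>Poly_Mapping.keys p.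
     (\<Sum>i\<in>Poly_Mapping.keys m. Poly_Mapping.lookup m i) = e)"

definition proj_space :: "('n, 'k::field) ppoint set" where
  "proj_space = {{(\<lambda>i. c * a i) | c. c \<noteq> 0} | a. \<exists>i. a i \<noteq> 0}"

definition vanishes_at :: "('n, 'k::field) mpol \<Rightarrow> ('n, 'k) ppoint \<Rightarrow> bool" where
  "vanishes_at p P \<longleftrightarrow> (\<forall>a\<in>P. mpol_eval a p = 0)"

definition proj_closed :: "('n, 'k::field) ppoint set \<Rightarrow> bool" where
  "proj_closed Z \<longleftrightarrow> (\<exists>S. (\<forall>p\<in>S. \<exists>e. homogeneous e p) \<and>
     Z = {P \<in> proj_space. \<forall>p\<in>S. vanishes_at p P})"

definition irreducible_proj_variety :: "('n, 'k::field) ppoint set \<Rightarrow> bool" where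
  "irreducible_proj_variety X \<longleftrightarrow> proj_closed X \<and> X \<noteq> {} \<and>
     (\<forall>Z\<^sub>1 Z\<^sub>2. proj_closed Z\<^sub>1 \<longrightarrow> proj_closed Z\<^sub>2 \<longrightarrow> X = Z\<^sub>1 \<union> Z\<^sub>2 \<longrightarrow> X = Z\<^sub>1 \<or> X = Z\<^sub>2)"


section \<open>The function field and the local rings\<close>

text \<open>The field \<open>'f\<close> is identified with \<open>k(X)\<close> by a map \<open>quo\<close> sending a pair of forms \<open>f\<close>, \<open>g\<close> of
  equal degree, \<open>g\<close> not identically zero on \<open>X\<close>, to the rational function \<open>f / g\<close> on \<open>X\<close>. The
  value of \<open>quo\<close> on other pairs is irrelevant.\<close>

definition form_pair :: "('n, 'k::field) mpol \<Rightarrow> ('n, 'k) mpol \<Rightarrow> bool" where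
  "form_pair f g \<longleftrightarrow> (\<exists>e. homogeneous e f \<and> homogeneous e g)"

definition fraction_on :: "('n, 'k::field) ppoint set \<Rightarrow> ('n, 'k) mpol \<Rightarrow> ('n, 'k) mpol \<Rightarrow> bool" where
  "fraction_on X f g \<longleftrightarrow> form_pair f g \<and> (\<exists>P\<in>X. \<not> vanishes_at g P)"

definition is_function_field ::
  "('n, 'k::field) ppoint set \<Rightarrow> (('n, 'k) mpol \<Rightarrow> ('n, 'k) mpol \<Rightarrow> 'f::field) \<Rightarrow> bool" where
  "is_function_field X quo \<longleftrightarrow>
     (\<forall>f g f' g'. fraction_on X f g \<longrightarrow> fraction_on X f' g' \<longrightarrow>
        (quo f g = quo f' g' \<longleftrightarrow> (\<forall>P\<in>X. vanishes_at (f * g' - f' * g) P)) \<and>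
        quo f g + quo f' g' = quo (f * g' + f' * g) (g * g') \<and>
        quo f g * quo f' g' = quo (f * f') (g * g')) \<and>
     (\<forall>z. \<exists>f g. fraction_on X f g \<and> z = quo f g)"

definition const_fun :: "(('n, 'k::field) mpol \<Rightarrow> ('n, 'k) mpol \<Rightarrow> 'f::field) \<Rightarrow> 'k \<Rightarrow> 'f" where
  "const_fun quo c = quo (Poly_Mapping.single 0 c) 1"

definition local_ring ::
  "(('n, 'k::field) mpol \<Rightarrow> ('n, 'k) mpol \<Rightarrow> 'f::field) \<Rightarrow> ('n, 'k) ppoint \<Rightarrow> 'f set" where
  "local_ring quo P = {quo f g | f g. form_pair f g \<and> \<not> vanishes_at g P}"

definition local_max_ideal ::
  "(('n, 'k::field) mpol \<Rightarrow> ('n, 'k) mpol \<Rightarrow> 'f::field) \<Rightarrow> ('n, 'k) ppoint \<Rightarrow> 'f set" where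
  "local_max_ideal quo P = {quo f g | f g. form_pair f g \<and> \<not> vanishes_at g P \<and> vanishes_at f P}"

definition is_local_param ::
  "(('n, 'k::field) mpol \<Rightarrow> ('n, 'k) mpol \<Rightarrow> 'f::field) \<Rightarrow> ('n, 'k) ppoint \<Rightarrow> 'f \<Rightarrow> bool" where
  "is_local_param quo P t \<longleftrightarrow> local_max_ideal quo P = {t * u | u. u \<in> local_ring quo P}"

definition algebraic_over :: "'f::field set \<Rightarrow> 'f \<Rightarrow> bool" where
  "algebraic_over K y \<longleftrightarrow> (\<exists>p. p \<noteq> 0 \<and> (\<forall>i. poly.coeff p i \<in> K) \<and> poly p y = 0)"

definition simple_extension :: "('k::field \<Rightarrow> 'f::field) \<Rightarrow> 'f \<Rightarrow> 'f set" where
  "simple_extension emb x = {poly (map_poly emb p) x / poly (map_poly emb q) x | p q. True}"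

text \<open>The dimension of an irreducible variety is the transcendence degree of its function field; a
  point of a variety of dimension one is non-singular if its local ring is regular, i.e. if the
  maximal ideal is generated by one element.\<close>

definition algebraic_curve ::
  "('n::finite, 'k::field) ppoint set \<Rightarrow> (('n, 'k) mpol \<Rightarrow> ('n, 'k) mpol \<Rightarrow> 'f::field) \<Rightarrow> bool" where
  "algebraic_curve X quo \<longleftrightarrow>
     irreducible_proj_variety X \<and>
     is_function_field X quo \<and>
     (\<exists>x. \<not> algebraic_over (range (const_fun quo)) x \<and>
          (\<forall>y. algebraic_over (simple_extension (const_fun quo) x) y)) \<and>
     (\<forall>P\<in>X. \<exists>t. is_local_param quo P t)"

text \<open>The value at \<open>f = 0\<close> is meaningless.\<close>

definition val_at ::
  "(('n, 'k::field) mpol \<Rightarrow> ('n, 'k) mpol \<Rightarrow> 'f::field) \<Rightarrow> ('n, 'k) ppoint \<Rightarrow> 'f \<Rightarrow> int" where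
  "val_at quo P f = (THE n. \<exists>t u. is_local_param quo P t \<and>
     u \<in> local_ring quo P - local_max_ideal quo P \<and> f = t powi n * u)"


section \<open>Completions, adeles and residues\<close>

text \<open>The field of Laurent series, complete for the subdegree valuation, together with an isometric
  dense embedding of the valued field \<open>F\<close> that is the identity on constants, is a completion of
  \<open>F\<close> at \<open>P\<close>. The choice of such an embedding amounts to that of a uniformizer of the completion,
  namely the one corresponding to \<^term>\<open>fls_X\<close>.\<close>

definition is_completion ::
  "(('n, 'k::field) mpol \<Rightarrow> ('n, 'k) mpol \<Rightarrow> 'f::field) \<Rightarrow> ('n, 'k) ppoint \<Rightarrow> ('f \<Rightarrow> 'k fls) \<Rightarrow> bool" where
  "is_completion quo P j \<longleftrightarrow>
     (\<forall>f h. j (f + h) = j f + j h \<and> j (f * h) = j f * j h) \<and>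
     (\<forall>c. j (const_fun quo c) = fls_const c) \<and>
     (\<forall>f. f \<noteq> 0 \<longrightarrow> j f \<noteq> 0 \<and> fls_subdegree (j f) = val_at quo P f) \<and>
     (\<forall>s n. \<exists>f. s = j f \<or> fls_subdegree (s - j f) \<ge> n)"

text \<open>\<open>v(s) \<ge> n\<close>, with \<open>v(0) = \<infinity>\<close>\<close>

definition val_ge :: "'k::zero fls \<Rightarrow> int \<Rightarrow> bool" where
  "val_ge s n \<longleftrightarrow> s = 0 \<or> fls_subdegree s \<ge> n"

text \<open>A family of local components is extended by zero outside \<open>X\<close>.\<close>

definition adeles :: "('n, 'k::field) ppoint set \<Rightarrow> (('n, 'k) ppoint \<Rightarrow> 'k fls) set" where
  "adeles X = {x. (\<forall>P. P \<notin> X \<longrightarrow> x P = 0) \<and> finite {P \<in> X. \<not> val_ge (x P) 0}}"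

definition diagonal ::
  "('n, 'k::field) ppoint set \<Rightarrow> (('n, 'k) ppoint \<Rightarrow> 'f \<Rightarrow> 'k fls) \<Rightarrow> 'f \<Rightarrow> ('n, 'k) ppoint \<Rightarrow> 'k fls" where
  "diagonal X \<iota> f = (\<lambda>P. if P \<in> X then \<iota> P f else 0)"

text \<open>For adeles all but finitely many of the residues are zero.\<close>

definition c_form ::
  "('n, 'k::field) ppoint set \<Rightarrow> (('n, 'k) ppoint \<Rightarrow> 'k fls) \<Rightarrow> (('n, 'k) ppoint \<Rightarrow> 'k fls) \<Rightarrow> 'k" where
  "c_form X x y = - (\<Sum>P | P \<in> X \<and> fls_residue (x P * fls_deriv (y P)) \<noteq> 0.
      fls_residue (x P * fls_deriv (y P)))"


section \<open>Kaehler differentials\<close>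

text \<open>The finitely supported map \<open>\<phi>\<close> stands for the formal sum of the symbols \<open>\<phi>(f) df\<close>.\<close>

definition kahler_relations :: "('k \<Rightarrow> 'f::field) \<Rightarrow> ('f \<Rightarrow>\<^sub>0 'f) set" where
  "kahler_relations emb = module.span (\<lambda>a. Poly_Mapping.map ((*) a))
     ({Poly_Mapping.single (f + h) 1 - Poly_Mapping.single f 1 - Poly_Mapping.single h 1 | f h. True} \<union>
      {Poly_Mapping.single (f * h) 1 - Poly_Mapping.single h f - Poly_Mapping.single f h | f h. True} \<union>
      {Poly_Mapping.single (emb c) 1 | c. True})"

text \<open>\<open>(\<Omega>, d)\<close> is the module presented by the symbols \<open>df\<close> and the above relations.\<close>

definition is_kahler_module ::
  "('k \<Rightarrow> 'f::field) \<Rightarrow> ('f \<Rightarrow> 'w::ab_group_add \<Rightarrow> 'w) \<Rightarrow> ('f \<Rightarrow> 'w) \<Rightarrow> bool" where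
  "is_kahler_module emb smul d \<longleftrightarrow>
     vector_space smul \<and>
     module.span smul (range d) = UNIV \<and>
     (\<forall>\<phi>. (\<Sum>f\<in>Poly_Mapping.keys \<phi>. smul (Poly_Mapping.lookup \<phi> f) (d f)) = 0
        \<longleftrightarrow> \<phi> \<in> kahler_relations emb)"

text \<open>The image in the module \<open>k((t)) dt\<close> of completed differentials, identified with \<open>k((t))\<close>.\<close>

definition restrict_diff ::
  "('f::field \<Rightarrow> 'w::ab_group_add \<Rightarrow> 'w) \<Rightarrow> ('f \<Rightarrow> 'w) \<Rightarrow> ('f \<Rightarrow> 'k::field fls) \<Rightarrow> 'w \<Rightarrow> 'k fls" where
  "restrict_diff smul d j = (THE L.
     (\<forall>\<omega> \<omega>'. L (\<omega> + \<omega>') = L \<omega> + L \<omega>') \<and>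
     (\<forall>f \<omega>. L (smul f \<omega>) = j f * L \<omega>) \<and>
     (\<forall>f. L (d f) = fls_deriv (j f)))"

definition diffs_of_divisor ::
  "('n, 'k::field) ppoint set \<Rightarrow> ('f::field \<Rightarrow> 'w::ab_group_add \<Rightarrow> 'w) \<Rightarrow> ('f \<Rightarrow> 'w) \<Rightarrow>
   (('n, 'k) ppoint \<Rightarrow> 'f \<Rightarrow> 'k fls) \<Rightarrow> (('n, 'k) ppoint \<Rightarrow> int) \<Rightarrow> 'w set" where
  "diffs_of_divisor X smul d \<iota> D = {\<omega>. \<forall>P\<in>X. val_ge (restrict_diff smul d (\<iota> P) \<omega>) (- D P)}"

definition second_kind ::
  "('n, 'k::field) ppoint set \<Rightarrow> ('f::field \<Rightarrow> 'w::ab_group_add \<Rightarrow> 'w) \<Rightarrow> ('f \<Rightarrow> 'w) \<Rightarrow>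
   (('n, 'k) ppoint \<Rightarrow> 'f \<Rightarrow> 'k fls) \<Rightarrow> 'w set" where
  "second_kind X smul d \<iota> = {\<omega>. \<forall>P\<in>X. fls_residue (restrict_diff smul d (\<iota> P) \<omega>) = 0}"

text \<open>The genus is the dimension over \<open>k\<close> of the space of regular differentials. (This space and
  those below are finite-dimensional because \<open>X\<close> is projective.)\<close>

definition genus ::
  "('n, 'k::field) ppoint set \<Rightarrow> (('n, 'k) mpol \<Rightarrow> ('n, 'k) mpol \<Rightarrow> 'f::field) \<Rightarrow>
   ('f \<Rightarrow> 'w::ab_group_add \<Rightarrow> 'w) \<Rightarrow> ('f \<Rightarrow> 'w) \<Rightarrow> (('n, 'k) ppoint \<Rightarrow> 'f \<Rightarrow> 'k fls) \<Rightarrow> nat" where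
  "genus X quo smul d \<iota> = vector_space.dim (\<lambda>c. smul (const_fun quo c))
     (diffs_of_divisor X smul d \<iota> (\<lambda>_. 0))"


section \<open>Divisors\<close>

text \<open>A divisor is given by its coefficients at the points of \<open>X\<close>.\<close>

definition h0 ::
  "('n, 'k::field) ppoint set \<Rightarrow> (('n, 'k) mpol \<Rightarrow> ('n, 'k) mpol \<Rightarrow> 'f::field) \<Rightarrow>
   (('n, 'k) ppoint \<Rightarrow> int) \<Rightarrow> nat" where
  "h0 X quo D = vector_space.dim (\<lambda>c f. const_fun quo c * f)
     {f. f = 0 \<or> (\<forall>P\<in>X. val_at quo P f \<ge> - D P)}"

definition div_of_diff ::
  "('f::field \<Rightarrow> 'w::ab_group_add \<Rightarrow> 'w) \<Rightarrow> ('f \<Rightarrow> 'w) \<Rightarrow>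
   (('n, 'k::field) ppoint \<Rightarrow> 'f \<Rightarrow> 'k fls) \<Rightarrow> 'w \<Rightarrow> ('n, 'k) ppoint \<Rightarrow> int" where
  "div_of_diff smul d \<iota> \<omega> = (\<lambda>P. fls_subdegree (restrict_diff smul d (\<iota> P) \<omega>))"

definition nonspecial ::
  "('n, 'k::field) ppoint set \<Rightarrow> (('n, 'k) mpol \<Rightarrow> ('n, 'k) mpol \<Rightarrow> 'f::field) \<Rightarrow>
   ('f \<Rightarrow> 'w::ab_group_add \<Rightarrow> 'w) \<Rightarrow> ('f \<Rightarrow> 'w) \<Rightarrow> (('n, 'k) ppoint \<Rightarrow> 'f \<Rightarrow> 'k fls) \<Rightarrow>
   (('n, 'k) ppoint \<Rightarrow> int) \<Rightarrow> bool" where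
  "nonspecial X quo smul d \<iota> D \<longleftrightarrow> (\<forall>P\<in>X. D P \<ge> 0) \<and>
     (\<exists>\<omega>. \<omega> \<noteq> 0 \<and> h0 X quo (\<lambda>P. div_of_diff smul d \<iota> \<omega> P - D P) = 0)"

definition sum_of_points :: "nat \<Rightarrow> (nat \<Rightarrow> ('n, 'k) ppoint) \<Rightarrow> ('n, 'k) ppoint \<Rightarrow> int" where
  "sum_of_points g Q = (\<lambda>P. \<Sum>i=1..g. if Q i = P then 1 else 0)"


section \<open>Additive multi-valued functions\<close>

definition additive_functions ::
  "('n, 'k::field) ppoint set \<Rightarrow> (('n, 'k) ppoint \<Rightarrow> 'f::field \<Rightarrow> 'k fls) \<Rightarrow>
   nat \<Rightarrow> (nat \<Rightarrow> ('n, 'k) ppoint \<Rightarrow> 'k fls) \<Rightarrow> (('n, 'k) ppoint \<Rightarrow> 'k fls) set" where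
  "additive_functions X \<iota> g \<eta> =
     {(\<lambda>P. (\<Sum>i=1..g. fls_const (c i) * \<eta> i P) + diagonal X \<iota> f P) | c f. True}"

end

theory Submission
  imports Defs "HOL-Library.Function_Algebras" "HOL-Library.FuncSet"
begin

text \<open>
  The theorem is the residue theorem on \<open>X\<close>, applied to one differential. Let
  \<open>a\<^sub>1 = \<Sum>c\<^sub>i \<eta>\<^sub>i + f\<close> and \<open>a\<^sub>2 = \<Sum>c'\<^sub>j \<eta>\<^sub>j + h\<close>. The residue of \<open>\<eta>\<^sub>i d\<eta>\<^sub>j\<close> vanishes at every
  point: for \<open>i = j\<close> the differential is exact, and for \<open>i \<noteq> j\<close> the simple pole of \<open>\<eta>\<^sub>i\<close> at \<open>P\<^sub>i\<close> meets a
  zero of \<open>\<omega>\<^sub>j\<close>, the point \<open>P\<^sub>j\<close> is treated in the same way after an integration by parts, and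
  elsewhere everything is regular. Integrating \<open>\<eta>\<^sub>i dh\<close> by parts, one finds that at each point
  \<open>a\<^sub>1 da\<^sub>2\<close> has the same residue as the global differential \<open>f (\<Sum>c'\<^sub>j \<omega>\<^sub>j + dh) - h \<Sum>c\<^sub>i \<omega>\<^sub>i\<close>.

  The residue theorem is proved by Tate's method. It suffices to treat \<open>f dg\<close>. Let \<open>S\<close> be the finite
  set of poles of \<open>f\<close> and \<open>g\<close>, let \<open>Q\<close> be the truncation of families of Laurent series to power series
  at the points of \<open>S\<close>, and let \<open>A\<close> be its image. The commutator of \<open>Q f Q\<close> and \<open>Q g Q\<close> has finite rank,
  and its trace is the sum of the residues (\<open>trace_truncated_commutator\<close>). The functions regular
  outside \<open>S\<close> form a space \<open>R\<close> stable under \<open>f\<close> and \<open>g\<close> that is, up to finite dimensions, a complement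
  of \<open>A\<close>. For a projection \<open>P\<close> with kernel \<open>R\<close> the operators \<open>P f P\<close> and \<open>P g P\<close> commute, and as the image
  of \<open>P\<close> is commensurable with \<open>A\<close>, the first trace is zero as well
  (\<open>trace_commutator_eq_0_of_complement\<close>).

  That \<open>R \<inter> A\<close> is finite-dimensional means that a non-constant function has a pole
  (\<open>nonconstant_has_pole\<close>). This is where projectivity enters: a maximal subring of \<open>F\<close> that avoids a
  non-constant \<open>z\<close> is a valuation ring, and it is centred at a point of \<open>X\<close>, where \<open>z\<close> has a pole. That
  \<open>R + A\<close> has finite codimension (\<open>function_splitting\<close>, \<open>weak_approximation\<close>) follows from the
  finiteness of \<open>F\<close> over \<open>k(x)\<close>, where \<open>x = f + c g\<close> is chosen to have exactly the poles \<open>S\<close>, and from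
  division with remainder in \<open>k[x]\<close>. The finiteness of \<open>F\<close> over \<open>k(z)\<close> for all non-constant \<open>z\<close>
  (\<open>finite_over_nonconstant\<close>) is the one global algebraic input. In the form
  \<open>dependence_mod_ideal\<close> it also yields that the local rings are discrete valuation rings, that
  functions have finitely many zeros and poles, and that residue fields of valuation rings are \<open>k\<close>.
\<close>

unbundle fps_syntax

section \<open>Traces of operators of finite rank\<close>

locale operator_trace = vector_space scale
  for scale :: "'a::field \<Rightarrow> 'b::ab_group_add \<Rightarrow> 'b"
begin

definition finite_rank :: "('b \<Rightarrow> 'b) \<Rightarrow> bool" where
  "finite_rank T \<longleftrightarrow> (\<exists>B. finite B \<and> range T \<subseteq> span B)"

abbreviation endo :: "('b \<Rightarrow> 'b) \<Rightarrow> bool" where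
  "endo T \<equiv> Vector_Spaces.linear scale scale T"

definition coord :: "'b \<Rightarrow> 'b \<Rightarrow> 'a" where
  "coord v b = representation (extend_basis {}) v b"

text \<open>The index set is finite when \<open>T\<close> has finite rank; the value on other operators is meaningless.\<close>

definition trace :: "('b \<Rightarrow> 'b) \<Rightarrow> 'a" where
  "trace T = (\<Sum>b | coord (T b) b \<noteq> 0. coord (T b) b)"

lemma endoI:
  assumes "\<And>u v. T (u + v) = T u + T v" "\<And>c v. T (scale c v) = scale c (T v)"
  shows "endo T"
  using assms unfolding Vector_Spaces.linear_iff by (simp add: vector_space_axioms)

lemma endoD:
  assumes "endo T"
  shows "T (u + v) = T u + T v" "T (scale c v) = scale c (T v)" "T (u - v) = T u - T v"
    "T 0 = 0" "T (- v) = - T v" "T (sum h I) = (\<Sum>i\<in>I. T (h i))"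
proof -
  interpret T: Vector_Spaces.linear scale scale T by fact
  show "T (u + v) = T u + T v" "T (scale c v) = scale c (T v)" "T (u - v) = T u - T v"
    "T 0 = 0" "T (- v) = - T v" "T (sum h I) = (\<Sum>i\<in>I. T (h i))"
    by (simp_all add: T.add T.scale T.diff T.zero T.neg T.sum)
qed

lemma endo_comp: "endo S \<Longrightarrow> endo T \<Longrightarrow> endo (\<lambda>v. S (T v))"
  by (intro endoI) (simp_all add: endoD[of S] endoD[of T])

lemma endo_diff: "endo S \<Longrightarrow> endo T \<Longrightarrow> endo (\<lambda>v. S v - T v)"
  by (intro endoI) (simp_all add: endoD[of S] endoD[of T] algebra_simps scale_right_diff_distrib)

lemma endo_id: "endo (\<lambda>v. v)"
  by (intro endoI) simp_all

lemma finite_rank_add: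
  assumes "finite_rank S" "finite_rank T" shows "finite_rank (\<lambda>v. S v + T v)"
proof -
  obtain B C where "finite B" "range S \<subseteq> span B" "finite C" "range T \<subseteq> span C"
    using assms unfolding finite_rank_def by blast
  moreover have "span B \<subseteq> span (B \<union> C)" "span C \<subseteq> span (B \<union> C)" by (simp_all add: span_mono)
  ultimately show ?thesis unfolding finite_rank_def
    by (intro exI[of _ "B \<union> C"]) (auto intro!: span_add)
qed

lemma finite_rank_uminus: "finite_rank T \<Longrightarrow> finite_rank (\<lambda>v. - T v)"
  unfolding finite_rank_def by (blast intro: span_neg)

lemma finite_rank_diff:
  assumes "finite_rank S" "finite_rank T" shows "finite_rank (\<lambda>v. S v - T v)"
  using finite_rank_add[OF assms(1) finite_rank_uminus[OF assms(2)]] by simp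

lemma finite_rank_comp_right: "finite_rank T \<Longrightarrow> finite_rank (\<lambda>v. T (S v))"
  unfolding finite_rank_def by blast

lemma finite_rank_comp_left:
  assumes "finite_rank T" "endo S" shows "finite_rank (\<lambda>v. S (T v))"
proof -
  interpret S: Vector_Spaces.linear scale scale S by fact
  obtain B where "finite B" "range T \<subseteq> span B" using assms unfolding finite_rank_def by blast
  moreover have "S ` span B = span (S ` B)" by (simp add: S.span_image)
  ultimately show ?thesis unfolding finite_rank_def
    by (intro exI[of _ "S ` B"]) auto
qed

lemma coord_basis: "independent (extend_basis {})" "span (extend_basis {}) = UNIV"
  by (simp_all add: independent_extend_basis span_extend_basis independent_empty)

lemma coord_lin: "coord (u + v) b = coord u b + coord v b" "coord (scale c v) b = c * coord v b"
  "coord 0 b = 0" "coord (sum h I) b = (\<Sum>i\<in>I. coord (h i) b)"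
  "coord (u - v) b = coord u b - coord v b"
  unfolding coord_def using coord_basis
  by (simp_all add: representation_add representation_scale representation_zero representation_sum
      representation_diff)

lemma finite_coord: "finite {b. coord v b \<noteq> 0}"
  unfolding coord_def by (rule finite_representation)

lemma coord_sum: "finite B \<Longrightarrow> {b. coord v b \<noteq> 0} \<subseteq> B \<Longrightarrow> (\<Sum>b\<in>B. scale (coord v b) b) = v"
proof -
  assume "finite B" "{b. coord v b \<noteq> 0} \<subseteq> B"
  then have "(\<Sum>b\<in>B. scale (coord v b) b) = (\<Sum>b | coord v b \<noteq> 0. scale (coord v b) b)"
    by (intro sum.mono_neutral_right) auto
  also have "\<dots> = v" unfolding coord_def
    by (intro sum_nonzero_representation_eq) (simp_all add: coord_basis)
  finally show ?thesis .
qed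

lemma finite_rank_coord_support:
  assumes "finite_rank T" shows "\<exists>B. finite B \<and> (\<forall>v b. coord (T v) b \<noteq> 0 \<longrightarrow> b \<in> B)"
proof -
  obtain C where C: "finite C" "range T \<subseteq> span C" using assms unfolding finite_rank_def by blast
  define B where "B = (\<Union>c\<in>C. {b. coord c b \<noteq> 0})"
  have *: "coord v b = 0" if "v \<in> span C" "b \<notin> B" for v b
    using that(1)
  proof (induction rule: span_induct_alt)
    case base show ?case by (simp add: coord_lin)
  next
    case (step c x y) then show ?case using that(2) by (auto simp: coord_lin B_def)
  qed
  have "finite B" using C(1) by (auto simp: B_def finite_coord)
  moreover have "b \<in> B" if "coord (T v) b \<noteq> 0" for v b using * that C(2) by blast
  ultimately show ?thesis by blast
qed

lemma trace_eq: "finite B \<Longrightarrow> (\<And>b. coord (T b) b \<noteq> 0 \<Longrightarrow> b \<in> B) \<Longrightarrow> trace T = (\<Sum>b\<in>B. coord (T b) b)"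
  unfolding trace_def by (intro sum.mono_neutral_left) auto

lemma trace_add:
  assumes "finite_rank S" "finite_rank T" shows "trace (\<lambda>v. S v + T v) = trace S + trace T"
proof -
  obtain B where B: "finite B" "\<And>v b. coord (S v) b \<noteq> 0 \<Longrightarrow> b \<in> B"
    using finite_rank_coord_support[OF assms(1)] by blast
  obtain C where C: "finite C" "\<And>v b. coord (T v) b \<noteq> 0 \<Longrightarrow> b \<in> C"
    using finite_rank_coord_support[OF assms(2)] by blast
  have "trace (\<lambda>v. S v + T v) = (\<Sum>b\<in>B\<union>C. coord (S b + T b) b)"
    using B C by (intro trace_eq) (auto simp: coord_lin, metis add.right_neutral)
  moreover have "trace S = (\<Sum>b\<in>B\<union>C. coord (S b) b)" using B C by (intro trace_eq) auto
  moreover have "trace T = (\<Sum>b\<in>B\<union>C. coord (T b) b)" using B C by (intro trace_eq) auto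
  ultimately show ?thesis by (simp add: coord_lin sum.distrib)
qed

lemma trace_uminus: "trace (\<lambda>v. - T v) = - trace T"
proof -
  have "coord (- v) b = - coord v b" for v b using coord_lin(5)[of 0 v b] by (simp add: coord_lin)
  then show ?thesis unfolding trace_def by (simp add: sum_negf)
qed

lemma trace_diff:
  assumes "finite_rank S" "finite_rank T" shows "trace (\<lambda>v. S v - T v) = trace S - trace T"
  using trace_add[OF assms(1) finite_rank_uminus[OF assms(2)]] by (simp add: trace_uminus)

lemma functional_coord:
  assumes "Vector_Spaces.linear scale (*) \<phi>" "finite B" "{b. coord v b \<noteq> 0} \<subseteq> B"
  shows "\<phi> v = (\<Sum>b\<in>B. coord v b * \<phi> b)"
proof -
  interpret F: Vector_Spaces.linear scale "(*)" \<phi> by fact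
  have "\<phi> (\<Sum>b\<in>B. scale (coord v b) b) = (\<Sum>b\<in>B. coord v b * \<phi> b)"
    by (simp add: F.sum F.scale)
  then show ?thesis using coord_sum[OF assms(2,3)] by simp
qed

lemma trace_sum_rank_one:
  assumes "finite I" "\<And>i. i \<in> I \<Longrightarrow> Vector_Spaces.linear scale (*) (\<phi> i)"
    and T: "\<And>v. T v = (\<Sum>i\<in>I. scale (\<phi> i v) (w i))"
  shows "trace T = (\<Sum>i\<in>I. \<phi> i (w i))"
proof -
  define B where "B = (\<Union>i\<in>I. {b. coord (w i) b \<noteq> 0})"
  have fB: "finite B" using assms(1) by (auto simp: B_def finite_coord)
  have "trace T = (\<Sum>b\<in>B. coord (T b) b)"
  proof (rule trace_eq[OF fB])
    fix b assume "coord (T b) b \<noteq> 0"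
    then have "(\<Sum>i\<in>I. \<phi> i b * coord (w i) b) \<noteq> 0" by (simp add: T coord_lin)
    then obtain i where "i \<in> I" "\<phi> i b * coord (w i) b \<noteq> 0" by (meson sum.neutral)
    then show "b \<in> B" by (auto simp: B_def)
  qed
  also have "\<dots> = (\<Sum>b\<in>B. \<Sum>i\<in>I. coord (w i) b * \<phi> i b)" by (simp add: T coord_lin mult.commute)
  also have "\<dots> = (\<Sum>i\<in>I. \<Sum>b\<in>B. coord (w i) b * \<phi> i b)" by (rule sum.swap)
  also have "\<dots> = (\<Sum>i\<in>I. \<phi> i (w i))"
    by (intro sum.cong refl functional_coord[symmetric] assms fB) (auto simp: B_def)
  finally show ?thesis .
qed

lemma finite_rank_sum_rank_one:
  assumes "finite I" and T: "\<And>v. T v = (\<Sum>i\<in>I. scale (\<phi> i v) (w i))"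
  shows "finite_rank T"
  unfolding finite_rank_def
proof (intro exI conjI)
  show "finite (w ` I)" using assms by simp
  have "T v \<in> span (w ` I)" for v
    unfolding T by (intro span_sum span_scale) (blast intro: span_base)
  then show "range T \<subseteq> span (w ` I)" by blast
qed

text \<open>Expanding \<open>T\<close> in coordinates writes both composites as sums of rank-one operators over the same finite
  set of basis vectors, although \<open>S\<close> may have infinite rank.\<close>

lemma trace_comm:
  assumes S: "endo S" and T: "endo T" and fr: "finite_rank T"
  shows "trace (\<lambda>v. S (T v)) = trace (\<lambda>v. T (S v))"
proof -
  interpret s: vector_space "(*) :: 'a \<Rightarrow> 'a \<Rightarrow> 'a" by unfold_locales (auto simp: algebra_simps)
  obtain B where B: "finite B" "\<And>v b. coord (T v) b \<noteq> 0 \<Longrightarrow> b \<in> B"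
    using finite_rank_coord_support[OF fr] by blast
  have T': "T v = (\<Sum>b\<in>B. scale (coord (T v) b) b)" for v
    by (rule coord_sum[OF B(1), symmetric]) (use B(2) in blast)
  have lin: "Vector_Spaces.linear scale (*) (\<lambda>v. coord (U v) b)" if "endo U" for U b
    using that unfolding Vector_Spaces.linear_iff by (auto simp: coord_lin s.vector_space_axioms)
  have "S (T v) = (\<Sum>b\<in>B. scale (coord (T v) b) (S b))" for v
    by (subst T') (simp add: endoD[OF S])
  then have "trace (\<lambda>v. S (T v)) = (\<Sum>b\<in>B. coord (T (S b)) b)"
    by (intro trace_sum_rank_one[OF B(1) lin[OF T]]) simp_all
  moreover have "trace (\<lambda>v. T (S v)) = (\<Sum>b\<in>B. coord (T (S b)) b)"
    by (rule trace_sum_rank_one[OF B(1) lin[OF endo_comp[OF T S]]]) (rule T')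
  ultimately show ?thesis by simp
qed

section \<open>Commutators of compressed operators\<close>

lemma trace_commutator:
  assumes "endo S" "endo T" "finite_rank T"
  shows "trace (\<lambda>v. S (T v) - T (S v)) = 0" "finite_rank (\<lambda>v. S (T v) - T (S v))"
proof -
  have fr: "finite_rank (\<lambda>v. S (T v))" "finite_rank (\<lambda>v. T (S v))"
    using finite_rank_comp_left[OF assms(3,1)] finite_rank_comp_right[OF assms(3)] by simp_all
  show "finite_rank (\<lambda>v. S (T v) - T (S v))" by (intro finite_rank_diff fr)
  show "trace (\<lambda>v. S (T v) - T (S v)) = 0"
    using trace_diff[OF fr] trace_comm[OF assms] by simp
qed

text \<open>The difference of the two commutators is a sum of commutators in which one factor has finite rank, and
  those have trace zero.\<close>

lemma trace_commutator_perturb: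
  assumes lin: "endo F" "endo G" "endo F'" "endo G'"
    and fr: "finite_rank (\<lambda>v. F' v - F v)" "finite_rank (\<lambda>v. G' v - G v)"
    and c: "finite_rank (\<lambda>v. F (G v) - G (F v))"
  shows "trace (\<lambda>v. F' (G' v) - G' (F' v)) = trace (\<lambda>v. F (G v) - G (F v))"
proof -
  define X where "X = (\<lambda>v. F' v - F v)"
  define Y where "Y = (\<lambda>v. G' v - G v)"
  have e: "endo X" "endo Y" "finite_rank X" "finite_rank Y"
    using assms by (auto simp: X_def Y_def endo_diff)
  have F': "F' v = F v + X v" and G': "G' v = G v + Y v" for v by (auto simp: X_def Y_def)
  define C1 where "C1 = (\<lambda>v. F (G v) - G (F v))"
  define C2 where "C2 = (\<lambda>v. F' (Y v) - Y (F' v))"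
  define C3 where "C3 = (\<lambda>v. G (X v) - X (G v))"
  have "finite_rank C2" "trace C2 = 0" "finite_rank C3" "trace C3 = 0"
    unfolding C2_def C3_def using e lin by (auto intro: trace_commutator)
  moreover have "finite_rank C1" using c by (simp add: C1_def)
  moreover have "(\<lambda>v. F' (G' v) - G' (F' v)) = (\<lambda>v. (C1 v + C2 v) - C3 v)"
    by (simp add: fun_eq_iff F' G' C1_def C2_def C3_def endoD[OF lin(1)] endoD[OF lin(2)] endoD[OF e(1)] algebra_simps)
  ultimately show ?thesis
    by (simp add: trace_diff trace_add finite_rank_add C1_def)
qed

text \<open>\<open>Q f Q\<close> agrees with \<open>Q P f P Q\<close> up to finite rank, so by the previous lemma it is enough to study the
  latter. There the middle factor \<open>P Q P\<close> differs from \<open>P\<close> by \<open>\<kappa>\<close> of finite rank. Without \<open>\<kappa>\<close> the commutator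
  would vanish because \<open>P f P\<close> and \<open>P g P\<close> commute; the terms containing \<open>\<kappa>\<close> cancel in the trace by
  cyclicity.\<close>

lemma trace_compressed_commutator_eq_0:
  assumes lin: "endo f" "endo g" "endo P" "endo Q"
    and idem: "\<And>v. P (P v) = P v" "\<And>v. Q (Q v) = Q v"
    and comm: "\<And>v. f (g v) = g (f v)"
    and ker: "\<And>v. P (f (P v)) = P (f v)" "\<And>v. P (g (P v)) = P (g v)"
    and k: "finite_rank (\<lambda>v. P (Q (P v)) - P v)"
    and fQ: "finite_rank (\<lambda>v. f (Q v) - P (f (Q v)))"
    and gQ: "finite_rank (\<lambda>v. g (Q v) - P (g (Q v)))"
  shows "trace (\<lambda>v. Q (f (Q (Q (g (Q v))))) - Q (g (Q (Q (f (Q v)))))) = 0"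
proof -
  define \<kappa> where "\<kappa> = (\<lambda>v. P (Q (P v)) - P v)"
  define f' where "f' = (\<lambda>v. P (f (P v)))"
  define g' where "g' = (\<lambda>v. P (g (P v)))"
  have e: "endo \<kappa>" "endo f'" "endo g'" "finite_rank \<kappa>"
    unfolding \<kappa>_def f'_def g'_def
    using endo_diff[OF endo_comp[OF lin(3) endo_comp[OF lin(4) lin(3)]] lin(3)]
      endo_comp[OF lin(3) endo_comp[OF lin(1) lin(3)]]
      endo_comp[OF lin(3) endo_comp[OF lin(2) lin(3)]] k by simp_all
  have PQP: "P (Q (P v)) = P v + \<kappa> v" for v by (simp add: \<kappa>_def)
  have fg': "f' (g' v) = g' (f' v)" for v
    by (simp add: f'_def g'_def ker idem comm)
  have Pf': "P (f' v) = f' v" "P (g' v) = g' v" "f' (P v) = f' v" "g' (P v) = g' v" for v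
    by (simp_all add: f'_def g'_def idem)
  \<comment> \<open>the compression of \<open>f\<close> to the image of \<open>P\<close>, transported to the image of \<open>Q\<close>\<close>
  define F where "F = (\<lambda>v. Q (f' (Q v)))"
  define G where "G = (\<lambda>v. Q (g' (Q v)))"
  have eFG: "endo F" "endo G" unfolding F_def G_def
    using endo_comp[OF lin(4) endo_comp[OF e(2) lin(4)]] endo_comp[OF lin(4) endo_comp[OF e(3) lin(4)]]
    by simp_all
  have f'Qg': "f' (Q (g' v)) = f' (g' v) + f' (\<kappa> (g' v))" for v
  proof -
    have "f' (Q (g' v)) = f' (P (Q (P (g' v))))" by (simp only: Pf')
    also have "\<dots> = f' (P (g' v) + \<kappa> (g' v))" by (simp only: PQP)
    finally show ?thesis by (simp add: endoD[OF e(2)] Pf')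
  qed
  have g'Qf': "g' (Q (f' v)) = g' (f' v) + g' (\<kappa> (f' v))" for v
  proof -
    have "g' (Q (f' v)) = g' (P (Q (P (f' v))))" by (simp only: Pf')
    also have "\<dots> = g' (P (f' v) + \<kappa> (f' v))" by (simp only: PQP)
    finally show ?thesis by (simp add: endoD[OF e(3)] Pf')
  qed
  define U where "U = (\<lambda>v. Q (f' (\<kappa> (g' (Q v)))))"
  define W where "W = (\<lambda>v. Q (g' (\<kappa> (f' (Q v)))))"
  have com: "(\<lambda>v. F (G v) - G (F v)) = (\<lambda>v. U v - W v)"
    by (simp add: fun_eq_iff F_def G_def U_def W_def idem f'Qg' g'Qf' fg' endoD[OF lin(4)])
  have fr: "finite_rank (\<lambda>v. \<kappa> (g' (Q v)))" "finite_rank (\<lambda>v. \<kappa> (f' (Q v)))"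
    by (rule finite_rank_comp_right[OF e(4)])+
  have frUW: "finite_rank U" "finite_rank W"
    unfolding U_def W_def
    by (rule finite_rank_comp_left[OF finite_rank_comp_left[OF finite_rank_comp_right[OF e(4)] e(2)] lin(4)])
      (rule finite_rank_comp_left[OF finite_rank_comp_left[OF finite_rank_comp_right[OF e(4)] e(3)] lin(4)])
  have tr: "trace (\<lambda>v. Q (a (\<kappa> (b (Q v))))) = trace (\<lambda>v. \<kappa> (b (a v))) + trace (\<lambda>v. \<kappa> (b (\<kappa> (a v))))"
    if ab: "endo a" "endo b" "\<And>v. P (a v) = a v" "\<And>v. b (P v) = b v" for a b
  proof -
    have 1: "trace (\<lambda>v. Q (a (\<kappa> (b (Q v))))) = trace (\<lambda>v. \<kappa> (b (Q (Q (a v)))))"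
      by (rule trace_comm[OF endo_comp[OF lin(4) ab(1)] endo_comp[OF e(1) endo_comp[OF ab(2) lin(4)]]
          finite_rank_comp_right[OF e(4)]])
    have "b (Q (a v)) = b (a v) + b (\<kappa> (a v))" for v
    proof -
      have "b (Q (a v)) = b (P (Q (P (a v))))" by (simp only: ab)
      also have "\<dots> = b (P (a v) + \<kappa> (a v))" by (simp only: PQP)
      finally show ?thesis by (simp add: endoD[OF ab(2)] ab)
    qed
    then have 2: "(\<lambda>v. \<kappa> (b (Q (Q (a v))))) = (\<lambda>v. \<kappa> (b (a v)) + \<kappa> (b (\<kappa> (a v))))"
      by (simp add: idem endoD[OF e(1)])
    show ?thesis unfolding 1 2
      by (rule trace_add[OF finite_rank_comp_right[OF e(4)] finite_rank_comp_right[OF e(4)]])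
  qed
  have "trace U = trace (\<lambda>v. \<kappa> (g' (f' v))) + trace (\<lambda>v. \<kappa> (g' (\<kappa> (f' v))))"
    unfolding U_def by (rule tr) (auto simp: e Pf')
  moreover have "trace W = trace (\<lambda>v. \<kappa> (f' (g' v))) + trace (\<lambda>v. \<kappa> (f' (\<kappa> (g' v))))"
    unfolding W_def by (rule tr) (auto simp: e Pf')
  moreover have "trace (\<lambda>v. \<kappa> (g' (\<kappa> (f' v)))) = trace (\<lambda>v. \<kappa> (f' (\<kappa> (g' v))))"
    by (rule trace_comm[OF endo_comp[OF e(1,3)] endo_comp[OF e(1,2)] finite_rank_comp_right[OF e(4)]])
  ultimately have UW: "trace U = trace W" by (simp add: fg')
  have c0: "trace (\<lambda>v. F (G v) - G (F v)) = 0" "finite_rank (\<lambda>v. F (G v) - G (F v))"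
    unfolding com using trace_diff[OF frUW] finite_rank_diff[OF frUW] UW by auto
  have "trace (\<lambda>v. (\<lambda>v. Q (f (Q v))) ((\<lambda>v. Q (g (Q v))) v) - (\<lambda>v. Q (g (Q v))) ((\<lambda>v. Q (f (Q v))) v))
      = trace (\<lambda>v. F (G v) - G (F v))"
  proof (rule trace_commutator_perturb[OF eFG _ _ _ _ c0(2)])
    show "endo (\<lambda>v. Q (f (Q v)))" "endo (\<lambda>v. Q (g (Q v)))"
      using endo_comp[OF lin(4) endo_comp[OF lin(1,4)]] endo_comp[OF lin(4) endo_comp[OF lin(2,4)]]
      by simp_all
    have "finite_rank (\<lambda>v. Q (f (Q v) - P (f (Q v))))" by (rule finite_rank_comp_left[OF fQ lin(4)])
    then show "finite_rank (\<lambda>v. Q (f (Q v)) - F v)" by (simp add: F_def f'_def ker endoD[OF lin(4)])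
    have "finite_rank (\<lambda>v. Q (g (Q v) - P (g (Q v))))" by (rule finite_rank_comp_left[OF gQ lin(4)])
    then show "finite_rank (\<lambda>v. Q (g (Q v)) - G v)" by (simp add: G_def g'_def ker endoD[OF lin(4)])
  qed
  then show ?thesis using c0(1) by simp
qed

lemma endo_image_span:
  assumes "endo T" "u \<in> span B" shows "T u \<in> span (T ` B)"
proof -
  interpret T: Vector_Spaces.linear scale scale T by fact
  show ?thesis using assms(2) T.span_image[of B] by blast
qed

text \<open>A basis of \<open>R\<close> is extended first by vectors of \<open>A\<close> and then by finitely many vectors \<open>E\<close> of \<open>T\<close>. The
  projection kills the first part and fixes the rest, so it moves an element of \<open>A\<close> only by an element
  of \<open>R \<inter> A\<close>.\<close>

lemma projection_along:
  assumes R: "subspace R" and A: "subspace A" and T: "finite T"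
    and sum: "\<And>v. \<exists>r\<in>R. \<exists>a\<in>A. \<exists>t\<in>span T. v = r + a + t"
  obtains P E where "endo P" "finite E" "\<And>r. r \<in> R \<Longrightarrow> P r = 0" "\<And>v. v - P v \<in> R"
    "\<And>a. a \<in> A \<Longrightarrow> P a \<in> A" "\<And>v. \<exists>a\<in>A. \<exists>e\<in>span E. P v = a + e"
proof -
  obtain BR where BR: "BR \<subseteq> R" "independent BR" "R \<subseteq> span BR"
    using maximal_independent_subset[of R] by blast
  obtain B1 where B1: "BR \<subseteq> B1" "B1 \<subseteq> BR \<union> A" "independent B1" "BR \<union> A \<subseteq> span B1"
    using maximal_independent_subset_extend[of BR "BR \<union> A"] BR(2) by blast
  obtain B where B: "B1 \<subseteq> B" "B \<subseteq> B1 \<union> T" "independent B" "B1 \<union> T \<subseteq> span B"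
    using maximal_independent_subset_extend[of B1 "B1 \<union> T"] B1(3) by blast
  have span_BR: "span BR \<subseteq> R" by (rule span_minimal[OF BR(1) R])
  have mono: "span BR \<subseteq> span B1" "span B1 \<subseteq> span B" by (auto intro!: span_mono B1 B)
  have UN: "v \<in> span B" for v
  proof -
    obtain r a t where v: "r \<in> R" "a \<in> A" "t \<in> span T" "v = r + a + t" using sum by blast
    have "t \<in> span B" using v(3) span_mono[of T "span B"] B(4) by (auto simp: span_span)
    moreover have "r \<in> span B" "a \<in> span B" using v(1,2) BR(3) B1(4) mono by blast+
    ultimately show ?thesis unfolding v(4) by (intro span_add)
  qed
  interpret p: vector_space_pair scale scale by unfold_locales
  define P where "P = p.construct B (\<lambda>b. if b \<in> BR then 0 else b)"
  have P: "endo P" unfolding P_def by (rule p.linear_construct[OF B(3)])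
  have Pb: "P b = (if b \<in> BR then 0 else b)" if "b \<in> B" for b
    unfolding P_def by (rule p.construct_basis[OF B(3) that])
  have PR: "P r = 0" if "r \<in> span BR" for r
    using that
  proof (induction rule: span_induct_alt)
    case base show ?case by (rule endoD(4)[OF P])
  next
    case (step c x y)
    then have "P x = 0" using Pb[of x] B1(1) B(1) by auto
    then show ?case using step by (simp add: endoD[OF P])
  qed
  have PN: "P v = v" if "v \<in> span (B - BR)" for v
    using that
  proof (induction rule: span_induct_alt)
    case base show ?case by (rule endoD(4)[OF P])
  next
    case (step c x y)
    then have "P x = x" using Pb[of x] by auto
    then show ?case using step by (simp add: endoD[OF P])
  qed
  define E where "E = B - B1"
  have A1: "span (B1 - BR) \<subseteq> A" by (rule span_minimal[OF _ A]) (use B1(2) in auto)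
  have split: "\<exists>r\<in>span BR. \<exists>a\<in>span (B1 - BR). v = r + a" if "v \<in> span B1" for v
  proof -
    have "B1 = BR \<union> (B1 - BR)" using B1(1) by blast
    then have "v \<in> span (BR \<union> (B1 - BR))" using that by simp
    then show ?thesis unfolding span_Un by blast
  qed
  have Pv: "\<exists>a\<in>span (B1 - BR). \<exists>e\<in>span E. P v = a + e \<and> v - P v \<in> span BR" for v
  proof -
    have "B = B1 \<union> E" using B(1) by (auto simp: E_def)
    then have "v \<in> span (B1 \<union> E)" using UN by simp
    then obtain w e where w: "w \<in> span B1" "e \<in> span E" "v = w + e" unfolding span_Un by blast
    obtain r a where r: "r \<in> span BR" "a \<in> span (B1 - BR)" "w = r + a" using split[OF w(1)] by blast
    have "span E \<subseteq> span (B - BR)" "span (B1 - BR) \<subseteq> span (B - BR)"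
      using B(1) B1(1) by (auto intro!: span_mono simp: E_def)
    then have "P e = e" "P a = a" using PN w(2) r(2) by auto
    then have "P v = a + e" using PR[OF r(1)] by (simp add: w(3) r(3) endoD[OF P])
    moreover from this have "v - P v = r" by (simp add: w(3) r(3))
    ultimately show ?thesis using r w by auto
  qed
  show thesis
  proof (rule that[of P E])
    show "endo P" by (rule P)
    show "finite E" using B(2) T by (auto simp: E_def intro: finite_subset)
    show "P r = 0" if "r \<in> R" for r using PR BR(3) that by blast
    show "v - P v \<in> R" for v using Pv[of v] span_BR by blast
    show "P a \<in> A" if "a \<in> A" for a
    proof -
      obtain r a' where r: "r \<in> span BR" "a' \<in> span (B1 - BR)" "a = r + a'" using split[of a] B1(4) \<open>a \<in> A\<close> by blast
      have "span (B1 - BR) \<subseteq> span (B - BR)" using B(1) by (auto intro!: span_mono)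
      then have "P a = a'" using PR[OF r(1)] PN r(2) by (simp add: r(3) endoD[OF P]) blast
      then show ?thesis using r(2) A1 by blast
    qed
    show "\<exists>a\<in>A. \<exists>e\<in>span E. P v = a + e" for v using Pv[of v] A1 by blast
  qed
qed

text \<open>The vanishing half of the residue theorem, as linear algebra: \<open>R\<close> plays the functions with poles in a
  finite set and \<open>A\<close> the power series. The hypotheses on \<open>f Q\<close> and \<open>g Q\<close> say that multiplication by a
  function creates only finitely many polar terms.\<close>

theorem trace_commutator_eq_0_of_complement:
  assumes lin: "endo f" "endo g" "endo Q" and comm: "\<And>v. f (g v) = g (f v)"
    and R: "subspace R" "\<And>r. r \<in> R \<Longrightarrow> f r \<in> R" "\<And>r. r \<in> R \<Longrightarrow> g r \<in> R"
    and A: "subspace A" "\<And>v. Q v \<in> A" "\<And>a. a \<in> A \<Longrightarrow> Q a = a"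
    and fin: "finite C" "finite T" and RA: "R \<inter> A \<subseteq> span C"
    and sum: "\<And>v. \<exists>r\<in>R. \<exists>a\<in>A. \<exists>t\<in>span T. v = r + a + t"
    and fQ: "\<And>v. \<exists>a\<in>A. \<exists>t\<in>span T. f (Q v) = a + t"
    and gQ: "\<And>v. \<exists>a\<in>A. \<exists>t\<in>span T. g (Q v) = a + t"
  shows "trace (\<lambda>v. Q (f (Q (Q (g (Q v))))) - Q (g (Q (Q (f (Q v)))))) = 0"
proof -
  obtain P E where P: "endo P" "finite E" "\<And>r. r \<in> R \<Longrightarrow> P r = 0" "\<And>v. v - P v \<in> R"
    "\<And>a. a \<in> A \<Longrightarrow> P a \<in> A" "\<And>v. \<exists>a\<in>A. \<exists>e\<in>span E. P v = a + e"
    by (rule projection_along[OF R(1) A(1) fin(2) sum]) blast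
  have PP: "P (P v) = P v" for v using P(3)[OF P(4)[of v]] by (simp add: endoD[OF P(1)])
  have ker: "P (h (P v)) = P (h v)" if "endo h" "\<And>r. r \<in> R \<Longrightarrow> h r \<in> R" for h v
    using P(3)[OF that(2)[OF P(4)[of v]]] by (simp add: endoD[OF P(1)] endoD[OF that(1)])
  have fr: "finite_rank (\<lambda>v. h (Q v) - P (h (Q v)))" if h: "\<And>v. \<exists>a\<in>A. \<exists>t\<in>span T. h (Q v) = a + t" for h
    unfolding finite_rank_def
  proof (intro exI conjI)
    let ?T = "(\<lambda>v. v - P v) ` T"
    show "finite (C \<union> ?T)" using fin by simp
    have "h (Q v) - P (h (Q v)) \<in> span (C \<union> ?T)" for v
    proof -
      obtain a t where at: "a \<in> A" "t \<in> span T" "h (Q v) = a + t" using h by blast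
      have "a - P a \<in> R \<inter> A" using P(4) subspace_diff[OF A(1) at(1) P(5)[OF at(1)]] by blast
      then have "a - P a \<in> span (C \<union> ?T)" using RA span_mono[of C "C \<union> ?T"] by blast
      moreover have "t - P t \<in> span (C \<union> ?T)"
        using endo_image_span[OF endo_diff[OF endo_id P(1)] at(2)] span_mono[of ?T "C \<union> ?T"] by blast
      moreover have "h (Q v) - P (h (Q v)) = (a - P a) + (t - P t)" by (simp add: at(3) endoD[OF P(1)])
      ultimately show ?thesis by (simp only: span_add)
    qed
    then show "range (\<lambda>v. h (Q v) - P (h (Q v))) \<subseteq> span (C \<union> ?T)" by blast
  qed
  have "finite_rank (\<lambda>v. P (Q (P v)) - P v)" unfolding finite_rank_def
  proof (intro exI conjI)
    let ?E = "(\<lambda>v. P (Q v) - P v) ` E"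
    show "finite ?E" using P(2) by simp
    have lin': "endo (\<lambda>v. P (Q v) - P v)" by (rule endo_diff[OF endo_comp[OF P(1) lin(3)] P(1)])
    have "P (Q (P v)) - P v \<in> span ?E" for v
    proof -
      obtain a e where ae: "a \<in> A" "e \<in> span E" "P v = a + e" using P(6) by blast
      have "P (Q (P v)) - P v = P (Q (P v)) - P (P v)" by (simp add: PP)
      also have "\<dots> = P (Q e) - P e" using A(3)[OF ae(1)] by (simp add: ae(3) endoD[OF P(1)] endoD[OF lin(3)])
      finally show ?thesis using endo_image_span[OF lin' ae(2)] by (simp only:)
    qed
    then show "range (\<lambda>v. P (Q (P v)) - P v) \<subseteq> span ?E" by blast
  qed
  moreover have "Q (Q v) = Q v" for v using A(2,3) by blast
  ultimately show ?thesis
    using ker[of f, OF lin(1) R(2)] ker[of g, OF lin(2) R(3)] fr[of f, OF fQ] fr[of g, OF gQ]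
    by (intro trace_compressed_commutator_eq_0[OF lin(1,2) P(1) lin(3) PP _ comm]) simp_all
qed

end

section \<open>Laurent series and their residues\<close>

lemma val_ge_iff: "val_ge s n \<longleftrightarrow> (\<forall>k<n. s $$ k = 0)"
  unfolding val_ge_def
  by (metis fls_eq0_below_subdegree fls_subdegree_geI fls_zero_nth order_less_le_trans)

lemma val_ge_add: "val_ge s n \<Longrightarrow> val_ge u n \<Longrightarrow> val_ge (s + u) n"
  by (simp add: val_ge_iff)

lemma val_ge_diff: "val_ge s n \<Longrightarrow> val_ge u n \<Longrightarrow> val_ge (s - u) n"
  by (simp add: val_ge_iff)

lemma val_ge_zero [simp]: "val_ge 0 n"
  by (simp add: val_ge_def)

lemma val_ge_mono: "val_ge s n \<Longrightarrow> m \<le> n \<Longrightarrow> val_ge s m"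
  by (simp add: val_ge_iff)

lemma val_ge_sum: "(\<And>i. i \<in> I \<Longrightarrow> val_ge (s i) n) \<Longrightarrow> val_ge (sum s I) n"
  by (induction I rule: infinite_finite_induct) (auto intro: val_ge_add)

lemma val_ge_mult:
  fixes s u :: "'k::field fls"
  assumes "val_ge s m" "val_ge u n" shows "val_ge (s * u) (m + n)"
  using assms unfolding val_ge_def by (cases "s = 0"; cases "u = 0") (auto simp: fls_subdegree_mult)

lemma val_ge_power: "val_ge s m \<Longrightarrow> val_ge (s ^ n) (int n * m)" for s :: "'k::field fls"
proof (induction n)
  case (Suc n)
  then show ?case using val_ge_mult[of s m "s ^ n" "int n * m"] by (simp add: algebra_simps)
qed (simp add: val_ge_def)

lemma val_ge_deriv:
  fixes s :: "'k::field_char_0 fls"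
  assumes "val_ge s 0" shows "val_ge (fls_deriv s) 0"
  unfolding val_ge_iff
proof (intro allI impI)
  fix k :: int assume "k < 0"
  then show "fls_deriv s $$ k = 0" using assms by (cases "k = - 1") (auto simp: val_ge_iff)
qed

lemma val_ge_bound:
  fixes s :: "'p \<Rightarrow> 'k::field fls"
  assumes "finite S" shows "\<exists>M. \<forall>p\<in>S. val_ge (s p) (- int M)"
proof -
  define M where "M = (\<Sum>p\<in>S. nat \<bar>fls_subdegree (s p)\<bar>)"
  have "val_ge (s p) (- int M)" if "p \<in> S" for p
  proof -
    have "nat \<bar>fls_subdegree (s p)\<bar> \<le> M" unfolding M_def using assms that by (intro member_le_sum) auto
    then show ?thesis unfolding val_ge_def by linarith
  qed
  then show ?thesis by blast
qed

text \<open>In characteristic zero integration raises the valuation by one, except that the constant term is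
  arbitrary; hence the bound by zero.\<close>

lemma val_ge_antideriv:
  fixes s :: "'k::field_char_0 fls"
  assumes "val_ge (fls_deriv s) m" "n \<le> m + 1" "n \<le> 0" shows "val_ge s n"
  unfolding val_ge_iff
proof (intro allI impI)
  fix k assume k: "k < n"
  have "fls_deriv s $$ (k - 1) = 0" using assms(1,2) k by (simp add: val_ge_iff del: fls_deriv_nth)
  moreover have "(of_int k :: 'k) \<noteq> 0" using k assms(3) by simp
  ultimately show "s $$ k = 0" by simp
qed

lemma residue_regular: "val_ge s 0 \<Longrightarrow> fls_residue s = 0"
  by (simp add: val_ge_iff)

lemma residue_by_parts: "fls_residue (s * fls_deriv u) = - fls_residue (u * fls_deriv s)"
  for s u :: "'k::field fls"
  using fls_residue_times_deriv[of u s] by (simp only: mult.commute)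

lemma residue_self_deriv: "fls_residue (s * fls_deriv s) = 0" for s :: "'k::field_char_0 fls"
  using residue_by_parts[of s s] by (simp only: eq_neg_iff_add_eq_0) simp

lemma times_shift_one: "f * fls_shift n 1 = fls_shift n (f :: 'k::field fls)"
  using fls_X_intpow_times_conv_shift(2)[of f "- n"] by simp

lemma fls_mult_nth_bounds:
  fixes f g :: "'k::field fls"
  assumes "val_ge f A" "val_ge g B"
  shows "(f * g) $$ n = (\<Sum>k=A..n - B. f $$ k * g $$ (n - k))"
proof (cases "f = 0 \<or> g = 0")
  case False
  then have "(f * g) $$ n = (\<Sum>k=fls_subdegree f..n - fls_subdegree g. f $$ k * g $$ (n - k))"
    by (simp add: fls_times_nth(2))
  also have "\<dots> = (\<Sum>k=A..n - B. f $$ k * g $$ (n - k))"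
  proof (intro sum.mono_neutral_left ballI)
    show "{fls_subdegree f..n - fls_subdegree g} \<subseteq> {A..n - B}"
      using assms False by (auto simp: val_ge_def)
    fix k assume "k \<in> {A..n - B} - {fls_subdegree f..n - fls_subdegree g}"
    then show "f $$ k * g $$ (n - k) = 0" by (cases "k < fls_subdegree f") auto
  qed simp
  finally show ?thesis .
qed auto

text \<open>Grouping opposite exponents brings the residue into the shape in which the traces below produce it.\<close>

lemma residue_as_sum:
  fixes f g :: "'k::field_char_0 fls"
  assumes "val_ge f (- int M)" "val_ge g (- int M)"
  shows "fls_residue (f * fls_deriv g)
    = (\<Sum>n=1..M. of_nat n * f $$ (- int n) * g $$ int n) - (\<Sum>n=1..M. of_nat n * f $$ int n * g $$ (- int n))"
proof -
  have "val_ge (fls_deriv g) (- int M - 1)" using assms(2) by (simp add: val_ge_iff)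
  then have "fls_residue (f * fls_deriv g) = (\<Sum>k=- int M..int M. - (of_int k * f $$ k * g $$ (- k)))"
    unfolding fls_residue_def fls_mult_nth_bounds[OF assms(1) \<open>val_ge (fls_deriv g) _\<close>]
    by (intro sum.cong) (auto simp: algebra_simps)
  also have "{- int M..int M} = (\<lambda>n. - int n) ` {1..M} \<union> ({0} \<union> int ` {1..M})" (is "_ = ?A \<union> ({0} \<union> ?B)")
  proof (intro equalityI subsetI)
    fix k assume "k \<in> {- int M..int M}"
    then show "k \<in> ?A \<union> ({0} \<union> ?B)"
      using image_eqI[of k "\<lambda>n. - int n" "nat (- k)" "{1..M}"] image_eqI[of k int "nat k" "{1..M}"]
      by (cases k "0 :: int" rule: linorder_cases) (auto simp: Suc_le_eq nat_le_iff)
  qed auto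
  also have "(\<Sum>k\<in>?A \<union> ({0} \<union> ?B). - (of_int k * f $$ k * g $$ (- k)))
     = (\<Sum>k\<in>?A. - (of_int k * f $$ k * g $$ (- k))) + (\<Sum>k\<in>?B. - (of_int k * f $$ k * g $$ (- k)))"
    by (subst sum.union_disjoint) (auto simp: sum.insert_if)
  also have "(\<Sum>k\<in>?A. - (of_int k * f $$ k * g $$ (- k))) = (\<Sum>n=1..M. of_nat n * f $$ (- int n) * g $$ int n)"
    by (subst sum.reindex) (auto simp: inj_on_def)
  also have "(\<Sum>k\<in>?B. - (of_int k * f $$ k * g $$ (- k))) = - (\<Sum>n=1..M. of_nat n * f $$ int n * g $$ (- int n))"
    by (subst sum.reindex) (auto simp: inj_on_def sum_negf)
  finally show ?thesis by simp
qed

text \<open>The diagonal entry, at the basis vector \<open>t\<^sup>-\<^sup>i\<close>, of \<open>f\<close> followed by truncation followed by \<open>g\<close>.\<close>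

lemma double_truncation_coefficient:
  fixes f g :: "'k::field fls"
  assumes g: "val_ge g (- int M)" and i: "1 \<le> i" "i \<le> M"
  shows "(g * fls_regpart_as_fls (f * fls_X_intpow (- int i))) $$ (- int i)
    = (\<Sum>n=i..M. f $$ int n * g $$ (- int n))"
proof -
  let ?h = "fls_regpart_as_fls (f * fls_X_intpow (- int i))"
  have h: "val_ge ?h 0" by (simp add: val_ge_iff)
  have hk: "?h $$ k = f $$ (k + int i)" if "k \<ge> 0" for k
    using that by (simp add: times_shift_one)
  have "(g * ?h) $$ (- int i) = (\<Sum>k=0..- int i - - int M. ?h $$ k * g $$ (- int i - k))"
    by (subst mult.commute) (rule fls_mult_nth_bounds[OF h g])
  also have "\<dots> = (\<Sum>k=0..int M - int i. f $$ (k + int i) * g $$ (- (k + int i)))"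
  proof (rule sum.cong)
    fix k assume "k \<in> {0..int M - int i}"
    moreover have "- int i - k = - (k + int i)" by simp
    ultimately show "?h $$ k * g $$ (- int i - k) = f $$ (k + int i) * g $$ (- (k + int i))"
      using hk by (metis atLeastAtMost_iff)
  qed simp
  also have "\<dots> = (\<Sum>n=i..M. f $$ int n * g $$ (- int n))"
    using i by (intro sum.reindex_bij_witness[of _ "\<lambda>n. int n - int i" "\<lambda>k. nat (k + int i)"]) auto
  finally show ?thesis .
qed

lemma sum_triangle: 
  fixes c :: "nat \<Rightarrow> 'k::comm_ring_1"
  shows "(\<Sum>i=1..M. \<Sum>n=i..M. c n) = (\<Sum>n=1..M. of_nat n * c n)"
proof -
  have "(\<Sum>i=1..M. \<Sum>n=i..M. c n) = (\<Sum>i=1..M. \<Sum>n=1..M. if i \<le> n then c n else 0)"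
    by (intro sum.cong refl sum.mono_neutral_cong_left) auto
  also have "\<dots> = (\<Sum>n=1..M. \<Sum>i=1..M. if i \<le> n then c n else 0)" by (rule sum.swap)
  also have "\<dots> = (\<Sum>n=1..M. of_nat n * c n)"
  proof (intro sum.cong refl)
    fix n assume n: "n \<in> {1..M}"
    have "(\<Sum>i=1..M. if i \<le> n then c n else 0) = (\<Sum>i=1..n. c n)"
      using n by (intro sum.mono_neutral_cong_right) auto
    then show "(\<Sum>i=1..M. if i \<le> n then c n else 0) = of_nat n * c n" by simp
  qed
  finally show ?thesis .
qed

lemma polar_part_eq:
  fixes y :: "'k::field fls"
  assumes "val_ge y (- int M)"
  shows "y - fls_regpart_as_fls y = (\<Sum>i=1..M. fls_const (y $$ (- int i)) * fls_X_intpow (- int i))"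
proof (rule fls_eqI)
  fix n :: int
  have "(\<Sum>i=1..M. fls_const (y $$ (- int i)) * fls_X_intpow (- int i)) $$ n
      = (\<Sum>i=1..M. if i = nat (- n) then y $$ (- int i) else 0)"
    unfolding fls_nth_sum by (intro sum.cong refl) auto
  also have "\<dots> = (if nat (- n) \<in> {1..M} then y $$ n else 0)"
    by (subst sum.delta) (auto simp: le_nat_iff)
  also have "\<dots> = (y - fls_regpart_as_fls y) $$ n"
    using assms by (auto simp: val_ge_iff)
  finally show "(y - fls_regpart_as_fls y) $$ n = (\<Sum>i=1..M. fls_const (y $$ (- int i)) * fls_X_intpow (- int i)) $$ n"
    by simp
qed

section \<open>Truncation at finitely many points\<close>

lemma sum_apply_point: "(\<Sum>i\<in>I. h i) q = (\<Sum>i\<in>I. h i q)"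
  for h :: "'i \<Rightarrow> 'p \<Rightarrow> 'c::comm_monoid_add"
  by (induction I rule: infinite_finite_induct) auto

definition series_scale :: "'k::field \<Rightarrow> ('p \<Rightarrow> 'k fls) \<Rightarrow> 'p \<Rightarrow> 'k fls" where
  "series_scale c v = (\<lambda>p. fls_const c * v p)"

definition mult_on :: "'p set \<Rightarrow> ('p \<Rightarrow> 'k::field fls) \<Rightarrow> ('p \<Rightarrow> 'k fls) \<Rightarrow> 'p \<Rightarrow> 'k fls" where
  "mult_on S a v = (\<lambda>p. if p \<in> S then a p * v p else 0)"

text \<open>Components outside \<open>S\<close> are kept, so that they belong to the image of the truncation and need no
  separate treatment; multiplication operators annihilate them.\<close>

definition truncate_on :: "'p set \<Rightarrow> ('p \<Rightarrow> 'k::field fls) \<Rightarrow> 'p \<Rightarrow> 'k fls" where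
  "truncate_on S v = (\<lambda>p. if p \<in> S then fls_regpart_as_fls (v p) else v p)"

interpretation series: operator_trace "series_scale :: 'k::field \<Rightarrow> ('p \<Rightarrow> 'k fls) \<Rightarrow> _"
  by unfold_locales (auto simp: series_scale_def fun_eq_iff algebra_simps 
    simp flip: fls_const_mult_const fls_plus_const)

lemma regpart_lin:
  fixes u v :: "'k::field fls"
  shows "fls_regpart_as_fls (u + v) = fls_regpart_as_fls u + fls_regpart_as_fls v"
    "fls_regpart_as_fls (fls_const c * v) = fls_const c * fls_regpart_as_fls v"
  by (auto intro!: fls_eqI)

lemma endo_mult_on: "series.endo (mult_on S a)"
  by (intro series.endoI) (auto simp: mult_on_def series_scale_def fun_eq_iff algebra_simps)

lemma endo_truncate_on: "series.endo (truncate_on S :: ('p \<Rightarrow> 'k::field fls) \<Rightarrow> _)"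
  by (intro series.endoI)
    (auto simp: truncate_on_def series_scale_def fun_eq_iff regpart_lin simp del: fls_regpart_plus)

lemma truncate_on_idem: "truncate_on S (truncate_on S v) = truncate_on S v"
  by (simp add: truncate_on_def fun_eq_iff)

lemma polar_decomposition:
  fixes v :: "'p \<Rightarrow> 'k::field fls"
  assumes S: "finite S" and v: "\<And>p. p \<in> S \<Longrightarrow> val_ge (v p) (- int M)"
  shows "\<exists>t\<in>series.span ((\<lambda>(p, i) q. if q = p then fls_X_intpow (- int i) else 0) ` (S \<times> {1..M})).
    v = truncate_on S v + t"
proof -
  let ?e = "\<lambda>(p, i) q. if q = p then fls_X_intpow (- int i) else (0 :: 'k fls)"
  define t where "t = (\<Sum>j\<in>S \<times> {1..M}. series_scale (v (fst j) $$ (- int (snd j))) (?e j))"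
  have "t \<in> series.span (?e ` (S \<times> {1..M}))"
    unfolding t_def by (intro series.span_sum series.span_scale series.span_base imageI)
  moreover have "v = truncate_on S v + t"
  proof
    fix q
    have tq: "t q = (\<Sum>p\<in>S. \<Sum>i=1..M. fls_const (v p $$ (- int i)) * ?e (p, i) q)"
      unfolding t_def sum_apply_point by (simp add: series_scale_def sum.cartesian_product case_prod_beta)
    show "v q = (truncate_on S v + t) q"
    proof (cases "q \<in> S")
      case True
      have "t q = (\<Sum>p\<in>S. if p = q then (\<Sum>i=1..M. fls_const (v p $$ (- int i)) * fls_X_intpow (- int i)) else 0)"
        unfolding tq by (intro sum.cong) auto
      also have "\<dots> = (\<Sum>i=1..M. fls_const (v q $$ (- int i)) * fls_X_intpow (- int i))"
        using S True by simp
      also have "\<dots> = v q - fls_regpart_as_fls (v q)" by (rule polar_part_eq[OF v[OF True], symmetric])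
      finally show ?thesis using True by (simp add: truncate_on_def)
    next
      case False
      have "t q = 0" unfolding tq using False by (intro sum.neutral ballI) auto
      then show ?thesis using False by (simp add: truncate_on_def)
    qed
  qed
  ultimately show ?thesis by blast
qed

text \<open>The polar part of \<open>b (Q v)\<close> involves only finitely many coefficients, so \<open>D\<close> is an explicit sum of
  rank-one operators, indexed by a point \<open>p\<close> and a pole order \<open>i\<close>. The contributions of the pole orders
  \<open>i \<le> n\<close> to \<open>a\<^sub>n b\<^sub>-\<^sub>n\<close> are equal, whence the factor \<open>n\<close>.\<close>

lemma trace_truncated_product:
  fixes a b :: "'p \<Rightarrow> 'k::field fls"
  assumes S: "finite S" and b: "\<And>p. p \<in> S \<Longrightarrow> val_ge (b p) (- int M)"
  defines "D \<equiv> \<lambda>v. truncate_on S (mult_on S a (mult_on S b (truncate_on S v)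
      - truncate_on S (mult_on S b (truncate_on S v))))"
  shows "series.trace D = (\<Sum>p\<in>S. \<Sum>n=1..M. of_nat n * a p $$ int n * b p $$ (- int n))"
    and "series.finite_rank D"
proof -
  define e where "e = (\<lambda>(p :: 'p, i :: nat) q. if q = p then fls_X_intpow (- int i) else (0 :: 'k fls))"
  define w where "w = (\<lambda>j. truncate_on S (mult_on S a (e j)))"
  define \<phi> where "\<phi> = (\<lambda>(p, i :: nat) v. (b p * fls_regpart_as_fls (v p)) $$ (- int i))"
  define I where "I = S \<times> {1..M}"
  interpret s: vector_space "(*) :: 'k \<Rightarrow> 'k \<Rightarrow> 'k" by unfold_locales (auto simp: algebra_simps)
  have fI: "finite I" using S by (simp add: I_def)
  have lin: "Vector_Spaces.linear series_scale (*) (\<phi> j)" for j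
  proof -
    obtain p i where j: "j = (p, i)" by (cases j)
    have "\<phi> j (series_scale c v) = c * \<phi> j v" for c v
    proof -
      have "\<phi> j (series_scale c v) = (b p * (fls_const c * fls_regpart_as_fls (v p))) $$ (- int i)"
        unfolding \<phi>_def j prod.case series_scale_def regpart_lin ..
      also have "\<dots> = (fls_const c * (b p * fls_regpart_as_fls (v p))) $$ (- int i)"
        by (subst mult.left_commute) (rule refl)
      finally show ?thesis by (simp add: \<phi>_def j)
    qed
    then show ?thesis unfolding Vector_Spaces.linear_iff
      by (auto simp: series.vector_space_axioms s.vector_space_axioms \<phi>_def j regpart_lin algebra_simps
        simp del: fls_regpart_plus)
  qed
  have D: "D v = (\<Sum>j\<in>I. series_scale (\<phi> j v) (w j))" for v
  proof
    fix q
    show "D v q = (\<Sum>j\<in>I. series_scale (\<phi> j v) (w j)) q"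
    proof (cases "q \<in> S")
      case False
      have "(\<Sum>j\<in>I. series_scale (\<phi> j v) (w j)) q = (\<Sum>j\<in>I. series_scale (\<phi> j v) (w j) q)"
        by (simp add: sum_apply_point)
      also have "\<dots> = 0" using False
        by (intro sum.neutral) (auto simp: series_scale_def w_def truncate_on_def mult_on_def)
      finally show ?thesis using False by (simp add: D_def truncate_on_def mult_on_def)
    next
      case True
      define y where "y = b q * fls_regpart_as_fls (v q)"
      have "val_ge (fls_regpart_as_fls (v q)) 0" by (simp add: val_ge_iff)
      from val_ge_mult[OF b[OF True] this] have y: "val_ge y (- int M)" by (simp add: y_def)
      have "D v q = fls_regpart_as_fls (a q * (y - fls_regpart_as_fls y))"
        using True by (simp add: D_def truncate_on_def mult_on_def y_def)
      also have "\<dots> = (\<Sum>i=1..M. fls_const (y $$ (- int i)) * fls_regpart_as_fls (a q * fls_X_intpow (- int i)))"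
      proof -
        have "fls_regpart_as_fls (sum h J) = (\<Sum>i\<in>J. fls_regpart_as_fls (h i))" for h :: "nat \<Rightarrow> 'k fls" and J
          by (induction J rule: infinite_finite_induct) (auto simp: regpart_lin simp del: fls_regpart_plus)
        note rp_sum = this
        have "a q * (y - fls_regpart_as_fls y)
            = (\<Sum>i=1..M. fls_const (y $$ (- int i)) * (a q * fls_X_intpow (- int i)))"
          unfolding polar_part_eq[OF y] sum_distrib_left by (intro sum.cong refl) (rule mult.left_commute)
        then show ?thesis by (simp only: rp_sum regpart_lin)
      qed
      also have "\<dots> = (\<Sum>i=1..M. series_scale (\<phi> (q, i) v) (w (q, i)) q)"
        using True by (simp add: series_scale_def \<phi>_def w_def truncate_on_def mult_on_def e_def y_def)
      also have "\<dots> = (\<Sum>p\<in>S. \<Sum>i=1..M. series_scale (\<phi> (p, i) v) (w (p, i)) q)"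
      proof -
        have "(\<Sum>p\<in>S. \<Sum>i=1..M. series_scale (\<phi> (p, i) v) (w (p, i)) q)
          = (\<Sum>p\<in>{q}. \<Sum>i=1..M. series_scale (\<phi> (p, i) v) (w (p, i)) q)"
        proof (intro sum.mono_neutral_right ballI)
          fix p assume "p \<in> S - {q}"
          then have "q \<noteq> p" by auto
          then have "w (p, i) q = 0" for i
            using True by (simp add: w_def truncate_on_def mult_on_def e_def)
          then show "(\<Sum>i=1..M. series_scale (\<phi> (p, i) v) (w (p, i)) q) = 0"
            by (simp add: series_scale_def)
        qed (use S True in auto)
        then show ?thesis by simp
      qed
      also have "\<dots> = (\<Sum>j\<in>I. series_scale (\<phi> j v) (w j) q)"
        unfolding I_def by (simp add: sum.cartesian_product case_prod_beta)
      finally show ?thesis by (simp add: sum_apply_point)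
    qed
  qed
  show "series.finite_rank D" by (rule series.finite_rank_sum_rank_one[OF fI D])
  have "series.trace D = (\<Sum>j\<in>I. \<phi> j (w j))" by (rule series.trace_sum_rank_one[OF fI lin D])
  also have "\<dots> = (\<Sum>p\<in>S. \<Sum>i=1..M. \<phi> (p, i) (w (p, i)))"
    unfolding I_def by (simp add: sum.cartesian_product case_prod_beta)
  also have "\<dots> = (\<Sum>p\<in>S. \<Sum>i=1..M. \<Sum>n=i..M. a p $$ int n * b p $$ (- int n))"
  proof (intro sum.cong refl)
    fix p i assume p: "p \<in> S" and i: "i \<in> {1..M}"
    have "\<phi> (p, i) (w (p, i)) = (b p * fls_regpart_as_fls (a p * fls_X_intpow (- int i))) $$ (- int i)"
      using p by (simp add: \<phi>_def w_def truncate_on_def mult_on_def e_def)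
    then show "\<phi> (p, i) (w (p, i)) = (\<Sum>n=i..M. a p $$ int n * b p $$ (- int n))"
      using double_truncation_coefficient[OF b[OF p]] i by (simp only: atLeastAtMost_iff)
  qed
  also have "\<dots> = (\<Sum>p\<in>S. \<Sum>n=1..M. of_nat n * a p $$ int n * b p $$ (- int n))"
    unfolding mult.assoc by (intro sum.cong refl sum_triangle)
  finally show "series.trace D = (\<Sum>p\<in>S. \<Sum>n=1..M. of_nat n * a p $$ int n * b p $$ (- int n))" .
qed

text \<open>As \<open>f\<close> and \<open>g\<close> commute, the commutator of their compressions is the difference of the two operators
  \<open>Q g (1 - Q) f Q\<close> and \<open>Q f (1 - Q) g Q\<close>, whose traces are known.\<close>

theorem trace_truncated_commutator:
  fixes a b :: "'p \<Rightarrow> 'k::field_char_0 fls"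
  assumes S: "finite S"
  defines "Q \<equiv> truncate_on S" and "f \<equiv> mult_on S a" and "g \<equiv> mult_on S b"
  shows "series.trace (\<lambda>v. Q (f (Q (Q (g (Q v))))) - Q (g (Q (Q (f (Q v))))))
    = (\<Sum>p\<in>S. fls_residue (a p * fls_deriv (b p)))"
proof -
  obtain M1 where M1: "\<And>p. p \<in> S \<Longrightarrow> val_ge (a p) (- int M1)" using val_ge_bound[OF S, of a] by blast
  obtain M2 where M2: "\<And>p. p \<in> S \<Longrightarrow> val_ge (b p) (- int M2)" using val_ge_bound[OF S, of b] by blast
  define M where "M = max M1 M2"
  have a: "val_ge (a p) (- int M)" and b: "val_ge (b p) (- int M)" if "p \<in> S" for p
    using M1[OF that] M2[OF that] by (auto simp: M_def intro: val_ge_mono)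
  define D1 where "D1 = (\<lambda>v. Q (f (g (Q v) - Q (g (Q v)))))"
  define D2 where "D2 = (\<lambda>v. Q (g (f (Q v) - Q (f (Q v)))))"
  have D1: "series.trace D1 = (\<Sum>p\<in>S. \<Sum>n=1..M. of_nat n * a p $$ int n * b p $$ (- int n))"
    "series.finite_rank D1"
    using trace_truncated_product[OF S b, where a = a] unfolding D1_def Q_def f_def g_def by auto
  have D2: "series.trace D2 = (\<Sum>p\<in>S. \<Sum>n=1..M. of_nat n * b p $$ int n * a p $$ (- int n))"
    "series.finite_rank D2"
    using trace_truncated_product[OF S a, where a = b] unfolding D2_def Q_def f_def g_def by auto
  have fg: "f (g v) = g (f v)" for v by (simp add: f_def g_def mult_on_def fun_eq_iff)
  have "series.endo f" "series.endo g" "series.endo Q"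
    by (simp_all add: f_def g_def Q_def endo_mult_on endo_truncate_on)
  note e = this[THEN series.endoD(3)]
  have Q_idem: "Q (Q v) = Q v" for v by (simp add: Q_def truncate_on_idem)
  have "(\<lambda>v. Q (f (Q (Q (g (Q v))))) - Q (g (Q (Q (f (Q v)))))) = (\<lambda>v. D2 v - D1 v)"
    by (simp add: D1_def D2_def e fg Q_idem)
  then have "series.trace (\<lambda>v. Q (f (Q (Q (g (Q v))))) - Q (g (Q (Q (f (Q v))))))
      = series.trace D2 - series.trace D1"
    by (simp only: series.trace_diff[OF D2(2) D1(2)])
  also have "\<dots> = (\<Sum>p\<in>S. fls_residue (a p * fls_deriv (b p)))"
    unfolding D1 D2 sum_subtractf[symmetric]
    by (intro sum.cong refl) (simp add: residue_as_sum[OF a b] sum_subtractf mult.assoc mult.commute[of "b _ $$ _"] del: fls_residue_def)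
  finally show ?thesis .
qed

section \<open>Homogeneous forms\<close>

definition monom_val :: "('n::finite \<Rightarrow> 'k::comm_ring_1) \<Rightarrow> ('n \<Rightarrow>\<^sub>0 nat) \<Rightarrow> 'k" where
  "monom_val a m = (\<Prod>i\<in>UNIV. a i ^ Poly_Mapping.lookup m i)"

definition monom_deg :: "('n::finite \<Rightarrow>\<^sub>0 nat) \<Rightarrow> nat" where
  "monom_deg m = (\<Sum>i\<in>UNIV. Poly_Mapping.lookup m i)"

lemma monom_val_keys: "(\<Prod>i\<in>Poly_Mapping.keys m. a i ^ Poly_Mapping.lookup m i) = monom_val a m"
  unfolding monom_val_def by (rule prod.mono_neutral_left) (auto simp: in_keys_iff)

lemma monom_deg_keys: "(\<Sum>i\<in>Poly_Mapping.keys m. Poly_Mapping.lookup m i) = monom_deg m"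
  unfolding monom_deg_def by (rule sum.mono_neutral_left) (auto simp: in_keys_iff)

lemma monom_val_add: "monom_val a (m + m') = monom_val a m * monom_val a m'"
  by (simp add: monom_val_def lookup_add power_add prod.distrib)

lemma monom_val_0 [simp]: "monom_val a 0 = 1"
  by (simp add: monom_val_def)

lemma monom_val_single: "monom_val a (Poly_Mapping.single j 1) = a j"
proof -
  have "monom_val a (Poly_Mapping.single j 1) = (\<Prod>i\<in>UNIV. if i = j then a j else 1)"
    unfolding monom_val_def by (intro prod.cong) (auto simp: lookup_single when_def)
  then show ?thesis by simp
qed

lemma monom_val_scale: "monom_val (\<lambda>i. c * a i) m = c ^ monom_deg m * monom_val a m"
  by (simp add: monom_val_def monom_deg_def power_mult_distrib prod.distrib power_sum)

lemma monom_deg_add: "monom_deg (m + m') = monom_deg m + monom_deg m'"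
  by (simp add: monom_deg_def lookup_add sum.distrib)

lemma monom_deg_0 [simp]: "monom_deg 0 = 0"
  by (simp add: monom_deg_def)

lemma monom_deg_single: "monom_deg (Poly_Mapping.single j 1) = 1"
  by (simp add: monom_deg_def lookup_single when_def)

lemma homogeneous_iff: "homogeneous e p \<longleftrightarrow> (\<forall>m. Poly_Mapping.lookup p m \<noteq> 0 \<longrightarrow> monom_deg m = e)"
  by (auto simp: homogeneous_def monom_deg_keys in_keys_iff)

lemma mpol_eval_alt:
  assumes "finite A" "Poly_Mapping.keys p \<subseteq> A"
  shows "mpol_eval a p = (\<Sum>m\<in>A. Poly_Mapping.lookup p m * monom_val a m)"
  unfolding mpol_eval_def monom_val_keys
  using assms by (intro sum.mono_neutral_left) (auto simp: in_keys_iff)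

lemma mpol_eval_add: "mpol_eval a (p + q) = mpol_eval a p + mpol_eval a q"
  for a :: "'n::finite \<Rightarrow> 'k::comm_ring_1"
proof -
  let ?A = "Poly_Mapping.keys p \<union> Poly_Mapping.keys q"
  have "Poly_Mapping.keys (p + q) \<subseteq> ?A" by (rule keys_add)
  then show ?thesis by (simp add: mpol_eval_alt[of ?A] lookup_add algebra_simps sum.distrib)
qed

lemma mpol_eval_0 [simp]: "mpol_eval a 0 = 0"
  by (simp add: mpol_eval_def)

lemma mpol_eval_single: "mpol_eval a (Poly_Mapping.single m c) = c * monom_val a m"
  for a :: "'n::finite \<Rightarrow> 'k::comm_ring_1"
  by (subst mpol_eval_alt[of "{m}"]) auto

lemma mpol_eval_1 [simp]: "mpol_eval a 1 = 1"
  for a :: "'n::finite \<Rightarrow> 'k::comm_ring_1"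
  using mpol_eval_single[of a 0 1] by simp

lemma mpol_eval_sum: "mpol_eval a (sum h I) = (\<Sum>i\<in>I. mpol_eval a (h i))"
  for a :: "'n::finite \<Rightarrow> 'k::comm_ring_1"
  by (induction I rule: infinite_finite_induct) (auto simp: mpol_eval_add)

lemma mpol_sum_monomials: "p = (\<Sum>m\<in>Poly_Mapping.keys p. Poly_Mapping.single m (Poly_Mapping.lookup p m))"
  for p :: "('n, 'k::comm_ring_1) mpol"
  by (rule poly_mapping_eqI) (auto simp: lookup_sum lookup_single when_def in_keys_iff)

lemma mpol_eval_mult: "mpol_eval a (p * q) = mpol_eval a p * mpol_eval a q"
  for a :: "'n::finite \<Rightarrow> 'k::comm_ring_1"
proof -
  let ?s = "\<lambda>p m. Poly_Mapping.single m (Poly_Mapping.lookup p m)"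
  have "p * q = (\<Sum>m\<in>Poly_Mapping.keys p. ?s p m) * (\<Sum>m\<in>Poly_Mapping.keys q. ?s q m)"
    by (rule arg_cong2[where f = "(*)"]; rule mpol_sum_monomials)
  also have "\<dots> = (\<Sum>m\<in>Poly_Mapping.keys p. \<Sum>m'\<in>Poly_Mapping.keys q. ?s p m * ?s q m')"
    by (rule sum_product)
  also have "mpol_eval a \<dots> = (\<Sum>m\<in>Poly_Mapping.keys p. \<Sum>m'\<in>Poly_Mapping.keys q.
      mpol_eval a (?s p m) * mpol_eval a (?s q m'))"
    unfolding mpol_eval_sum
    by (intro sum.cong refl) (simp add: mult_single mpol_eval_single monom_val_add)
  also have "\<dots> = mpol_eval a p * mpol_eval a q"
    unfolding sum_product[symmetric] mpol_eval_sum[symmetric] mpol_sum_monomials[symmetric] ..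
  finally show ?thesis .
qed

lemma mpol_eval_power: "mpol_eval a (p ^ n) = mpol_eval a p ^ n"
  for a :: "'n::finite \<Rightarrow> 'k::comm_ring_1"
  by (induction n) (auto simp: mpol_eval_mult)

lemma mpol_eval_diff: "mpol_eval a (p - q) = mpol_eval a p - mpol_eval a q"
  for a :: "'n::finite \<Rightarrow> 'k::comm_ring_1"
  using mpol_eval_add[of a "p - q" q] by simp

lemma mpol_eval_scale:
  fixes a :: "'n::finite \<Rightarrow> 'k::comm_ring_1"
  assumes "homogeneous e p" shows "mpol_eval (\<lambda>i. c * a i) p = c ^ e * mpol_eval a p"
proof -
  have "Poly_Mapping.lookup p m * monom_val (\<lambda>i. c * a i) m = c ^ e * (Poly_Mapping.lookup p m * monom_val a m)" for m
    using assms by (cases "Poly_Mapping.lookup p m = 0") (auto simp: homogeneous_iff monom_val_scale)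
  then show ?thesis
    by (simp add: mpol_eval_alt[OF finite_keys order_refl] sum_distrib_left)
qed

lemma homogeneous_0 [simp]: "homogeneous e (0 :: ('n::finite, 'k::comm_ring_1) mpol)"
  by (simp add: homogeneous_iff)

lemma homogeneous_const: "homogeneous 0 (Poly_Mapping.single 0 c :: ('n::finite, 'k::comm_ring_1) mpol)"
  by (auto simp: homogeneous_iff lookup_single when_def)

lemma homogeneous_1: "homogeneous 0 (1 :: ('n::finite, 'k::comm_ring_1) mpol)"
  using homogeneous_const[of 1] by simp

lemma homogeneous_add: "homogeneous e p \<Longrightarrow> homogeneous e q \<Longrightarrow> homogeneous e (p + q)"
  for p :: "('n::finite, 'k::comm_ring_1) mpol"
  unfolding homogeneous_iff lookup_add by (metis add.right_neutral)

lemma homogeneous_sum: "(\<And>i. i \<in> I \<Longrightarrow> homogeneous e (h i)) \<Longrightarrow> homogeneous e (sum h I)"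
  for h :: "'i \<Rightarrow> ('n::finite, 'k::comm_ring_1) mpol"
  by (induction I rule: infinite_finite_induct) (auto intro: homogeneous_add)

lemma homogeneous_mult: "homogeneous e p \<Longrightarrow> homogeneous e' q \<Longrightarrow> homogeneous (e + e') (p * q)"
  for p :: "('n::finite, 'k::comm_ring_1) mpol"
  unfolding homogeneous_def monom_deg_keys using keys_mult[of p q] by (fastforce simp: monom_deg_add)

lemma homogeneous_power: "homogeneous e p \<Longrightarrow> homogeneous (n * e) (p ^ n)"
  for p :: "('n::finite, 'k::comm_ring_1) mpol"
  by (induction n) (auto simp: homogeneous_1 homogeneous_mult)

definition coord_form :: "'n::finite \<Rightarrow> ('n, 'k::comm_ring_1) mpol" where
  "coord_form i = Poly_Mapping.single (Poly_Mapping.single i 1) 1"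

lemma coord_form [simp]: "mpol_eval a (coord_form i) = a i" "homogeneous 1 (coord_form i)"
proof -
  show "mpol_eval a (coord_form i) = a i" by (simp only: coord_form_def mpol_eval_single monom_val_single mult_1)
  show "homogeneous 1 (coord_form i)"
    unfolding homogeneous_iff coord_form_def using monom_deg_single[of i] by (auto simp: lookup_single when_def)
qed

definition linear_form :: "('n::finite \<Rightarrow> 'k::comm_ring_1) \<Rightarrow> ('n, 'k) mpol" where
  "linear_form c = (\<Sum>i\<in>UNIV. Poly_Mapping.single (Poly_Mapping.single i 1) (c i))"

lemma linear_form: "mpol_eval a (linear_form c) = (\<Sum>i\<in>UNIV. c i * a i)" "homogeneous 1 (linear_form c)"
proof -
  show "mpol_eval a (linear_form c) = (\<Sum>i\<in>UNIV. c i * a i)"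
    by (simp only: linear_form_def mpol_eval_sum mpol_eval_single monom_val_single)
  show "homogeneous 1 (linear_form c)" unfolding linear_form_def
  proof (rule homogeneous_sum)
    show "homogeneous 1 (Poly_Mapping.single (Poly_Mapping.single i 1) (c i))" for i
      unfolding homogeneous_iff using monom_deg_single[of i] by (auto simp: lookup_single when_def)
  qed
qed

lemma proj_space_vanishes_iff:
  fixes p :: "('n::finite, 'k::field) mpol"
  assumes "P \<in> proj_space" "homogeneous e p" "a \<in> P"
  shows "vanishes_at p P \<longleftrightarrow> mpol_eval a p = 0"
proof -
  obtain b where P: "P = {(\<lambda>i. c * b i) | c. c \<noteq> 0}" using assms(1) by (auto simp: proj_space_def)
  obtain c where c: "c \<noteq> 0" "a = (\<lambda>i. c * b i)" using assms(3) P by auto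
  have "mpol_eval a p = 0 \<longleftrightarrow> mpol_eval b p = 0" using c by (simp add: mpol_eval_scale[OF assms(2)])
  moreover have "vanishes_at p P \<longleftrightarrow> mpol_eval b p = 0"
  proof
    assume "vanishes_at p P"
    moreover have "(\<lambda>i. 1 * b i) \<in> P" unfolding P by (intro CollectI exI[of _ 1]) simp
    ultimately show "mpol_eval b p = 0" by (auto simp: vanishes_at_def)
  qed (auto simp: vanishes_at_def P mpol_eval_scale[OF assms(2)])
  ultimately show ?thesis by simp
qed

lemma proj_space_point:
  assumes "P \<in> proj_space" obtains a where "a \<in> P" "\<exists>i. a i \<noteq> 0" "P = {(\<lambda>i. c * a i) | c. c \<noteq> 0}"
proof -
  obtain b where P: "P = {(\<lambda>i. c * b i) | c. c \<noteq> 0}" "\<exists>i. b i \<noteq> 0" using assms by (auto simp: proj_space_def)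
  have "(\<lambda>i. 1 * b i) \<in> P" unfolding P by (intro CollectI exI[of _ 1]) simp
  then show thesis using that[of b] P by simp
qed

section \<open>The function field\<close>

locale proj_curve =
  fixes X :: "('n::finite, 'k::{alg_closed_field, field_char_0}) ppoint set"
    and quo :: "('n, 'k) mpol \<Rightarrow> ('n, 'k) mpol \<Rightarrow> 'f::field"
  assumes curve: "algebraic_curve X quo"
begin

abbreviation emb :: "'k \<Rightarrow> 'f" where "emb \<equiv> const_fun quo"

lemma X_proj_space: "P \<in> X \<Longrightarrow> P \<in> proj_space"
  using curve unfolding algebraic_curve_def irreducible_proj_variety_def proj_closed_def by blast

lemma X_nonempty: "X \<noteq> {}"
  using curve unfolding algebraic_curve_def irreducible_proj_variety_def by blast

lemma vanishes_iff: "P \<in> X \<Longrightarrow> homogeneous e p \<Longrightarrow> a \<in> P \<Longrightarrow> vanishes_at p P \<longleftrightarrow> mpol_eval a p = 0"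
  using proj_space_vanishes_iff X_proj_space by blast

lemma point_nonempty: "P \<in> X \<Longrightarrow> \<exists>a. a \<in> P"
  by (rule proj_space_point[OF X_proj_space]) blast+

lemma point_rep: "P \<in> X \<Longrightarrow> \<exists>b. b \<in> P \<and> (\<exists>i. b i \<noteq> 0) \<and> P = {(\<lambda>i. c * b i) | c. c \<noteq> 0}"
  by (rule proj_space_point[OF X_proj_space]) blast+

definition nonvanishing :: "nat \<Rightarrow> ('n, 'k) mpol \<Rightarrow> bool" where
  "nonvanishing e g \<longleftrightarrow> homogeneous e g \<and> (\<exists>P\<in>X. \<not> vanishes_at g P)"

lemma fraction_on_iff: "fraction_on X f g \<longleftrightarrow> (\<exists>e. homogeneous e f \<and> nonvanishing e g)"
  unfolding fraction_on_def form_pair_def nonvanishing_def by blast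

text \<open>Irreducibility of \<open>X\<close> enters here: if \<open>g g'\<close> vanished on \<open>X\<close>, the zero sets of the factors would
  cover \<open>X\<close>.\<close>

lemma nonvanishing_mult:
  assumes "nonvanishing e g" "nonvanishing e' g'" shows "nonvanishing (e + e') (g * g')"
proof (rule ccontr)
  have h: "homogeneous (e + e') (g * g')" using assms by (auto simp: nonvanishing_def homogeneous_mult)
  assume "\<not> nonvanishing (e + e') (g * g')"
  then have v: "vanishes_at (g * g') P" if "P \<in> X" for P using that h by (auto simp: nonvanishing_def)
  have closed: "proj_closed {P\<in>X. vanishes_at p P}" if p: "homogeneous d p" for p d
  proof -
    obtain S where S: "\<forall>p\<in>S. \<exists>e. homogeneous e p" "X = {P \<in> proj_space. \<forall>p\<in>S. vanishes_at p P}"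
      using curve unfolding algebraic_curve_def irreducible_proj_variety_def proj_closed_def by blast
    then show ?thesis unfolding proj_closed_def using p by (intro exI[of _ "insert p S"]) auto
  qed
  have "X = {P\<in>X. vanishes_at g P} \<union> {P\<in>X. vanishes_at g' P}"
  proof -
    have "vanishes_at g P \<or> vanishes_at g' P" if P: "P \<in> X" for P
    proof -
      obtain a where a: "a \<in> P" using point_nonempty[OF P] by blast
      show ?thesis using v[OF P] vanishes_iff[OF P h a] assms vanishes_iff[OF P _ a]
        by (auto simp: mpol_eval_mult nonvanishing_def)
    qed
    then show ?thesis by blast
  qed
  then have "X = {P\<in>X. vanishes_at g P} \<or> X = {P\<in>X. vanishes_at g' P}"
    using curve closed assms unfolding algebraic_curve_def irreducible_proj_variety_def nonvanishing_def
    by blast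
  then show False using assms unfolding nonvanishing_def by blast
qed

lemma nonvanishing_1: "nonvanishing 0 1"
proof -
  obtain P where P: "P \<in> X" using X_nonempty by blast
  obtain a where "a \<in> P" using point_nonempty[OF P] by blast
  then show ?thesis using P vanishes_iff[OF P homogeneous_1] by (auto simp: nonvanishing_def homogeneous_1)
qed

lemma nonvanishing_power: "nonvanishing e g \<Longrightarrow> nonvanishing (n * e) (g ^ n)"
  by (induction n) (auto simp: nonvanishing_1 nonvanishing_mult)

lemma function_field: "is_function_field X quo"
  using curve by (simp add: algebraic_curve_def)

lemma quo_eq:
  assumes "homogeneous e f" "nonvanishing e g" "homogeneous e' f'" "nonvanishing e' g'"
  shows "quo f g = quo f' g' \<longleftrightarrow> (\<forall>P\<in>X. vanishes_at (f * g' - f' * g) P)"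
    and "quo f g + quo f' g' = quo (f * g' + f' * g) (g * g')"
    and "quo f g * quo f' g' = quo (f * f') (g * g')"
proof -
  have "fraction_on X f g" "fraction_on X f' g'" using assms by (auto simp: fraction_on_iff)
  then show "quo f g = quo f' g' \<longleftrightarrow> (\<forall>P\<in>X. vanishes_at (f * g' - f' * g) P)"
    and "quo f g + quo f' g' = quo (f * g' + f' * g) (g * g')"
    and "quo f g * quo f' g' = quo (f * f') (g * g')"
    using function_field unfolding is_function_field_def by blast+
qed

lemma quo_eqI:
  assumes "homogeneous e f" "nonvanishing e g" "homogeneous e' f'" "nonvanishing e' g'" "f * g' = f' * g"
  shows "quo f g = quo f' g'"
  using assms quo_eq(1)[OF assms(1-4)] by (auto simp: vanishes_at_def)

lemma quo_cases:
  obtains e f g where "homogeneous e f" "nonvanishing e g" "z = quo f g"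
  using function_field unfolding is_function_field_def fraction_on_iff by metis

lemma quo_0: assumes "nonvanishing e g" shows "quo 0 g = 0"
proof -
  have h: "homogeneous e (0 :: ('n, 'k) mpol)" by simp
  have "quo 0 g + quo 0 g = quo 0 (g * g)" using quo_eq(2)[OF h assms h assms] by simp
  also have "\<dots> = quo 0 g"
    by (rule quo_eqI[OF _ nonvanishing_mult[OF assms assms] h assms]) auto
  finally show ?thesis by (simp only: add_cancel_left_right)
qed

lemma quo_eq_0_iff:
  assumes "homogeneous e f" "nonvanishing e g" shows "quo f g = 0 \<longleftrightarrow> (\<forall>P\<in>X. vanishes_at f P)"
proof -
  have "quo f g = 0 \<longleftrightarrow> quo f g = quo 0 1" using quo_0[OF nonvanishing_1] by simp
  also have "\<dots> \<longleftrightarrow> (\<forall>P\<in>X. vanishes_at f P)"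
    using quo_eq(1)[OF assms _ nonvanishing_1, of 0] by simp
  finally show ?thesis .
qed

lemma quo_self: assumes "nonvanishing e g" shows "quo g g = 1"
proof -
  have h: "homogeneous e g" using assms by (simp add: nonvanishing_def)
  have "quo g g * quo g g = quo (g * g) (g * g)" using quo_eq(3)[OF h assms h assms] .
  also have "\<dots> = quo g g"
    by (rule quo_eqI[OF homogeneous_mult[OF h h] nonvanishing_mult[OF assms assms] h assms]) (simp add: algebra_simps)
  finally have "quo g g * (quo g g - 1) = 0" by (simp add: algebra_simps)
  moreover have "quo g g \<noteq> 0" using quo_eq_0_iff[OF h assms] assms by (auto simp: nonvanishing_def)
  ultimately show ?thesis by simp
qed

lemma quo_add:
  assumes "homogeneous e f" "homogeneous e f'" "nonvanishing e g"
  shows "quo (f + f') g = quo f g + quo f' g"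
proof -
  have "quo f g + quo f' g = quo (f * g + f' * g) (g * g)"
    using quo_eq(2)[OF assms(1,3) assms(2,3)] .
  also have "\<dots> = quo (f + f') g"
    using assms by (intro quo_eqI[OF _ nonvanishing_mult[OF assms(3,3)] homogeneous_add[OF assms(1,2)] assms(3)])
      (auto simp: algebra_simps nonvanishing_def intro!: homogeneous_add homogeneous_mult)
  finally show ?thesis by simp
qed

lemma quo_mult:
  assumes "homogeneous e f" "nonvanishing e g" "homogeneous e' f'" "nonvanishing e' g'"
  shows "quo (f * f') (g * g') = quo f g * quo f' g'"
  using quo_eq(3)[OF assms] by simp

lemma emb_hom: "emb (c + c') = emb c + emb c'" "emb (c * c') = emb c * emb c'" "emb 0 = 0" "emb 1 = 1"
  unfolding const_fun_def
  using quo_add[OF homogeneous_const homogeneous_const nonvanishing_1, of c c']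
    quo_mult[OF homogeneous_const nonvanishing_1 homogeneous_const nonvanishing_1, of c c']
    quo_0[OF nonvanishing_1] quo_self[OF nonvanishing_1]
  by (simp_all add: single_add mult_single)

lemma emb_uminus: "emb (- c) = - emb c"
  using emb_hom(1)[of "- c" c] emb_hom(3) by (simp add: eq_neg_iff_add_eq_0)

lemma emb_diff: "emb (c - c') = emb c - emb c'"
  using emb_hom(1)[of c "- c'"] by (simp add: emb_uminus)

lemma emb_eq_0_iff: "emb c = 0 \<longleftrightarrow> c = 0"
proof
  assume *: "emb c = 0"
  show "c = 0"
  proof (rule ccontr)
    assume "c \<noteq> 0"
    then have "emb c * emb (inverse c) = 1" using emb_hom(2)[of c "inverse c"] emb_hom(4) by simp
    then show False using * by simp
  qed
qed (simp add: emb_hom)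

lemma emb_divide: "emb (c / c') = emb c / emb c'"
proof (cases "c' = 0")
  case False
  have "emb (c / c') * emb c' = emb c" using emb_hom(2)[of "c / c'" c'] False by simp
  then show ?thesis using False emb_eq_0_iff[of c'] by (simp add: field_simps)
qed (simp add: emb_hom)

subsection \<open>Values at points\<close>

text \<open>The relation combines membership in the local ring with the value there, which makes it closed under
  ring operations without a choice of representatives.\<close>

definition has_val :: "('n, 'k) ppoint \<Rightarrow> 'f \<Rightarrow> 'k \<Rightarrow> bool" where
  "has_val P h c \<longleftrightarrow> (\<exists>e f g. homogeneous e f \<and> homogeneous e g \<and> h = quo f g \<and>
     (\<forall>a\<in>P. mpol_eval a g \<noteq> 0 \<and> mpol_eval a f = c * mpol_eval a g))"

lemma has_val_nonvanishing:
  assumes "P \<in> X" "homogeneous e g" "\<And>a. a \<in> P \<Longrightarrow> mpol_eval a g \<noteq> 0"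
  shows "nonvanishing e g"
proof -
  obtain a where "a \<in> P" using point_nonempty[OF assms(1)] by blast
  then show ?thesis using assms vanishes_iff unfolding nonvanishing_def by blast
qed

lemma has_valE:
  assumes "P \<in> X" "has_val P h c"
  obtains e f g where "homogeneous e f" "nonvanishing e g" "homogeneous e g" "h = quo f g"
    "\<And>a. a \<in> P \<Longrightarrow> mpol_eval a g \<noteq> 0" "\<And>a. a \<in> P \<Longrightarrow> mpol_eval a f = c * mpol_eval a g"
  using assms has_val_nonvanishing[OF assms(1)] unfolding has_val_def by metis

lemma has_valI:
  assumes "homogeneous e f" "homogeneous e g" "h = quo f g"
    "\<And>a. a \<in> P \<Longrightarrow> mpol_eval a g \<noteq> 0" "\<And>a. a \<in> P \<Longrightarrow> mpol_eval a f = c * mpol_eval a g"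
  shows "has_val P h c"
  using assms unfolding has_val_def by blast

lemma has_val_emb: "has_val P (emb c) c"
  unfolding const_fun_def
  by (rule has_valI[OF homogeneous_const homogeneous_1 refl]) (auto simp: mpol_eval_single)

lemma has_val_add:
  assumes P: "P \<in> X" and "has_val P h c" "has_val P h' c'" shows "has_val P (h + h') (c + c')"
proof -
  obtain e f g where 1: "homogeneous e f" "nonvanishing e g" "homogeneous e g" "h = quo f g"
    "\<And>a. a \<in> P \<Longrightarrow> mpol_eval a g \<noteq> 0" "\<And>a. a \<in> P \<Longrightarrow> mpol_eval a f = c * mpol_eval a g"
    using has_valE[OF P assms(2)] by metis
  obtain e' f' g' where 2: "homogeneous e' f'" "nonvanishing e' g'" "homogeneous e' g'" "h' = quo f' g'"
    "\<And>a. a \<in> P \<Longrightarrow> mpol_eval a g' \<noteq> 0" "\<And>a. a \<in> P \<Longrightarrow> mpol_eval a f' = c' * mpol_eval a g'"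
    using has_valE[OF P assms(3)] by metis
  show ?thesis
  proof (rule has_valI)
    show "homogeneous (e + e') (f * g' + f' * g)"
      using homogeneous_mult[OF 1(1) 2(3)] homogeneous_mult[OF 2(1) 1(3)] 
      by (auto simp: add.commute intro: homogeneous_add)
    show "homogeneous (e + e') (g * g')" by (rule homogeneous_mult[OF 1(3) 2(3)])
    show "h + h' = quo (f * g' + f' * g) (g * g')" unfolding 1 2 by (rule quo_eq(2)[OF 1(1,2) 2(1,2)])
  qed (use 1 2 in \<open>auto simp: mpol_eval_add mpol_eval_mult algebra_simps\<close>)
qed

lemma has_val_mult:
  assumes P: "P \<in> X" and "has_val P h c" "has_val P h' c'" shows "has_val P (h * h') (c * c')"
proof -
  obtain e f g where 1: "homogeneous e f" "nonvanishing e g" "homogeneous e g" "h = quo f g"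
    "\<And>a. a \<in> P \<Longrightarrow> mpol_eval a g \<noteq> 0" "\<And>a. a \<in> P \<Longrightarrow> mpol_eval a f = c * mpol_eval a g"
    using has_valE[OF P assms(2)] by metis
  obtain e' f' g' where 2: "homogeneous e' f'" "nonvanishing e' g'" "homogeneous e' g'" "h' = quo f' g'"
    "\<And>a. a \<in> P \<Longrightarrow> mpol_eval a g' \<noteq> 0" "\<And>a. a \<in> P \<Longrightarrow> mpol_eval a f' = c' * mpol_eval a g'"
    using has_valE[OF P assms(3)] by metis
  show ?thesis
  proof (rule has_valI)
    show "homogeneous (e + e') (f * f')" by (rule homogeneous_mult[OF 1(1) 2(1)])
    show "homogeneous (e + e') (g * g')" by (rule homogeneous_mult[OF 1(3) 2(3)])
    show "h * h' = quo (f * f') (g * g')" unfolding 1 2 by (rule quo_eq(3)[OF 1(1,2) 2(1,2)])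
  qed (use 1 2 in \<open>auto simp: mpol_eval_mult algebra_simps\<close>)
qed

lemma has_val_unique:
  assumes P: "P \<in> X" and "has_val P h c" "has_val P h c'" shows "c = c'"
proof -
  obtain e f g where 1: "homogeneous e f" "nonvanishing e g" "homogeneous e g" "h = quo f g"
    "\<And>a. a \<in> P \<Longrightarrow> mpol_eval a g \<noteq> 0" "\<And>a. a \<in> P \<Longrightarrow> mpol_eval a f = c * mpol_eval a g"
    using has_valE[OF P assms(2)] by metis
  obtain e' f' g' where 2: "homogeneous e' f'" "nonvanishing e' g'" "homogeneous e' g'" "h = quo f' g'"
    "\<And>a. a \<in> P \<Longrightarrow> mpol_eval a g' \<noteq> 0" "\<And>a. a \<in> P \<Longrightarrow> mpol_eval a f' = c' * mpol_eval a g'"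
    using has_valE[OF P assms(3)] by metis
  obtain a where a: "a \<in> P" using point_nonempty[OF P] by blast
  have "vanishes_at (f * g' - f' * g) P" using quo_eq(1)[OF 1(1,2) 2(1,2)] 1(4) 2(4) P by simp
  then have "mpol_eval a (f * g' - f' * g) = 0" using a by (simp add: vanishes_at_def)
  then have "(c - c') * (mpol_eval a g * mpol_eval a g') = 0"
    using 1(6)[OF a] 2(6)[OF a] by (simp add: mpol_eval_diff mpol_eval_mult algebra_simps)
  then show ?thesis using 1(5)[OF a] 2(5)[OF a] by simp
qed

lemma has_val_inverse:
  assumes P: "P \<in> X" and "has_val P h c" "c \<noteq> 0" shows "has_val P (inverse h) (inverse c)" "h \<noteq> 0"
proof -
  obtain e f g where 1: "homogeneous e f" "nonvanishing e g" "homogeneous e g" "h = quo f g"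
    "\<And>a. a \<in> P \<Longrightarrow> mpol_eval a g \<noteq> 0" "\<And>a. a \<in> P \<Longrightarrow> mpol_eval a f = c * mpol_eval a g"
    using has_valE[OF P assms(2)] by metis
  have f: "mpol_eval a f \<noteq> 0" if "a \<in> P" for a using 1(5,6) that assms(3) by simp
  have fn: "nonvanishing e f" using has_val_nonvanishing[OF P 1(1)] f by blast
  have "h * quo g f = quo (f * g) (g * f)" unfolding 1 by (rule quo_eq(3)[OF 1(1,2) 1(3) fn])
  also have "g * f = f * g" by (rule mult.commute)
  also have "quo (f * g) (f * g) = 1" by (rule quo_self[OF nonvanishing_mult[OF fn 1(2)]])
  finally have *: "h * quo g f = 1" .
  then show "h \<noteq> 0" by auto
  then have "inverse h = quo g f" using * by (simp add: field_simps)
  then show "has_val P (inverse h) (inverse c)"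
    using 1 f assms(3) by (intro has_valI[OF 1(3) 1(1)]) (auto simp: field_simps)
qed

lemma local_ring_iff: 
  assumes P: "P \<in> X" shows "h \<in> local_ring quo P \<longleftrightarrow> (\<exists>c. has_val P h c)"
proof
  assume "h \<in> local_ring quo P"
  then obtain e f g where 1: "homogeneous e f" "homogeneous e g" "h = quo f g" "\<not> vanishes_at g P"
    by (auto simp: local_ring_def form_pair_def)
  obtain b where b: "b \<in> P" "P = {(\<lambda>i. c * b i) | c. c \<noteq> 0}" using point_rep[OF P] by blast
  have g: "mpol_eval b g \<noteq> 0" using vanishes_iff[OF P 1(2) b(1)] 1(4) by simp
  have "has_val P h (mpol_eval b f / mpol_eval b g)"
  proof (rule has_valI[OF 1(1-3)])
    fix a assume "a \<in> P"
    then obtain c where c: "c \<noteq> 0" "a = (\<lambda>i. c * b i)" using b(2) by auto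
    show "mpol_eval a g \<noteq> 0" unfolding c(2) mpol_eval_scale[OF 1(2)] using g c(1) by simp
    show "mpol_eval a f = mpol_eval b f / mpol_eval b g * mpol_eval a g"
      unfolding c(2) mpol_eval_scale[OF 1(1)] mpol_eval_scale[OF 1(2)] using g by simp
  qed
  then show "\<exists>c. has_val P h c" by blast
next
  assume "\<exists>c. has_val P h c"
  then obtain e f g where 1: "homogeneous e f" "homogeneous e g" "h = quo f g"
    "\<And>a. a \<in> P \<Longrightarrow> mpol_eval a g \<noteq> 0" unfolding has_val_def by auto
  moreover have "\<not> vanishes_at g P" using 1 point_nonempty[OF P] by (auto simp: vanishes_at_def)
  ultimately show "h \<in> local_ring quo P"
    unfolding local_ring_def form_pair_def by blast
qed

lemma local_max_ideal_iff:
  assumes P: "P \<in> X" shows "h \<in> local_max_ideal quo P \<longleftrightarrow> has_val P h 0"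
proof
  assume "h \<in> local_max_ideal quo P"
  then obtain e f g where 1: "homogeneous e f" "homogeneous e g" "h = quo f g" "\<not> vanishes_at g P" "vanishes_at f P"
    by (auto simp: local_max_ideal_def form_pair_def)
  show "has_val P h 0"
    by (rule has_valI[OF 1(1-3)]) (use 1(4,5) vanishes_iff[OF P 1(2)] in \<open>auto simp: vanishes_at_def\<close>)
next
  assume "has_val P h 0"
  then obtain e f g where 1: "homogeneous e f" "homogeneous e g" "h = quo f g"
    "\<And>a. a \<in> P \<Longrightarrow> mpol_eval a g \<noteq> 0" "\<And>a. a \<in> P \<Longrightarrow> mpol_eval a f = 0" unfolding has_val_def by auto
  moreover have "\<not> vanishes_at g P" using 1 point_nonempty[OF P] by (auto simp: vanishes_at_def)
  moreover have "vanishes_at f P" using 1(5) by (auto simp: vanishes_at_def)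
  ultimately show "h \<in> local_max_ideal quo P"
    unfolding local_max_ideal_def form_pair_def by blast
qed

subsection \<open>Affine coordinates\<close>

definition affine_chart :: "'n \<Rightarrow> bool" where
  "affine_chart i \<longleftrightarrow> nonvanishing 1 (coord_form i)"

definition affine_coord :: "'n \<Rightarrow> 'n \<Rightarrow> 'f" where
  "affine_coord i j = quo (coord_form j) (coord_form i)"

lemma point_has_chart:
  assumes "P \<in> X" "a \<in> P" obtains i where "a i \<noteq> 0"
proof -
  obtain b where b: "\<exists>i. b i \<noteq> 0" "P = {(\<lambda>i. c * b i) | c. c \<noteq> 0}" using point_rep[OF assms(1)] by blast
  obtain i c where "b i \<noteq> 0" "c \<noteq> 0" "a = (\<lambda>i. c * b i)" using assms(2) b by auto
  then show thesis using that[of i] by simp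
qed

lemma chartI:
  assumes "P \<in> X" "a \<in> P" "a i \<noteq> 0" shows "affine_chart i"
proof -
  have "homogeneous 1 (coord_form i :: ('n, 'k) mpol)" by (rule coord_form(2))
  moreover from this have "\<not> vanishes_at (coord_form i) P" using vanishes_iff[OF assms(1) _ assms(2)] assms(3) by simp
  ultimately show ?thesis unfolding affine_chart_def nonvanishing_def using assms(1) by blast
qed

text \<open>Dehomogenization, phrased for an arbitrary relation compatible with the ring operations. It is used for
  membership in a subring (ignoring the second argument) and for congruence modulo the maximal ideal of
  a valuation ring.\<close>

lemma form_in_coords:
  assumes i: "affine_chart i"
    and add: "\<And>h h' c c'. Rel h c \<Longrightarrow> Rel h' c' \<Longrightarrow> Rel (h + h') (c + c')"
    and mult: "\<And>h h' c c'. Rel h c \<Longrightarrow> Rel h' c' \<Longrightarrow> Rel (h * h') (c * c')"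
    and const: "\<And>c. Rel (emb c) c"
    and coords: "\<And>j. Rel (affine_coord i j) (a j)"
    and f: "homogeneous e f"
  shows "Rel (quo f (coord_form i ^ e)) (mpol_eval a f)"
proof -
  let ?x = "coord_form i :: ('n, 'k) mpol"
  have nv: "nonvanishing n (?x ^ n)" for n using nonvanishing_power[of 1 ?x n] i by (simp add: affine_chart_def)
  have mono: "Rel (quo (Poly_Mapping.single m 1) (?x ^ monom_deg m)) (monom_val a m)" for m
  proof (induction "monom_deg m" arbitrary: m)
    case 0
    then have "m = 0" by (intro poly_mapping_eqI) (auto simp: monom_deg_def)
    then show ?case using const[of 1] by (simp add: quo_self[OF nonvanishing_1] emb_hom)
  next
    case (Suc d)
    have "\<exists>j. Poly_Mapping.lookup m j \<noteq> 0"
    proof (rule ccontr)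
      assume "\<nexists>j. Poly_Mapping.lookup m j \<noteq> 0"
      then have "monom_deg m = 0" by (simp add: monom_deg_def)
      then show False using Suc by simp
    qed
    then obtain j where j: "Poly_Mapping.lookup m j \<noteq> 0" by blast
    define m' where "m' = m - Poly_Mapping.single j 1"
    have m: "m = m' + Poly_Mapping.single j 1"
      using j by (intro poly_mapping_eqI) (auto simp: m'_def lookup_add lookup_minus lookup_single when_def)
    have d: "monom_deg m = monom_deg m' + 1" unfolding m monom_deg_add monom_deg_single ..
    have IH: "Rel (quo (Poly_Mapping.single m' 1) (?x ^ monom_deg m')) (monom_val a m')"
      using Suc d by auto
    have s: "Poly_Mapping.single m 1 = Poly_Mapping.single m' 1 * (coord_form j :: ('n, 'k) mpol)"
      unfolding coord_form_def mult_single m by simp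
    have h: "homogeneous (monom_deg m') (Poly_Mapping.single m' (1::'k))"
      by (auto simp: homogeneous_iff lookup_single when_def)
    have "quo (Poly_Mapping.single m 1) (?x ^ monom_deg m)
        = quo (Poly_Mapping.single m' 1 * coord_form j) (?x ^ monom_deg m' * ?x)"
      unfolding s d by (simp add: mult.commute)
    also have "\<dots> = quo (Poly_Mapping.single m' 1) (?x ^ monom_deg m') * affine_coord i j"
      unfolding affine_coord_def by (rule quo_mult[OF h nv coord_form(2)]) (use i in \<open>simp add: affine_chart_def\<close>)
    finally show ?case
      using mult[OF IH coords[of j]] unfolding m monom_val_add monom_val_single by simp
  qed
  have main: "Rel (quo (\<Sum>m\<in>A. Poly_Mapping.single m (Poly_Mapping.lookup f m)) (?x ^ e))
      (mpol_eval a (\<Sum>m\<in>A. Poly_Mapping.single m (Poly_Mapping.lookup f m)))"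
    if "finite A" "A \<subseteq> Poly_Mapping.keys f" for A
    using that
  proof (induction A)
    case empty
    then show ?case using const[of 0] by (simp add: quo_0[OF nv] emb_hom)
  next
    case (insert m A)
    let ?s = "\<lambda>m. Poly_Mapping.single m (Poly_Mapping.lookup f m)"
    have hs: "homogeneous e (?s m)" if "m \<in> Poly_Mapping.keys f" for m
      using that f by (auto simp: homogeneous_iff lookup_single when_def)
    have hm: "monom_deg m = e" using f insert by (auto simp: homogeneous_iff in_keys_iff)
    have "homogeneous e (Poly_Mapping.single m (1::'k))" using hm by (auto simp: homogeneous_iff lookup_single when_def)
    from quo_mult[OF homogeneous_const nonvanishing_1 this nv, of "Poly_Mapping.lookup f m"]
    have "quo (?s m) (?x ^ e) = emb (Poly_Mapping.lookup f m) * quo (Poly_Mapping.single m 1) (?x ^ monom_deg m)"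
      by (simp add: mult_single const_fun_def hm)
    then have r: "Rel (quo (?s m) (?x ^ e)) (mpol_eval a (?s m))"
      using mult[OF const mono[of m]] by (simp add: mpol_eval_single)
    have "quo (?s m + (\<Sum>m\<in>A. ?s m)) (?x ^ e) = quo (?s m) (?x ^ e) + quo (\<Sum>m\<in>A. ?s m) (?x ^ e)"
      using insert by (intro quo_add[OF _ _ nv] homogeneous_sum hs) auto
    then show ?case using insert add[OF r insert.IH] by (simp add: mpol_eval_add)
  qed
  show ?thesis using main[of "Poly_Mapping.keys f"] mpol_sum_monomials[of f] by simp
qed

lemma fraction_in_coords:
  assumes "affine_chart i" "homogeneous e f" "nonvanishing e g"
  shows "quo f g = quo f (coord_form i ^ e) / quo g (coord_form i ^ e)" "quo g (coord_form i ^ e) \<noteq> 0"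
proof -
  let ?x = "coord_form i :: ('n, 'k) mpol"
  have nv: "nonvanishing e (?x ^ e)" using nonvanishing_power[of 1 ?x e] assms by (simp add: affine_chart_def)
  have g: "homogeneous e g" using assms by (simp add: nonvanishing_def)
  show nz: "quo g (?x ^ e) \<noteq> 0" using quo_eq_0_iff[OF g nv] assms by (auto simp: nonvanishing_def)
  have "quo f g * quo g (?x ^ e) = quo (f * g) (g * ?x ^ e)"
    by (rule quo_eq(3)[OF assms(2,3) g nv])
  also have "\<dots> = quo f (?x ^ e)"
    by (rule quo_eqI[OF homogeneous_mult[OF assms(2) g] nonvanishing_mult[OF assms(3) nv] assms(2) nv])
      (simp add: algebra_simps)
  finally show "quo f g = quo f (?x ^ e) / quo g (?x ^ e)" using nz by (simp add: field_simps)
qed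

lemma has_val_affine_coord:
  assumes "P \<in> X" "a \<in> P" "a i \<noteq> 0" shows "has_val P (affine_coord i j) (a j / a i)"
proof -
  obtain b where b: "P = {(\<lambda>i. c * b i) | c. c \<noteq> 0}" using point_rep[OF assms(1)] by blast
  obtain c0 where c0: "c0 \<noteq> 0" "a = (\<lambda>i. c0 * b i)" using assms(2) b by auto
  show ?thesis unfolding affine_coord_def
  proof (rule has_valI[OF coord_form(2) coord_form(2) refl])
    fix a' assume "a' \<in> P"
    then obtain c where c: "c \<noteq> 0" "a' = (\<lambda>i. c * b i)" using b by auto
    show "mpol_eval a' (coord_form i) \<noteq> 0" "mpol_eval a' (coord_form j) = a j / a i * mpol_eval a' (coord_form i)"
      using c c0 assms(3) by (simp_all add: field_simps)
  qed
qed

end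

section \<open>Finite extensions\<close>

lemma power_split: "m < i \<Longrightarrow> w ^ i = w ^ m * w * w ^ (i - Suc m)" for w :: "'a::monoid_mult"
proof -
  assume "m < i"
  then have "i = Suc m + (i - Suc m)" by simp
  then have "w ^ i = w ^ (Suc m + (i - Suc m))" by (rule arg_cong)
  then show ?thesis by (simp only: power_add power_Suc2)
qed

text \<open>The ground field is a type rather than a subset of \<open>'f\<close>, which gives access to the theory of vector
  spaces. It is later instantiated with fraction fields of polynomial rings.\<close>

locale field_extension =
  fixes \<phi> :: "'a::field \<Rightarrow> 'f::field"
  assumes hom_add: "\<phi> (a + b) = \<phi> a + \<phi> b" and hom_mult: "\<phi> (a * b) = \<phi> a * \<phi> b" and hom_1: "\<phi> 1 = 1"
begin

sublocale vector_space "\<lambda>c f. \<phi> c * f"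
  by unfold_locales (simp_all add: hom_add hom_mult hom_1 algebra_simps)

lemma hom_0: "\<phi> 0 = 0"
  using hom_add[of 0 0] by (simp only: add_0_right add_cancel_left_left add_cancel_left_right add_cancel_right_right)

lemma hom_uminus: "\<phi> (- a) = - \<phi> a"
  using hom_add[of a "- a"] by (simp add: hom_0 eq_neg_iff_add_eq_0 add.commute)

lemma hom_eq_0_iff: "\<phi> a = 0 \<longleftrightarrow> a = 0"
  using hom_mult[of a "inverse a"] by (cases "a = 0") (auto simp: hom_0 hom_1)

lemma hom_divide: "\<phi> (a / b) = \<phi> a / \<phi> b"
proof (cases "b = 0")
  case False
  then have "\<phi> (a / b) * \<phi> b = \<phi> a" using hom_mult[of "a / b" b] by simp
  then show ?thesis using False hom_eq_0_iff[of b] by (simp add: field_simps)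
qed (simp add: hom_0)

definition finite_dim :: "'f set \<Rightarrow> bool" where
  "finite_dim W \<longleftrightarrow> (\<exists>B. finite B \<and> W \<subseteq> span B)"

lemma finite_dim_dependence:
  assumes "finite_dim W" "\<And>i :: nat. u i \<in> W"
  shows "\<exists>N c. (\<exists>i\<le>N. c i \<noteq> 0) \<and> (\<Sum>i\<le>N. \<phi> (c i) * u i) = 0"
proof -
  obtain B where B: "finite B" "W \<subseteq> span B" using assms(1) by (auto simp: finite_dim_def)
  define N where "N = card B"
  show ?thesis
  proof (cases "inj_on u {..N}")
    case False
    then obtain i j where ij: "i \<le> N" "j \<le> N" "i \<noteq> j" "u i = u j" by (auto simp: inj_on_def)
    have "(\<Sum>l\<le>N. \<phi> (if l = i then 1 else if l = j then - 1 else 0) * u l)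
        = (\<Sum>l\<le>N. (if l = i then u i else 0) + (if l = j then - u j else 0))"
      using ij by (intro sum.cong) (auto simp: hom_0 hom_1 hom_uminus)
    also have "\<dots> = 0" using ij by (simp add: sum.distrib)
    finally show ?thesis using ij
      by (intro exI[of _ N] exI[of _ "\<lambda>l. if l = i then 1 else if l = j then - 1 else 0"]) auto
  next
    case True
    have "dependent (u ` {..N})"
    proof (rule ccontr)
      assume "independent (u ` {..N})"
      then have "card (u ` {..N}) \<le> card B"
        using independent_span_bound[OF B(1)] assms(2) B(2) by blast
      then show False using card_image[OF True] by (simp add: N_def)
    qed
    then obtain d where d: "\<exists>v\<in>u ` {..N}. d v \<noteq> 0" "(\<Sum>v\<in>u ` {..N}. \<phi> (d v) * v) = 0"
      using dependent_finite[of "u ` {..N}"] by auto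
    then have "(\<Sum>i\<le>N. \<phi> (d (u i)) * u i) = 0" using sum.reindex[OF True, of "\<lambda>v. \<phi> (d v) * v"] by simp
    then show ?thesis using d(1) by (intro exI[of _ N] exI[of _ "\<lambda>i. d (u i)"]) auto
  qed
qed

definition finite_subring :: "'f set \<Rightarrow> bool" where
  "finite_subring W \<longleftrightarrow> subspace W \<and> 1 \<in> W \<and> (\<forall>u\<in>W. \<forall>v\<in>W. u * v \<in> W) \<and> finite_dim W"

lemma finite_subringD:
  assumes "finite_subring W"
  shows "subspace W" "\<phi> c \<in> W" "u \<in> W \<Longrightarrow> v \<in> W \<Longrightarrow> u * v \<in> W" "u \<in> W \<Longrightarrow> v \<in> W \<Longrightarrow> u + v \<in> W"
    "u \<in> W \<Longrightarrow> u ^ n \<in> W" "finite_dim W"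
proof -
  show s: "subspace W" "finite_dim W" and m: "u \<in> W \<Longrightarrow> v \<in> W \<Longrightarrow> u * v \<in> W" for u v
    using assms by (auto simp: finite_subring_def)
  show "\<phi> c \<in> W" using subspace_scale[OF s(1), of 1 c] assms by (simp add: finite_subring_def)
  show "u \<in> W \<Longrightarrow> v \<in> W \<Longrightarrow> u + v \<in> W" by (rule subspace_add[OF s(1)])
  show "u \<in> W \<Longrightarrow> u ^ n \<in> W" using assms by (induction n) (auto simp: finite_subring_def)
qed

text \<open>The powers of \<open>w\<close> are linearly dependent. Dividing a relation by its lowest term expresses \<open>1\<close> as a
  multiple of \<open>w\<close> inside \<open>W\<close>.\<close>

lemma finite_subring_inverse:
  assumes W: "finite_subring W" and w: "w \<in> W"
  shows "inverse w \<in> W"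
proof (cases "w = 0")
  case False
  have "w ^ i \<in> W" for i using finite_subringD(5)[OF W w] .
  from finite_dim_dependence[OF finite_subringD(6)[OF W], of "\<lambda>i. w ^ i", OF this]
  obtain N c where c: "\<exists>i\<le>N. c i \<noteq> 0" "(\<Sum>i\<le>N. \<phi> (c i) * w ^ i) = 0" by blast
  define m where "m = (LEAST i. c i \<noteq> 0)"
  have m1: "c m \<noteq> 0" unfolding m_def by (rule LeastI_ex) (use c(1) in blast)
  have m2: "c i = 0" if "i < m" for i using not_less_Least[of i "\<lambda>i. c i \<noteq> 0"] that by (auto simp: m_def)
  note m = m1 m2
  have mN: "m \<le> N"
  proof -
    obtain i where "i \<le> N" "c i \<noteq> 0" using c(1) by blast
    then show ?thesis using m(2)[of i] by (cases "i < m") auto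
  qed
  define v where "v = - (\<Sum>i\<in>{Suc m..N}. \<phi> (c i / c m) * w ^ (i - Suc m))"
  have "(\<Sum>i\<le>N. \<phi> (c i) * w ^ i) = (\<Sum>i\<in>{m..N}. \<phi> (c i) * w ^ i)"
    by (rule sum.mono_neutral_right) (auto simp: m(2) hom_0)
  also have "\<dots> = \<phi> (c m) * w ^ m + (\<Sum>i\<in>{Suc m..N}. \<phi> (c i) * w ^ i)"
    using mN by (simp add: sum.atLeast_Suc_atMost)
  also have "(\<Sum>i\<in>{Suc m..N}. \<phi> (c i) * w ^ i) = (\<Sum>i\<in>{Suc m..N}. (\<phi> (c m) * w ^ m * w) * (\<phi> (c i / c m) * w ^ (i - Suc m)))"
  proof (rule sum.cong)
    fix i assume "i \<in> {Suc m..N}"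
    then have "w ^ i = w ^ m * w * w ^ (i - Suc m)" by (intro power_split) simp
    then show "\<phi> (c i) * w ^ i = (\<phi> (c m) * w ^ m * w) * (\<phi> (c i / c m) * w ^ (i - Suc m))"
      using m(1) by (simp add: hom_divide hom_eq_0_iff)
  qed simp
  also have "\<dots> = - (\<phi> (c m) * w ^ m * w) * v" by (simp add: v_def sum_distrib_left sum_negf)
  finally have "\<phi> (c m) * w ^ m * (1 - w * v) = 0" using c(2) by (simp add: algebra_simps)
  then have "w * v = 1" using False m(1) by (simp add: hom_eq_0_iff)
  then have "inverse w = v" by (simp add: inverse_unique)
  moreover have "v \<in> W" unfolding v_def
    by (intro subspace_neg subspace_sum finite_subringD[OF W] w)
  ultimately show ?thesis by simp
qed (use subspace_0 W in \<open>auto simp: finite_subring_def\<close>)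

definition integral_elem :: "'f \<Rightarrow> bool" where
  "integral_elem y \<longleftrightarrow> (\<exists>n c. y ^ n = (\<Sum>i<n. \<phi> (c i) * y ^ i))"

lemma integral_elemI:
  assumes "\<exists>i\<le>N. c i \<noteq> 0" "(\<Sum>i\<le>N. \<phi> (c i) * y ^ i) = 0"
  shows "integral_elem y"
proof -
  define n where "n = Max {i. i \<le> N \<and> c i \<noteq> 0}"
  have fin: "finite {i. i \<le> N \<and> c i \<noteq> 0}" by simp
  have n: "n \<le> N" "c n \<noteq> 0" using Max_in[OF fin] assms(1) by (auto simp: n_def)
  have above: "c i = 0" if "i \<le> N" "n < i" for i 
  proof (rule ccontr)
    assume "c i \<noteq> 0"
    then have "i \<le> n" unfolding n_def using that(1) by (intro Max_ge[OF fin]) simp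
    then show False using that(2) by simp
  qed
  have "0 = (\<Sum>i\<in>{..n}. \<phi> (c i) * y ^ i)"
    unfolding assms(2)[symmetric] using n by (intro sum.mono_neutral_right) (auto simp: above hom_0)
  also have "{..n} = insert n {..<n}" by auto
  finally have "\<phi> (c n) * y ^ n = - (\<Sum>i<n. \<phi> (c i) * y ^ i)" by (simp add: eq_neg_iff_add_eq_0)
  then have "y ^ n = - (\<Sum>i<n. \<phi> (c i) * y ^ i) / \<phi> (c n)"
    using n(2) hom_eq_0_iff[of "c n"] by (simp add: field_simps)
  also have "\<dots> = (\<Sum>i<n. \<phi> (- (c i / c n)) * y ^ i)"
    by (simp add: hom_uminus hom_divide sum_negf sum_divide_distrib)
  finally have "y ^ n = (\<Sum>i<n. \<phi> (- (c i / c n)) * y ^ i)" .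
  then show ?thesis unfolding integral_elem_def by (intro exI)
qed

lemma span_mult_closed:
  assumes "u \<in> span A" "\<And>a. a \<in> A \<Longrightarrow> a * w \<in> span C" shows "u * w \<in> span C"
  using assms(1)
proof (induction rule: span_induct_alt)
  case base then show ?case by (simp add: span_zero)
next
  case (step c x y)
  have "(\<phi> c * x + y) * w = \<phi> c * (x * w) + y * w" by (simp add: algebra_simps)
  then show ?case using step assms(2) by (auto intro!: span_add span_scale)
qed

text \<open>The products of \<open>W\<close> with the powers of \<open>y\<close> below the degree of its equation span a ring.\<close>

lemma finite_subring_adjoin:
  assumes W: "finite_subring W" and y: "integral_elem y"
  shows "\<exists>W'. finite_subring W' \<and> W \<subseteq> W' \<and> y \<in> W'"
proof -
  obtain n c where n: "y ^ n = (\<Sum>i<n. \<phi> (c i) * y ^ i)" using y by (auto simp: integral_elem_def)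
  obtain B where B: "finite B" "W \<subseteq> span B" using finite_subringD(6)[OF W] by (auto simp: finite_dim_def)
  define G where "G = {w * y ^ i | w i. w \<in> W \<and> i < n}"
  define W' where "W' = span G"
  have n0: "0 < n" using n by (cases n) auto
  have gen: "w * y ^ i \<in> W'" if "w \<in> W" "i < n" for w i
    unfolding W'_def G_def using that by (auto intro!: span_base)
  have 1: "w \<in> W'" if "w \<in> W" for w using gen[OF that n0] by simp
  have one: "1 \<in> W" using W by (simp add: finite_subring_def)
  have gen': "w * y ^ i \<in> W'" if "w \<in> W" "i \<le> n" for w i
  proof (cases "i = n")
    case True
    have "w * y ^ n = (\<Sum>i<n. \<phi> (c i) * (w * y ^ i))" unfolding n by (simp add: sum_distrib_left mult_ac)
    also have "\<dots> \<in> W'" using gen[OF that(1)] unfolding W'_def by (intro span_sum span_scale) auto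
    finally show ?thesis using True by simp
  qed (use that gen in auto)
  have ymul: "v * y \<in> W'" if "v \<in> W'" for v
    unfolding W'_def
  proof (rule span_mult_closed[of v G])
    fix a assume "a \<in> G"
    then obtain w i where "a = w * y ^ i" "w \<in> W" "i < n" by (auto simp: G_def)
    then have "a * y = w * y ^ Suc i" "w \<in> W" "Suc i \<le> n" by (auto simp: mult_ac)
    then show "a * y \<in> span G" using gen'[of w "Suc i"] by (simp only: W'_def)
  qed (use that in \<open>simp add: W'_def\<close>)
  have wmul: "v * w \<in> W'" if "v \<in> W'" "w \<in> W" for v w
    unfolding W'_def
  proof (rule span_mult_closed[of v G])
    fix a assume "a \<in> G"
    then obtain w' i where a: "a = w' * y ^ i" "w' \<in> W" "i < n" by (auto simp: G_def)
    then have "a * w = (w' * w) * y ^ i" by (simp add: mult_ac)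
    then show "a * w \<in> span G" using gen[of "w' * w" i] finite_subringD(3)[OF W a(2) that(2)] a(3) by (simp only: W'_def)
  qed (use that in \<open>simp add: W'_def\<close>)
  have ypow: "v * y ^ i \<in> W'" if "v \<in> W'" for v i
  proof (induction i)
    case (Suc i)
    have "v * y ^ Suc i = (v * y ^ i) * y" by (simp add: mult_ac)
    then show ?case using ymul[OF Suc] by (simp only:)
  qed (use that in simp)
  have mul: "u * v \<in> W'" if "u \<in> W'" "v \<in> W'" for u v
  proof -
    have "v * u \<in> span G"
    proof (rule span_mult_closed[of v G])
      fix a assume "a \<in> G"
      then obtain w i where a: "a = w * y ^ i" "w \<in> W" "i < n" by (auto simp: G_def)
      then have au: "a * u = (u * w) * y ^ i" by (simp add: mult_ac)
      show "a * u \<in> span G" unfolding au using ypow[OF wmul[OF that(1) a(2)], of i] by (simp only: W'_def)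
    qed (use that in \<open>simp add: W'_def\<close>)
    then show ?thesis by (simp add: W'_def mult.commute)
  qed
  have "G \<subseteq> span (\<Union>i<n. (\<lambda>b. b * y ^ i) ` B)"
  proof
    fix a assume "a \<in> G"
    then obtain w i where a: "a = w * y ^ i" "w \<in> W" "i < n" by (auto simp: G_def)
    show "a \<in> span (\<Union>i<n. (\<lambda>b. b * y ^ i) ` B)" unfolding a(1)
    proof (rule span_mult_closed[of w B])
      show "w \<in> span B" using a(2) B(2) by blast
      show "b * y ^ i \<in> span (\<Union>i<n. (\<lambda>b. b * y ^ i) ` B)" if "b \<in> B" for b
        using that a(3) by (intro span_base) blast
    qed
  qed
  then have "W' \<subseteq> span (\<Union>i<n. (\<lambda>b. b * y ^ i) ` B)"
    unfolding W'_def using span_minimal subspace_span by blast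
  then have "finite_dim W'" unfolding finite_dim_def using B(1)
    by (intro exI[of _ "\<Union>i<n. (\<lambda>b. b * y ^ i) ` B"]) auto
  then have "finite_subring W'" unfolding finite_subring_def using mul 1[OF one] by (auto simp: W'_def)
  moreover have "y \<in> W'" using ymul[OF 1[OF one]] by simp
  ultimately show ?thesis using 1 by blast
qed

lemma finite_subring_exists:
  assumes "finite Y" "\<And>y. y \<in> Y \<Longrightarrow> integral_elem y"
  shows "\<exists>W. finite_subring W \<and> Y \<subseteq> W"
  using assms
proof (induction Y)
  case empty
  have "finite_subring (span {1})"
  proof -
    have "u * v \<in> span {1}" if "u \<in> span {1}" "v \<in> span {1}" for u v
      by (rule span_mult_closed[OF that(1)]) (use that in auto)
    then show ?thesis by (auto simp: finite_subring_def finite_dim_def intro: span_base)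
  qed
  then show ?case by blast
next
  case (insert y Y)
  then obtain W where W: "finite_subring W" "Y \<subseteq> W" by auto
  then show ?case using finite_subring_adjoin[OF W(1), of y] insert.prems by blast
qed

end

section \<open>Algebraic dependence of rational functions\<close>

context proj_curve
begin

definition ev :: "'f \<Rightarrow> 'k poly \<Rightarrow> 'f" where
  "ev z p = poly (map_poly emb p) z"

lemma ev_pCons: "ev z (pCons c p) = emb c + z * ev z p"
  by (cases "pCons c p = 0") (auto simp: ev_def map_poly_pCons emb_hom)

lemma ev_0 [simp]: "ev z 0 = 0"
  by (simp add: ev_def)

lemma ev_const [simp]: "ev z [:c:] = emb c"
  by (simp add: ev_pCons)

lemma ev_1 [simp]: "ev z 1 = 1"
  using ev_const[of z 1] by (simp add: emb_hom one_pCons)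

lemma ev_add: "ev z (p + q) = ev z p + ev z q"
  by (induction p q rule: poly_induct2) (auto simp: ev_pCons emb_hom algebra_simps)

lemma ev_smult: "ev z (smult c p) = emb c * ev z p"
  by (induction p) (auto simp: ev_pCons emb_hom algebra_simps)

lemma ev_mult: "ev z (p * q) = ev z p * ev z q"
  by (induction p) (auto simp: ev_pCons ev_add ev_smult emb_hom algebra_simps)

lemma ev_uminus: "ev z (- p) = - ev z p"
  using ev_smult[of z "-1" p] by (simp add: emb_uminus emb_hom)

lemma ev_diff: "ev z (p - q) = ev z p - ev z q"
  using ev_add[of z p "- q"] by (simp add: ev_uminus)

lemma ev_power: "ev z (p ^ n) = ev z p ^ n"
  by (induction n) (auto simp: ev_mult)

lemma ev_sum_coeff:
  assumes "degree p \<le> N" shows "ev z p = (\<Sum>i\<le>N. emb (coeff p i) * z ^ i)"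
proof -
  have "degree (map_poly emb p) \<le> N" using assms map_poly_degree_leq[of emb p] by (simp add: emb_hom)
  then have "ev z p = (\<Sum>i\<le>N. coeff (map_poly emb p) i * z ^ i)"
    unfolding ev_def poly_altdef by (intro sum.mono_neutral_left) (auto simp: coeff_eq_0)
  then show ?thesis by (simp add: coeff_map_poly emb_hom)
qed

text \<open>Over an algebraically closed field a polynomial is a product of linear factors, so every non-constant
  function is transcendental.\<close>

lemma ev_eq_0:
  assumes "z \<notin> range emb" "ev z p = 0" shows "p = 0"
proof (rule ccontr)
  assume p: "p \<noteq> 0"
  obtain A where A: "size A = degree p" "p = smult (lead_coeff p) (\<Prod>x\<in>#A. [:-x, 1:])"
    using alg_closed_imp_factorization[OF p] by blast
  have "ev z (\<Prod>x\<in>#A. [:-x, 1:]) \<noteq> 0"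
  proof (induction A)
    case (add x A)
    have "ev z [:-x, 1:] = z - emb x" by (simp add: ev_pCons emb_hom emb_uminus)
    then have "ev z [:-x, 1:] \<noteq> 0" using assms(1) by auto
    then show ?case using add by (simp only: image_mset_add_mset prod_mset.add_mset ev_mult mult_eq_0_iff simp_thms)
  qed simp
  then have "ev z p \<noteq> 0" using p by (subst A(2)) (simp add: ev_smult emb_eq_0_iff)
  then show False using assms(2) by simp
qed

text \<open>Substitution of \<open>z\<close> into rational functions of one variable, which identifies their field with \<open>k(z)\<close>;
  meaningful for non-constant \<open>z\<close>.\<close>

definition frac_ev :: "'f \<Rightarrow> 'k poly fract \<Rightarrow> 'f" where
  "frac_ev z q = (SOME r. \<exists>a b. b \<noteq> 0 \<and> q = Fract a b \<and> r = ev z a / ev z b)"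

lemma frac_ev_Fract:
  assumes z: "z \<notin> range emb" and b: "b \<noteq> 0" shows "frac_ev z (Fract a b) = ev z a / ev z b"
proof -
  have "\<exists>r a' b'. b' \<noteq> 0 \<and> Fract a b = Fract a' b' \<and> r = ev z a' / ev z b'" using b by blast
  from someI_ex[OF this] obtain a' b' where ab: "b' \<noteq> 0" "Fract a b = Fract a' b'" "frac_ev z (Fract a b) = ev z a' / ev z b'"
    unfolding frac_ev_def by blast
  then have "a * b' = a' * b" using b by (simp add: eq_fract)
  then have "ev z a * ev z b' = ev z a' * ev z b" using ev_mult[of z a b'] ev_mult[of z a' b] by simp
  moreover have "ev z b \<noteq> 0" "ev z b' \<noteq> 0" using ev_eq_0[OF z] ab(1) b by auto
  ultimately show ?thesis unfolding ab(3) by (simp add: frac_eq_eq)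
qed

lemma field_extension_frac_ev:
  assumes z: "z \<notin> range emb" shows "field_extension (frac_ev z)"
proof
  fix q r :: "'k poly fract"
  obtain a b where q: "q = Fract a b" "b \<noteq> 0" by (cases q) auto
  obtain c d where r: "r = Fract c d" "d \<noteq> 0" by (cases r) auto
  have nz: "ev z b \<noteq> 0" "ev z d \<noteq> 0" using ev_eq_0[OF z] q r by auto
  show "frac_ev z (q + r) = frac_ev z q + frac_ev z r" "frac_ev z (q * r) = frac_ev z q * frac_ev z r"
    using q r nz by (simp_all add: frac_ev_Fract[OF z] ev_add ev_mult field_simps)
  show "frac_ev z 1 = 1" by (simp add: One_fract_def frac_ev_Fract[OF z])
qed

text \<open>Spelled out as a spanning set, because the vector space structure itself depends on \<open>z\<close>.\<close>

definition finite_over :: "'f \<Rightarrow> bool" where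
  "finite_over z \<longleftrightarrow> (\<exists>B. finite B \<and> (\<forall>h. \<exists>q. h = (\<Sum>b\<in>B. frac_ev z (q b) * b)))"

lemma finite_overI:
  assumes z: "z \<notin> range emb" and "field_extension.finite_dim (frac_ev z) UNIV"
  shows "finite_over z"
proof -
  interpret z: field_extension "frac_ev z" by (rule field_extension_frac_ev[OF z])
  obtain B where B: "finite B" "z.span B = UNIV" using assms(2) unfolding z.finite_dim_def by auto
  have "\<exists>q. h = (\<Sum>b\<in>B. frac_ev z (q b) * b)" for h
    using B z.span_finite[OF B(1)] by blast
  then show ?thesis using B(1) unfolding finite_over_def by blast
qed

lemma finite_overD:
  assumes z: "z \<notin> range emb" and "finite_over z"
  shows "field_extension.finite_dim (frac_ev z) UNIV"
proof -
  interpret z: field_extension "frac_ev z" by (rule field_extension_frac_ev[OF z])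
  obtain B where B: "finite B" "\<And>h. \<exists>q. h = (\<Sum>b\<in>B. frac_ev z (q b) * b)"
    using assms(2) unfolding finite_over_def by blast
  have "h \<in> z.span B" for h
  proof -
    obtain q where "h = (\<Sum>b\<in>B. frac_ev z (q b) * b)" using B(2) by blast
    then show ?thesis by (simp only:) (intro z.span_sum z.span_scale, rule z.span_base)
  qed
  then show ?thesis using B(1) unfolding z.finite_dim_def by blast
qed

lemma emb_frac_ev: "z \<notin> range emb \<Longrightarrow> emb c = frac_ev z (Fract [:c:] 1)"
  by (simp add: frac_ev_Fract)

text \<open>The function \<open>x\<close> is the one from the definition of a curve. The affine coordinates are algebraic over
  \<open>k(x)\<close>, so they lie in a finite subring; it is closed under inverses, and quotients of forms are
  quotients of polynomials in the coordinates.\<close>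

lemma finite_over_some: "\<exists>x. x \<notin> range emb \<and> finite_over x"
proof -
  obtain x where x: "\<not> algebraic_over (range emb) x" "\<And>y. algebraic_over (simple_extension emb x) y"
    using curve unfolding algebraic_curve_def by blast
  have nr: "x \<notin> range emb"
  proof
    assume "x \<in> range emb"
    then obtain c where c: "x = emb c" by blast
    have "coeff [:- x, 1:] i \<in> range emb" for i
    proof (cases i)
      case 0 then show ?thesis using emb_uminus[of c] c by (auto intro: range_eqI[of _ _ "- c"])
    next
      case (Suc j) then show ?thesis by (cases j) (auto intro: range_eqI[of _ _ 1] range_eqI[of _ _ 0] simp: emb_hom)
    qed
    then have "algebraic_over (range emb) x" unfolding algebraic_over_def by (intro exI[of _ "[:- x, 1:]"]) auto
    then show False using x(1) by simp
  qed
  interpret x: field_extension "frac_ev x" by (rule field_extension_frac_ev[OF nr])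
  have se: "\<exists>q. u = frac_ev x q" if u: "u \<in> simple_extension emb x" for u
  proof -
    obtain p q where "u = ev x p / ev x q" using u by (auto simp: simple_extension_def ev_def)
    then show ?thesis
      by (cases "q = 0") (auto simp: x.hom_0 frac_ev_Fract[OF nr] intro: exI[of _ 0] exI[of _ "Fract p q"])
  qed
  have int: "x.integral_elem y" for y
  proof -
    obtain p where p: "p \<noteq> 0" "\<And>i. coeff p i \<in> simple_extension emb x" "poly p y = 0"
      using x(2)[of y] unfolding algebraic_over_def by blast
    have "\<forall>i. \<exists>q. coeff p i = frac_ev x q" using se p(2) by blast
    then obtain c where c: "\<And>i. coeff p i = frac_ev x (c i)" by metis
    show ?thesis
    proof (rule x.integral_elemI)
      show "\<exists>i\<le>degree p. c i \<noteq> 0" using p(1) c[of "degree p"] x.hom_0 by (metis leading_coeff_0_iff order_refl)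
      show "(\<Sum>i\<le>degree p. frac_ev x (c i) * y ^ i) = 0" using p(3) by (simp add: poly_altdef c)
    qed
  qed
  obtain P a where P: "P \<in> X" "a \<in> P" using X_nonempty point_nonempty by blast
  obtain i where i: "affine_chart i" using point_has_chart[OF P] chartI[OF P] by metis
  obtain W where W: "x.finite_subring W" "range (affine_coord i) \<subseteq> W"
    using x.finite_subring_exists[of "range (affine_coord i)"] int by auto
  have "h \<in> W" for h
  proof -
    obtain e f g where h: "homogeneous e f" "nonvanishing e g" "h = quo f g" using quo_cases by metis
    have "quo f' (coord_form i ^ e) \<in> W" if "homogeneous e f'" for f'
      using form_in_coords[OF i, of "\<lambda>h c. h \<in> W" "\<lambda>_. 0", OF _ _ _ _ that]
        x.finite_subringD(2-4)[OF W(1)] W(2) emb_frac_ev[OF nr] by force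
    then have "quo f (coord_form i ^ e) \<in> W" "inverse (quo g (coord_form i ^ e)) \<in> W"
      using h x.finite_subring_inverse[OF W(1)] by (auto simp: nonvanishing_def)
    then show ?thesis
      unfolding h(3) fraction_in_coords(1)[OF i h(1,2)] divide_inverse by (rule x.finite_subringD(3)[OF W(1)])
  qed
  then have "W = UNIV" by blast
  then have "finite_over x" using finite_overI[OF nr] x.finite_subringD(6)[OF W(1)] by simp
  then show ?thesis using nr by blast
qed

text \<open>A formulation that is symmetric in both functions, for the exchange argument below.\<close>

definition dependent_pair :: "'f \<Rightarrow> 'f \<Rightarrow> bool" where
  "dependent_pair z y \<longleftrightarrow> (\<exists>M N c. (\<exists>i\<le>M. \<exists>j\<le>N. c i j \<noteq> 0) \<and>
     (\<Sum>i\<le>M. \<Sum>j\<le>N. emb (c i j) * z ^ i * y ^ j) = 0)"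

lemma dependent_pairI:
  assumes "i \<le> M" "j \<le> N" "c i j \<noteq> 0" "(\<Sum>i\<le>M. \<Sum>j\<le>N. emb (c i j) * z ^ i * y ^ j) = 0"
  shows "dependent_pair z y"
  unfolding dependent_pair_def
  by (rule exI[of _ M], rule exI[of _ N], rule exI[of _ c]) (use assms in blast)

lemma dependent_pair_sym: "dependent_pair z y \<Longrightarrow> dependent_pair y z"
proof -
  assume "dependent_pair z y"
  then obtain M N c where c: "\<exists>i\<le>M. \<exists>j\<le>N. c i j \<noteq> (0 :: 'k)"
    "(\<Sum>i\<le>M. \<Sum>j\<le>N. emb (c i j) * z ^ i * y ^ j) = 0" unfolding dependent_pair_def by blast
  have "(\<Sum>j\<le>N. \<Sum>i\<le>M. emb (c i j) * y ^ j * z ^ i) = (\<Sum>j\<le>N. \<Sum>i\<le>M. emb (c i j) * z ^ i * y ^ j)"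
    by (intro sum.cong refl) (simp add: mult_ac)
  also have "\<dots> = 0" unfolding c(2)[symmetric] by (rule sum.swap)
  finally have "(\<Sum>j\<le>N. \<Sum>i\<le>M. emb (c i j) * y ^ j * z ^ i) = 0" .
  moreover obtain i j where "i \<le> M" "j \<le> N" "c i j \<noteq> 0" using c(1) by blast
  ultimately show ?thesis by (intro dependent_pairI[of j N i M "\<lambda>j i. c i j"])
qed

lemma common_denominator:
  assumes "finite J"
  shows "\<exists>D p. D \<noteq> 0 \<and> (\<forall>j\<in>J. q j * Fract D 1 = Fract (p j) (1 :: 'k poly))"
  using assms
proof (induction J)
  case empty show ?case by (intro exI[of _ 1]) auto
next
  case (insert j J)
  then obtain D p where D: "D \<noteq> 0" "\<And>i. i \<in> J \<Longrightarrow> q i * Fract D 1 = Fract (p i) 1" by blast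
  obtain a b where ab: "q j = Fract a b" "b \<noteq> 0" by (cases "q j") auto
  have Db: "Fract (D * b) 1 = Fract D 1 * Fract b 1" by simp
  have "q i * Fract (D * b) 1 = Fract ((p(j := a * D)) i * (if i = j then 1 else b)) 1" if i: "i \<in> insert j J" for i
  proof (cases "i = j")
    case True then show ?thesis using ab by (simp add: eq_fract)
  next
    case False
    then have "q i * Fract (D * b) 1 = Fract (p i) 1 * Fract b 1" using D(2) i unfolding Db mult.assoc[symmetric] by auto
    then show ?thesis using False by simp
  qed
  moreover have "D * b \<noteq> 0" using D(1) ab(2) by simp
  ultimately show ?case by (intro exI[of _ "D * b"] exI[of _ "\<lambda>i. (p(j := a * D)) i * (if i = j then 1 else b)"]) blast
qed

lemma finite_over_dependent_pair:
  assumes z: "z \<notin> range emb" and fin: "finite_over z" shows "dependent_pair z y"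
proof -
  interpret z: field_extension "frac_ev z" by (rule field_extension_frac_ev[OF z])
  obtain N q where q: "\<exists>j\<le>N. q j \<noteq> 0" "(\<Sum>j\<le>N. frac_ev z (q j) * y ^ j) = 0"
    using z.finite_dim_dependence[OF finite_overD[OF z fin], of "\<lambda>i. y ^ i"] by auto
  obtain D p where D: "D \<noteq> 0" "\<And>j. j \<le> N \<Longrightarrow> q j * Fract D 1 = Fract (p j) 1"
    using common_denominator[of "{..N}" q] by auto
  have p: "frac_ev z (q j) * ev z D = ev z (p j)" if "j \<le> N" for j
    using arg_cong[OF D(2)[OF that], of "frac_ev z"] by (simp add: z.hom_mult frac_ev_Fract[OF z])
  have "(\<Sum>j\<le>N. ev z (p j) * y ^ j) = (\<Sum>j\<le>N. frac_ev z (q j) * y ^ j) * ev z D"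
    unfolding sum_distrib_right by (intro sum.cong refl) (simp add: p[symmetric] mult_ac)
  then have s0: "(\<Sum>j\<le>N. ev z (p j) * y ^ j) = 0" using q(2) by simp
  obtain j where j: "j \<le> N" "q j \<noteq> 0" using q(1) by blast
  have pj: "p j \<noteq> 0"
  proof
    assume "p j = 0"
    then have "frac_ev z (q j) * ev z D = 0" using p[OF j(1)] by simp
    then show False using j(2) D(1) ev_eq_0[OF z] z.hom_eq_0_iff by auto
  qed
  define M where "M = (\<Sum>j\<le>N. degree (p j))"
  have M: "degree (p j) \<le> M" if "j \<le> N" for j unfolding M_def using that by (intro member_le_sum) auto
  have "(\<Sum>i\<le>M. \<Sum>j\<le>N. emb (coeff (p j) i) * z ^ i * y ^ j) = (\<Sum>j\<le>N. ev z (p j) * y ^ j)"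
    by (subst sum.swap) (intro sum.cong refl, simp add: ev_sum_coeff[OF M] sum_distrib_right)
  moreover have "coeff (p j) (degree (p j)) \<noteq> 0" using pj by simp
  ultimately show ?thesis using j(1) M[OF j(1)] s0
    by (intro dependent_pairI[of "degree (p j)" M j N "\<lambda>i j. coeff (p j) i"]) simp_all
qed

lemma dependent_pair_integral:
  assumes z: "z \<notin> range emb" and "dependent_pair z y"
  shows "field_extension.integral_elem (frac_ev z) y"
proof -
  interpret z: field_extension "frac_ev z" by (rule field_extension_frac_ev[OF z])
  obtain M N c where c: "\<exists>i\<le>M. \<exists>j\<le>N. c i j \<noteq> (0 :: 'k)"
    "(\<Sum>i\<le>M. \<Sum>j\<le>N. emb (c i j) * z ^ i * y ^ j) = 0" using assms(2) unfolding dependent_pair_def by blast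
  define p where "p = (\<lambda>j. \<Sum>i\<le>M. monom (c i j) i)"
  have cp: "coeff (p j) i = c i j" if "i \<le> M" for i j using that by (simp add: p_def coeff_sum)
  have deg: "degree (p j) \<le> M" for j unfolding p_def by (intro degree_sum_le) (auto intro: order.trans[OF degree_monom_le])
  show ?thesis
  proof (rule z.integral_elemI)
    obtain i j where ij: "i \<le> M" "j \<le> N" "c i j \<noteq> 0" using c(1) by blast
    then have "p j \<noteq> 0" using cp[OF ij(1), of j] by auto
    then have "Fract (p j) 1 \<noteq> 0" by (simp add: Zero_fract_def eq_fract)
    then show "\<exists>j\<le>N. Fract (p j) 1 \<noteq> 0" using ij(2) by blast
    have "(\<Sum>j\<le>N. frac_ev z (Fract (p j) 1) * y ^ j) = (\<Sum>j\<le>N. \<Sum>i\<le>M. emb (c i j) * z ^ i * y ^ j)"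
      by (intro sum.cong refl) (simp add: frac_ev_Fract[OF z] ev_sum_coeff[OF deg] cp sum_distrib_right)
    also have "\<dots> = 0" using c(2) by (subst sum.swap)
    finally show "(\<Sum>j\<le>N. frac_ev z (Fract (p j) 1) * y ^ j) = 0" .
  qed
qed

text \<open>Steinitz exchange: \<open>z\<close> is algebraic over \<open>k(x)\<close> for some \<open>x\<close> as above, hence \<open>x\<close> is algebraic over
  \<open>k(z)\<close>, and finiteness passes from \<open>k(x)\<close> to \<open>k(z)\<close> through a finite extension containing both.\<close>

theorem finite_over_nonconstant:
  assumes z: "z \<notin> range emb" shows "finite_over z"
proof -
  interpret z: field_extension "frac_ev z" by (rule field_extension_frac_ev[OF z])
  obtain x where x: "x \<notin> range emb" "finite_over x" using finite_over_some by blast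
  have "z.integral_elem x"
    using dependent_pair_integral[OF z] dependent_pair_sym finite_over_dependent_pair[OF x] by blast
  then obtain W where W: "z.finite_subring W" "x \<in> W" using z.finite_subring_exists[of "{x}"] by auto
  have evW: "ev x p \<in> W" for p
  proof (induction p)
    case 0 show ?case using z.finite_subringD(2)[OF W(1), of 0] z.hom_0 by simp
  next
    case (pCons c p)
    have "emb c \<in> W" using z.finite_subringD(2)[OF W(1)] emb_frac_ev[OF z] by simp
    then show ?case unfolding ev_pCons using z.finite_subringD(3,4)[OF W(1)] W(2) pCons by blast
  qed
  have fW: "frac_ev x q \<in> W" for q
  proof -
    obtain a b where "q = Fract a b" "b \<noteq> 0" by (cases q) auto
    then have "frac_ev x q = ev x a * inverse (ev x b)" by (simp add: frac_ev_Fract[OF x(1)] divide_inverse)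
    then show ?thesis using z.finite_subringD(3)[OF W(1)] z.finite_subring_inverse[OF W(1)] evW by simp
  qed
  obtain B where B: "finite B" "\<And>h. \<exists>q. h = (\<Sum>b\<in>B. frac_ev x (q b) * b)" using x(2) unfolding finite_over_def by blast
  obtain C where C: "finite C" "W \<subseteq> z.span C" using z.finite_subringD(6)[OF W(1)] unfolding z.finite_dim_def by blast
  have "h \<in> z.span ((\<lambda>(c, b). c * b) ` (C \<times> B))" for h
  proof -
    obtain q where h: "h = (\<Sum>b\<in>B. frac_ev x (q b) * b)" using B(2) by blast
    show ?thesis unfolding h
    proof (rule z.span_sum)
      fix b assume b: "b \<in> B"
      show "frac_ev x (q b) * b \<in> z.span ((\<lambda>(c, b). c * b) ` (C \<times> B))"
      proof (rule z.span_mult_closed[of _ C])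
        show "frac_ev x (q b) \<in> z.span C" using fW C(2) by blast
        show "c * b \<in> z.span ((\<lambda>(c, b). c * b) ` (C \<times> B))" if "c \<in> C" for c
          using that b by (intro z.span_base image_eqI[of _ _ "(c, b)"]) auto
      qed
    qed
  qed
  then have "z.finite_dim UNIV" unfolding z.finite_dim_def using B(1) C(1)
    by (intro exI[of _ "(\<lambda>(c, b). c * b) ` (C \<times> B)"]) auto
  then show ?thesis by (rule finite_overI[OF z])
qed

definition const_subring :: "'f set \<Rightarrow> bool" where
  "const_subring A \<longleftrightarrow> range emb \<subseteq> A \<and> (\<forall>u\<in>A. \<forall>v\<in>A. u + v \<in> A \<and> u * v \<in> A)"

lemma const_subringD:
  assumes "const_subring A"
  shows "emb c \<in> A" "u \<in> A \<Longrightarrow> v \<in> A \<Longrightarrow> u + v \<in> A" "u \<in> A \<Longrightarrow> v \<in> A \<Longrightarrow> u * v \<in> A" "u \<in> A \<Longrightarrow> u ^ n \<in> A"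
    "0 \<in> A" "1 \<in> A" "u \<in> A \<Longrightarrow> v \<in> A \<Longrightarrow> u - v \<in> A" "(\<And>i. i \<in> I \<Longrightarrow> h i \<in> A) \<Longrightarrow> sum h I \<in> A"
    "u \<in> A \<Longrightarrow> ev u p \<in> A"
proof -
  show e: "emb c \<in> A" and a: "u \<in> A \<Longrightarrow> v \<in> A \<Longrightarrow> u + v \<in> A" and m: "u \<in> A \<Longrightarrow> v \<in> A \<Longrightarrow> u * v \<in> A" for c u v
    using assms unfolding const_subring_def by auto
  show 01: "0 \<in> A" "1 \<in> A" using e[of 0] e[of 1] emb_hom by simp_all
  show "u \<in> A \<Longrightarrow> u ^ n \<in> A" by (induction n) (auto simp: 01 m)
  show "u \<in> A \<Longrightarrow> v \<in> A \<Longrightarrow> u - v \<in> A" using a[of u "emb (- 1) * v"] m[OF e, of v "- 1"] by (simp add: emb_uminus emb_hom)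
  show "(\<And>i. i \<in> I \<Longrightarrow> h i \<in> A) \<Longrightarrow> sum h I \<in> A" by (induction I rule: infinite_finite_induct) (auto simp: 01 a)
  show "u \<in> A \<Longrightarrow> ev u p \<in> A" by (induction p) (auto simp: ev_pCons 01 e a m)
qed

text \<open>An equation between \<open>z\<close> and \<open>y\<close>, divided by the highest power of \<open>z\<close> that it contains, remains
  non-trivial modulo \<open>z\<close>. Thus in any ring in which \<open>z\<close> belongs to an ideal, \<open>y\<close> is algebraic over the
  constants modulo that ideal.\<close>

lemma dependence_mod_ideal:
  assumes z: "z \<notin> range emb"
  shows "\<exists>q r. q \<noteq> 0 \<and> ev y q = z * r \<and> (\<forall>A. const_subring A \<longrightarrow> z \<in> A \<longrightarrow> y \<in> A \<longrightarrow> r \<in> A)"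
proof -
  obtain M N c where c: "\<exists>i\<le>M. \<exists>j\<le>N. c i j \<noteq> (0 :: 'k)"
    "(\<Sum>i\<le>M. \<Sum>j\<le>N. emb (c i j) * z ^ i * y ^ j) = 0"
    using finite_over_dependent_pair[OF z finite_over_nonconstant[OF z], of y] unfolding dependent_pair_def by blast
  define m where "m = (LEAST i. \<exists>j\<le>N. c i j \<noteq> 0)"
  have m: "\<exists>j\<le>N. c m j \<noteq> 0" unfolding m_def by (rule LeastI_ex) (use c(1) in blast)
  have below: "c i j = 0" if "i < m" "j \<le> N" for i j
    using not_less_Least[of i "\<lambda>i. \<exists>j\<le>N. c i j \<noteq> 0"] that by (auto simp: m_def)
  have mM: "m \<le> M"
  proof -
    obtain i j where "i \<le> M" "j \<le> N" "c i j \<noteq> 0" using c(1) by blast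
    then show ?thesis using below[of i j] by (cases "i < m") auto
  qed
  define q where "q = (\<Sum>j\<le>N. monom (c m j) j)"
  define r where "r = - (\<Sum>i\<in>{Suc m..M}. \<Sum>j\<le>N. emb (c i j) * z ^ (i - Suc m) * y ^ j)"
  have z0: "z \<noteq> 0" using z rangeI[of emb 0] by (auto simp: emb_hom)
  have cq: "coeff q j = c m j" if "j \<le> N" for j using that by (simp add: q_def coeff_sum)
  have deg: "degree q \<le> N" unfolding q_def by (intro degree_sum_le) (auto intro: order.trans[OF degree_monom_le])
  have evq: "ev y q = (\<Sum>j\<le>N. emb (c m j) * y ^ j)" by (simp add: ev_sum_coeff[OF deg] cq)
  have "0 = (\<Sum>i\<in>{m..M}. \<Sum>j\<le>N. emb (c i j) * z ^ i * y ^ j)"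
    unfolding c(2)[symmetric] by (intro sum.mono_neutral_right) (auto simp: below emb_hom)
  also have "\<dots> = (\<Sum>j\<le>N. emb (c m j) * z ^ m * y ^ j) + (\<Sum>i\<in>{Suc m..M}. \<Sum>j\<le>N. emb (c i j) * z ^ i * y ^ j)"
    using mM by (simp add: sum.atLeast_Suc_atMost)
  also have "(\<Sum>j\<le>N. emb (c m j) * z ^ m * y ^ j) = z ^ m * ev y q"
    unfolding evq sum_distrib_left by (intro sum.cong refl) (simp add: mult_ac)
  also have "(\<Sum>i\<in>{Suc m..M}. \<Sum>j\<le>N. emb (c i j) * z ^ i * y ^ j) = - (z ^ m * (z * r))"
  proof -
    have "emb (c i j) * z ^ i * y ^ j = z ^ m * (z * (emb (c i j) * z ^ (i - Suc m) * y ^ j))" if "i \<in> {Suc m..M}" for i j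
    proof -
      have "z ^ i = z ^ m * z * z ^ (i - Suc m)" using that by (intro power_split) simp
      then show ?thesis by (simp add: mult_ac)
    qed
    then show ?thesis unfolding r_def mult_minus_right minus_minus sum_distrib_left by (intro sum.cong refl)
  qed
  finally have "z ^ m * (ev y q - z * r) = 0" by (simp only: right_diff_distrib) simp
  then have "ev y q = z * r" using z0 by simp
  moreover have "q \<noteq> 0" using m cq by auto
  moreover have "r \<in> A" if A: "const_subring A" "z \<in> A" "y \<in> A" for A
  proof -
    have "(\<Sum>i\<in>{Suc m..M}. \<Sum>j\<le>N. emb (c i j) * z ^ (i - Suc m) * y ^ j) \<in> A"
      using A by (intro const_subringD(8)[OF A(1)] const_subringD(3)[OF A(1)] const_subringD(1)[OF A(1)] const_subringD(4)[OF A(1)])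
    from const_subringD(7)[OF A(1) const_subringD(5)[OF A(1)] this] show ?thesis by (simp add: r_def)
  qed
  ultimately show ?thesis by blast
qed

end

section \<open>Every non-constant function has a pole\<close>

lemma (in proj_curve) inverse_nonconst: "z \<notin> range emb \<Longrightarrow> inverse z \<notin> range emb"
proof
  assume z: "z \<notin> range emb" and "inverse z \<in> range emb"
  then obtain c where c: "inverse z = emb c" by blast
  have "z = inverse (emb c)" using c by (metis inverse_inverse_eq)
  also have "\<dots> = emb (1 / c)" by (simp add: emb_divide emb_hom inverse_eq_divide)
  finally show False using z by blast
qed

text \<open>Such a ring \<open>B\<close> exists by Zorn's lemma. It is a valuation ring, and the point of \<open>X\<close> at which it is
  centred is the pole of \<open>z\<close> that is sought.\<close>

locale maximal_avoiding = proj_curve X quo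
  for X :: "('n::finite, 'k::{alg_closed_field, field_char_0}) ppoint set"
    and quo :: "('n, 'k) mpol \<Rightarrow> ('n, 'k) mpol \<Rightarrow> 'f::field" +
  fixes z :: 'f and B :: "'f set"
  assumes B: "const_subring B" and uB: "inverse z \<in> B" and zB: "z \<notin> B"
    and maximal: "\<And>A. const_subring A \<Longrightarrow> B \<subseteq> A \<Longrightarrow> z \<notin> A \<Longrightarrow> A = B"
begin

lemma z_nonzero: "z \<noteq> 0"
  using const_subringD(5)[OF B] zB by auto

text \<open>By maximality, adjoining \<open>y\<close> to \<open>B\<close> produces \<open>z\<close>; \<open>n\<close> bounds the degree of the expression.\<close>

definition expressible :: "'f \<Rightarrow> nat \<Rightarrow> bool" where
  "expressible y n \<longleftrightarrow> (\<exists>c. (\<forall>i. c i \<in> B) \<and> z = (\<Sum>i\<le>n. c i * y ^ i))"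

lemma expressible_exists:
  assumes "y \<notin> B" shows "\<exists>n. expressible y n"
proof -
  define A where "A = {poly p y | p. \<forall>i. coeff p i \<in> B}"
  have "const_subring A" unfolding const_subring_def
  proof (intro conjI ballI)
    show "range emb \<subseteq> A"
    proof
      fix b assume "b \<in> range emb"
      then have "b \<in> B" using const_subringD(1)[OF B] by blast
      then have "\<forall>i. coeff [:b:] i \<in> B" using const_subringD(5)[OF B] by (auto simp: coeff_pCons split: nat.splits)
      moreover have "b = poly [:b:] y" by simp
      ultimately show "b \<in> A" unfolding A_def by blast
    qed
    fix u v assume "u \<in> A" "v \<in> A"
    then obtain p q where p: "u = poly p y" "\<And>i. coeff p i \<in> B" and q: "v = poly q y" "\<And>i. coeff q i \<in> B"
      unfolding A_def by blast
    have "\<forall>i. coeff (p + q) i \<in> B" using p q const_subringD(2)[OF B] by simp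
    moreover have "u + v = poly (p + q) y" using p q by simp
    ultimately show "u + v \<in> A" unfolding A_def by blast
    have "\<forall>i. coeff (p * q) i \<in> B" unfolding coeff_mult
      using p q by (intro allI const_subringD(8)[OF B] const_subringD(3)[OF B])
    moreover have "u * v = poly (p * q) y" using p q by simp
    ultimately show "u * v \<in> A" unfolding A_def by blast
  qed
  moreover have "B \<subseteq> A"
  proof
    fix b assume "b \<in> B"
    then have "\<forall>i. coeff [:b:] i \<in> B" using const_subringD(5)[OF B] by (auto simp: coeff_pCons split: nat.splits)
    moreover have "b = poly [:b:] y" by simp
    ultimately show "b \<in> A" unfolding A_def by blast
  qed
  moreover have "y \<in> A"
  proof -
    have "\<forall>i. coeff [:0, 1:] i \<in> B" using const_subringD(5,6)[OF B] by (auto simp: coeff_pCons split: nat.splits)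
    moreover have "y = poly [:0, 1:] y" by simp
    ultimately show ?thesis unfolding A_def by blast
  qed
  ultimately have "z \<in> A" using maximal[of A] assms by blast
  then obtain p where p: "z = poly p y" "\<And>i. coeff p i \<in> B" unfolding A_def by blast
  have "expressible y (degree p)" unfolding expressible_def
    by (rule exI[of _ "coeff p"]) (use p in \<open>simp add: poly_altdef\<close>)
  then show ?thesis by blast
qed

lemma expressible_mono:
  assumes "expressible y n" "n \<le> m" shows "expressible y m"
proof -
  obtain c where c: "\<And>i. c i \<in> B" "z = (\<Sum>i\<le>n. c i * y ^ i)" using assms(1) unfolding expressible_def by blast
  have "z = (\<Sum>i\<le>m. (if i \<le> n then c i else 0) * y ^ i)"
    unfolding c(2) using assms(2) by (intro sum.mono_neutral_cong_left) auto
  moreover have "\<forall>i. (if i \<le> n then c i else 0) \<in> B" using c(1) const_subringD(5)[OF B] by simp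
  ultimately show ?thesis unfolding expressible_def by (intro exI[of _ "\<lambda>i. if i \<le> n then c i else 0"] conjI)
qed

lemma not_expressible_0: "\<not> expressible y 0"
  using zB by (auto simp: expressible_def)

text \<open>Otherwise \<open>z\<close> would be a polynomial in the inverse of \<open>w = 1 - b / z\<close>. Clearing denominators puts
  \<open>z w\<^sup>n\<close> into \<open>B\<close>, and this differs from \<open>z\<close> by an element of \<open>B\<close>.\<close>

lemma one_minus_unit:
  assumes b: "b \<in> B" shows "1 - inverse z * b \<noteq> 0" "inverse (1 - inverse z * b) \<in> B"
proof -
  define w where "w = 1 - inverse z * b"
  show w0: "1 - inverse z * b \<noteq> 0"
  proof
    assume "1 - inverse z * b = 0"
    then have "b = z" using z_nonzero by (simp add: field_simps)
    then show False using b zB by simp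
  qed
  have wB: "w \<in> B" unfolding w_def by (intro const_subringD(7)[OF B] const_subringD(6)[OF B] const_subringD(3)[OF B] uB b)
  have power: "\<exists>b'\<in>B. w ^ n = 1 - inverse z * b'" for n
  proof (induction n)
    case 0 show ?case using const_subringD(5)[OF B] by (intro bexI[of _ 0]) auto
  next
    case (Suc n)
    then obtain b' where b': "b' \<in> B" "w ^ n = 1 - inverse z * b'" by blast
    have "w ^ Suc n = 1 - inverse z * (b + b' - inverse z * b * b')" by (simp add: b'(2)) (simp add: w_def algebra_simps)
    moreover have "b + b' - inverse z * b * b' \<in> B"
      by (intro const_subringD(7)[OF B] const_subringD(2)[OF B] const_subringD(3)[OF B] uB b b')
    ultimately show ?case by blast
  qed
  show "inverse (1 - inverse z * b) \<in> B"
  proof (rule ccontr)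
    assume "inverse (1 - inverse z * b) \<notin> B"
    then obtain n c where c: "\<And>i. c i \<in> B" "z = (\<Sum>i\<le>n. c i * inverse w ^ i)"
      using expressible_exists[of "inverse w"] unfolding expressible_def w_def by blast
    have w0': "w \<noteq> 0" using w0 by (simp add: w_def)
    have "z * w ^ n = (\<Sum>i\<le>n. c i * w ^ (n - i))"
      unfolding c(2) sum_distrib_right
    proof (intro sum.cong refl)
      fix i assume "i \<in> {..n}"
      then have "w ^ n = w ^ i * w ^ (n - i)" by (simp flip: power_add)
      then show "c i * inverse w ^ i * w ^ n = c i * w ^ (n - i)" using w0' by (simp add: field_simps)
    qed
    also have "\<dots> \<in> B" by (intro const_subringD(8)[OF B] const_subringD(3)[OF B] const_subringD(4)[OF B] c wB)
    finally have zw: "z * w ^ n \<in> B" .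
    obtain b' where b': "b' \<in> B" "w ^ n = 1 - inverse z * b'" using power by blast
    have "z * w ^ n = z - b'" using z_nonzero by (simp add: b'(2) right_diff_distrib mult.assoc[symmetric])
    then have "z = z * w ^ n + b'" by simp
    then show False using const_subringD(2)[OF B zw b'(1)] zB by simp
  qed
qed

text \<open>The expression in \<open>1 / y\<close> can be solved for \<open>1\<close>, since \<open>1 - q\<^sub>0 / z\<close> is a unit. Multiplied by the
  leading power of \<open>y\<close> it lowers the degree of the expression in \<open>y\<close>.\<close>

lemma expressible_descent:
  assumes y: "y \<noteq> 0" and e: "expressible y (Suc n)" "expressible (inverse y) (Suc n)"
  shows "expressible y n"
proof -
  obtain c where c: "\<And>i. c i \<in> B" "z = (\<Sum>i\<le>Suc n. c i * y ^ i)" using e(1) unfolding expressible_def by blast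
  obtain q where q: "\<And>i. q i \<in> B" "z = (\<Sum>i\<le>Suc n. q i * inverse y ^ i)" using e(2) unfolding expressible_def by blast
  \<comment> \<open>\<open>q 0\<close> is moved to the left-hand side, where it becomes a unit after division by \<open>z\<close>\<close>
  define \<epsilon> where "\<epsilon> = inverse (1 - inverse z * q 0)"
  have \<epsilon>: "\<epsilon> \<in> B" "\<epsilon> * (1 - inverse z * q 0) = 1" using one_minus_unit[OF q(1)[of 0]] by (auto simp: \<epsilon>_def)
  define r where "r = (\<lambda>i. \<epsilon> * inverse z * q i)"
  have r: "r i \<in> B" for i unfolding r_def by (intro const_subringD(3)[OF B] \<epsilon> uB q)
  have "z - q 0 = (\<Sum>i\<in>{1..Suc n}. q i * inverse y ^ i)"
    using q(2) by (simp add: atMost_atLeast0 sum.atLeast_Suc_atMost)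
  then have "\<epsilon> * inverse z * (z - q 0) = (\<Sum>i\<in>{1..Suc n}. r i * inverse y ^ i)"
    by (simp only: sum_distrib_left r_def mult.assoc)
  moreover have "\<epsilon> * inverse z * (z - q 0) = 1"
    using \<epsilon>(2) z_nonzero by (simp add: right_diff_distrib mult.assoc)
  ultimately have 1: "1 = (\<Sum>i\<in>{1..Suc n}. r i * inverse y ^ i)" by simp
  have "y ^ Suc n = (\<Sum>i\<in>{1..Suc n}. r i * y ^ (Suc n - i))"
  proof -
    have "y ^ Suc n = (\<Sum>i\<in>{1..Suc n}. r i * inverse y ^ i) * y ^ Suc n" using 1 by simp
    also have "\<dots> = (\<Sum>i\<in>{1..Suc n}. r i * y ^ (Suc n - i))"
      unfolding sum_distrib_right
    proof (intro sum.cong refl)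
      fix i assume "i \<in> {1..Suc n}"
      then have "i + (Suc n - i) = Suc n" by simp
      then have "y ^ Suc n = y ^ i * y ^ (Suc n - i)" by (metis power_add)
      then show "r i * inverse y ^ i * y ^ Suc n = r i * y ^ (Suc n - i)" using y by (simp add: field_simps del: power_Suc)
    qed
    finally show ?thesis .
  qed
  also have "\<dots> = (\<Sum>i\<le>n. r (Suc n - i) * y ^ i)"
    by (rule sum.reindex_bij_witness[of _ "\<lambda>i. Suc n - i" "\<lambda>i. Suc n - i"]) auto
  finally have yn: "y ^ Suc n = (\<Sum>i\<le>n. r (Suc n - i) * y ^ i)" .
  have "z = (\<Sum>i\<le>n. c i * y ^ i) + c (Suc n) * y ^ Suc n" using c(2) by simp
  also have "\<dots> = (\<Sum>i\<le>n. (c i + c (Suc n) * r (Suc n - i)) * y ^ i)"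
    unfolding yn by (simp add: sum_distrib_left sum.distrib algebra_simps)
  finally have "z = (\<Sum>i\<le>n. (c i + c (Suc n) * r (Suc n - i)) * y ^ i)" .
  moreover have "\<forall>i. c i + c (Suc n) * r (Suc n - i) \<in> B"
    by (intro allI const_subringD(2)[OF B] const_subringD(3)[OF B] c r)
  ultimately show ?thesis unfolding expressible_def
    by (intro exI[of _ "\<lambda>i. c i + c (Suc n) * r (Suc n - i)"] conjI)
qed

text \<open>If neither held, both \<open>y\<close> and \<open>1 / y\<close> would express \<open>z\<close> with a common degree, and the symmetric descent
  would end in degree zero, that is, with \<open>z \<in> B\<close>.\<close>

lemma valuation_ring: "y \<in> B \<or> inverse y \<in> B"
proof (rule ccontr)
  assume *: "\<not> (y \<in> B \<or> inverse y \<in> B)"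
  then have y: "y \<noteq> 0" using const_subringD(5)[OF B] by auto
  obtain n m where "expressible y n" "expressible (inverse y) m" using expressible_exists * by blast
  then have "expressible y (max n m) \<and> expressible (inverse y) (max n m)"
    by (auto intro: expressible_mono)
  then have "expressible y 0 \<and> expressible (inverse y) 0"
  proof (induction "max n m")
    case (Suc k)
    have "expressible y j \<and> expressible (inverse y) j \<Longrightarrow> expressible y 0 \<and> expressible (inverse y) 0" for j
    proof (induction j)
      case (Suc j)
      then show ?case using expressible_descent[OF y, of j] expressible_descent[of "inverse y" j] y by simp
    qed
    then show ?case using Suc by blast
  qed simp
  then show False using not_expressible_0 by blast
qed

definition nonunit :: "'f \<Rightarrow> bool" where
  "nonunit b \<longleftrightarrow> b \<in> B \<and> (b = 0 \<or> inverse b \<notin> B)"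

lemma nonunit_mult: "nonunit b \<Longrightarrow> c \<in> B \<Longrightarrow> nonunit (b * c)"
proof -
  assume b: "nonunit b" and c: "c \<in> B"
  have "b * c = 0 \<or> inverse (b * c) \<notin> B"
  proof (rule ccontr)
    assume *: "\<not> (b * c = 0 \<or> inverse (b * c) \<notin> B)"
    then have ib: "inverse b = inverse (b * c) * c" by (simp add: field_simps)
    have "inverse (b * c) * c \<in> B" using const_subringD(3)[OF B _ c] * by blast
    then have "inverse b \<in> B" by (simp only: ib)
    then show False using b * by (auto simp: nonunit_def)
  qed
  then show ?thesis using b c const_subringD(3)[OF B] by (auto simp: nonunit_def)
qed

lemma nonunit_add: assumes "nonunit b" "nonunit c" shows "nonunit (b + c)"
proof (cases "b = 0 \<or> c = 0")
  case False
  have "b / c \<in> B \<or> c / b \<in> B" using valuation_ring[of "b / c"] by (simp add: inverse_eq_divide)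
  then show ?thesis
  proof
    assume "b / c \<in> B"
    then have "nonunit (c * (b / c + 1))" using assms const_subringD(2,6)[OF B] by (intro nonunit_mult) auto
    then show ?thesis using False by (simp add: field_simps)
  next
    assume "c / b \<in> B"
    then have "nonunit (b * (c / b + 1))" using assms const_subringD(2,6)[OF B] by (intro nonunit_mult) auto
    then show ?thesis using False by (simp add: field_simps)
  qed
qed (use assms in auto)

lemma nonunit_emb: "nonunit (emb c) \<longleftrightarrow> c = 0"
proof
  assume "nonunit (emb c)"
  then show "c = 0" using const_subringD(1)[OF B, of "inverse c"] emb_divide[of 1 c]
    by (auto simp: nonunit_def emb_hom inverse_eq_divide emb_eq_0_iff)
qed (use const_subringD(5)[OF B] in \<open>auto simp: nonunit_def emb_hom\<close>)

lemma nonunit_u: "nonunit (inverse z)"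
  using uB zB by (auto simp: nonunit_def)

lemma nonunit_factor: "nonunit (b * c) \<Longrightarrow> b \<in> B \<Longrightarrow> c \<in> B \<Longrightarrow> nonunit b \<or> nonunit c"
  using const_subringD(3)[OF B, of "inverse b" "inverse c"] by (auto simp: nonunit_def)

definition residue_const :: "'f \<Rightarrow> 'k \<Rightarrow> bool" where
  "residue_const b c \<longleftrightarrow> b \<in> B \<and> nonunit (b - emb c)"

lemma residue_const_add: "residue_const b c \<Longrightarrow> residue_const b' c' \<Longrightarrow> residue_const (b + b') (c + c')"
  using nonunit_add[of "b - emb c" "b' - emb c'"] const_subringD(2)[OF B]
  by (auto simp: residue_const_def emb_hom algebra_simps)

lemma residue_const_mult:
  assumes "residue_const b c" "residue_const b' c'" shows "residue_const (b * b') (c * c')"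
proof -
  have "nonunit ((b - emb c) * b' + (b' - emb c') * emb c)"
    using assms const_subringD(1)[OF B] by (intro nonunit_add nonunit_mult) (auto simp: residue_const_def)
  moreover have "(b - emb c) * b' + (b' - emb c') * emb c = b * b' - emb (c * c')"
    by (simp add: emb_hom algebra_simps)
  ultimately show ?thesis using assms const_subringD(3)[OF B] by (auto simp: residue_const_def)
qed

lemma residue_const_emb: "residue_const (emb c) c"
  using const_subringD(1)[OF B] nonunit_emb[of 0] by (simp add: residue_const_def emb_hom)

lemma residue_const_unique: "residue_const b c \<Longrightarrow> residue_const b c' \<Longrightarrow> c = c'"
proof -
  assume a: "residue_const b c" "residue_const b c'"
  have "nonunit ((b - emb c) + (b - emb c') * emb (- 1))"
    using a const_subringD(1)[OF B] by (intro nonunit_add nonunit_mult) (auto simp: residue_const_def)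
  moreover have "(b - emb c) + (b - emb c') * emb (- 1) = emb (c' - c)"
    by (simp add: emb_hom emb_uminus emb_diff)
  ultimately show ?thesis using nonunit_emb by simp
qed

text \<open>The residue field of \<open>B\<close> is \<open>k\<close>: as \<open>1 / z\<close> is not a unit, \<open>b\<close> is a root modulo non-units of a polynomial
  over \<open>k\<close>, which splits into linear factors.\<close>

lemma residue_const_exists:
  assumes z: "z \<notin> range emb" and b: "b \<in> B" shows "\<exists>c. residue_const b c"
proof -
  have u: "inverse z \<notin> range emb" by (rule inverse_nonconst[OF z])
  obtain q r where q: "q \<noteq> 0" "ev b q = inverse z * r" "r \<in> B"
    using dependence_mod_ideal[OF u, of b] B uB b by blast
  obtain A where A: "q = smult (lead_coeff q) (\<Prod>x\<in>#A. [:-x, 1:])"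
    using alg_closed_imp_factorization[OF q(1)] by blast
  have "nonunit (ev b q)" unfolding q(2) by (rule nonunit_mult[OF nonunit_u q(3)])
  moreover have "ev b q = emb (lead_coeff q) * ev b (\<Prod>x\<in>#A. [:-x, 1:])" by (subst A) (rule ev_smult)
  ultimately have "nonunit (ev b (\<Prod>x\<in>#A. [:-x, 1:]))"
    using nonunit_factor[OF _ const_subringD(1)[OF B] const_subringD(9)[OF B b]] nonunit_emb q(1)
    by (metis leading_coeff_0_iff)
  then have "\<exists>c. nonunit (b - emb c)"
  proof (induction A)
    case empty then show ?case using nonunit_emb[of 1] by (simp add: emb_hom)
  next
    case (add x A)
    have "ev b [:-x, 1:] = b - emb x" by (simp add: ev_pCons emb_hom emb_uminus)
    then have "nonunit ((b - emb x) * ev b (\<Prod>x\<in>#A. [:-x, 1:]))"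
      using add.prems by (simp only: image_mset_add_mset prod_mset.add_mset ev_mult)
    then show ?case using nonunit_factor[OF _ const_subringD(7)[OF B b const_subringD(1)[OF B]] const_subringD(9)[OF B b]] add.IH
      by blast
  qed
  then show ?thesis using b by (auto simp: residue_const_def)
qed

lemma affine_coord_trans:
  assumes "affine_chart i" "affine_chart l"
  shows "affine_coord i l * affine_coord l j = affine_coord i j" "affine_coord i l \<noteq> 0"
proof -
  have nv: "nonvanishing 1 (coord_form i)" "nonvanishing 1 (coord_form l)" using assms by (auto simp: affine_chart_def)
  have "affine_coord i l * affine_coord l j = quo (coord_form l * coord_form j) (coord_form i * coord_form l)"
    unfolding affine_coord_def by (rule quo_mult[symmetric, OF coord_form(2) nv(1) coord_form(2) nv(2)])
  also have "\<dots> = affine_coord i j" unfolding affine_coord_def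
    by (rule quo_eqI[OF homogeneous_mult[OF coord_form(2) coord_form(2)] nonvanishing_mult[OF nv] coord_form(2) nv(1)])
      (simp add: mult_ac)
  finally show "affine_coord i l * affine_coord l j = affine_coord i j" .
  show "affine_coord i l \<noteq> 0" unfolding affine_coord_def quo_eq_0_iff[OF coord_form(2) nv(1)]
    using nv(2) by (auto simp: nonvanishing_def)
qed

text \<open>In a valuation ring any two non-zero functions are comparable under divisibility, so among the finitely
  many homogeneous coordinates there is one that divides all others.\<close>

lemma chart_in_B: "\<exists>i. affine_chart i \<and> (\<forall>j. affine_coord i j \<in> B)"
proof -
  obtain P a where P: "P \<in> X" "a \<in> P" using X_nonempty point_nonempty by blast
  obtain i0 where i0: "affine_chart i0" using point_has_chart[OF P] chartI[OF P] by metis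
  have self: "affine_coord i i = 1" if "affine_chart i" for i
    using that quo_self unfolding affine_coord_def affine_chart_def by blast
  have "\<exists>i\<in>S. \<forall>j\<in>S. affine_coord i j \<in> B" if "finite S" "S \<noteq> {}" "S \<subseteq> {i. affine_chart i}" for S
    using that
  proof (induction S rule: finite_ne_induct)
    case (singleton i)
    then show ?case using self[of i] const_subringD(6)[OF B] by auto
  next
    case (insert l S)
    then obtain i where i: "i \<in> S" "\<And>j. j \<in> S \<Longrightarrow> affine_coord i j \<in> B" by auto
    have c: "affine_chart i" "affine_chart l" using insert.prems i by auto
    have inv: "inverse (affine_coord i l) = affine_coord l i"
      using affine_coord_trans(1)[OF c, of i] self[OF c(1)] by (intro inverse_unique) simp
    from valuation_ring[of "affine_coord i l"] show ?case
    proof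
      assume "affine_coord i l \<in> B"
      then show ?thesis using i by (intro bexI[of _ i]) auto
    next
      assume *: "inverse (affine_coord i l) \<in> B"
      have "affine_coord l j \<in> B" if "j \<in> insert l S" for j
      proof (cases "j = l")
        case True then show ?thesis using self[OF c(2)] const_subringD(6)[OF B] by simp
      next
        case False
        then have "affine_coord i j \<in> B" using i(2) that by simp
        then show ?thesis using affine_coord_trans(1)[OF c(2,1), of j] const_subringD(3)[OF B] * inv by metis
      qed
      then show ?thesis by (intro bexI[of _ l]) auto
    qed
  qed
  from this[of "{i. affine_chart i}"] obtain i where i: "affine_chart i" "\<And>j. affine_chart j \<Longrightarrow> affine_coord i j \<in> B"
    using i0 by auto
  have "affine_coord i j \<in> B" for j
  proof (cases "affine_chart j")
    case False
    then have "\<forall>P\<in>X. vanishes_at (coord_form j) P" unfolding affine_chart_def nonvanishing_def using coord_form(2) by blast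
    then have "affine_coord i j = 0"
      unfolding affine_coord_def using quo_eq_0_iff[OF coord_form(2)] i(1) by (auto simp: affine_chart_def)
    then show ?thesis using const_subringD(5)[OF B] by simp
  qed (rule i(2))
  then show ?thesis using i(1) by blast
qed

text \<open>The residues of the affine coordinates of a suitable chart are the coordinates of a point \<open>P\<close>. It lies on
  \<open>X\<close> because equations of \<open>X\<close> hold between the coordinate functions. Functions regular at \<open>P\<close> lie in
  \<open>B\<close>, and \<open>z\<close> does not.\<close>

lemma pole_exists:
  assumes z: "z \<notin> range emb" shows "\<exists>P\<in>X. z \<notin> local_ring quo P"
proof -
  obtain i where i: "affine_chart i" "\<And>j. affine_coord i j \<in> B" using chart_in_B by blast
  have "\<forall>j. \<exists>c. residue_const (affine_coord i j) c" using residue_const_exists[OF z] i(2) by blast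
  then obtain a where a: "\<And>j. residue_const (affine_coord i j) (a j)" by metis
  have "affine_coord i i = emb 1" using quo_self i(1) unfolding affine_coord_def affine_chart_def emb_hom by blast
  then have ai: "a i = 1" using a[of i] residue_const_emb[of 1] residue_const_unique by metis
  define P where "P = {(\<lambda>i. c * a i) | c. c \<noteq> 0}"
  have aP: "a \<in> P" unfolding P_def by (intro CollectI exI[of _ 1]) auto
  have Pp: "P \<in> proj_space" 
  proof -
    have "\<exists>i. a i \<noteq> 0" by (rule exI[of _ i]) (simp add: ai)
    then show ?thesis unfolding proj_space_def P_def by blast
  qed
  have form: "residue_const (quo f (coord_form i ^ e)) (mpol_eval a f)" if "homogeneous e f" for e f
    by (rule form_in_coords[OF i(1) residue_const_add residue_const_mult residue_const_emb a that])
  obtain S where S: "\<forall>p\<in>S. \<exists>e. homogeneous e p" "X = {P \<in> proj_space. \<forall>p\<in>S. vanishes_at p P}"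
    using curve unfolding algebraic_curve_def irreducible_proj_variety_def proj_closed_def by blast
  have nv: "nonvanishing e (coord_form i ^ e)" for e using nonvanishing_power[of 1 _ e] i(1) by (simp add: affine_chart_def)
  have "vanishes_at p P" if p: "p \<in> S" for p
  proof -
    obtain e where e: "homogeneous e p" using S(1) p by blast
    have "\<forall>P\<in>X. vanishes_at p P" using S(2) p by blast
    then have "quo p (coord_form i ^ e) = 0" using quo_eq_0_iff[OF e nv] by simp
    then have "residue_const (emb 0) (mpol_eval a p)" using form[OF e] by (simp add: emb_hom)
    then have "mpol_eval a p = 0" using residue_const_emb residue_const_unique by blast
    then show ?thesis using proj_space_vanishes_iff[OF Pp e aP] by simp
  qed
  then have PX: "P \<in> X" using S(2) Pp by blast
  have "z \<notin> local_ring quo P"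
  proof
    assume "z \<in> local_ring quo P"
    then obtain c where "has_val P z c" using local_ring_iff[OF PX] by blast
    from has_valE[OF PX this] obtain e f g where fg: "homogeneous e f" "nonvanishing e g" "homogeneous e g" "z = quo f g"
      "\<And>a. a \<in> P \<Longrightarrow> mpol_eval a g \<noteq> 0" by metis
    define w where "w = quo g (coord_form i ^ e)"
    have w: "residue_const w (mpol_eval a g)" "mpol_eval a g \<noteq> 0" using form[OF fg(3)] fg(5)[OF aP] by (auto simp: w_def)
    have "\<not> nonunit w"
    proof
      assume "nonunit w"
      then have "residue_const w 0" by (simp add: residue_const_def emb_hom nonunit_def)
      then show False using w residue_const_unique by blast
    qed
    then have "inverse w \<in> B" using w(1) by (auto simp: nonunit_def residue_const_def)
    moreover have "z = quo f (coord_form i ^ e) * inverse w"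
      unfolding fg(4) fraction_in_coords(1)[OF i(1) fg(1,2)] w_def by (simp add: divide_inverse)
    moreover have "quo f (coord_form i ^ e) \<in> B" using form[OF fg(1)] by (simp add: residue_const_def)
    ultimately have "z \<in> B" using const_subringD(3)[OF B] by simp
    then show False using zB by simp
  qed
  then show ?thesis using PX by blast
qed

end

context proj_curve
begin

theorem nonconstant_has_pole:
  assumes z: "z \<notin> range emb" shows "\<exists>P\<in>X. z \<notin> local_ring quo P"
proof -
  let ?u = "inverse z"
  have u: "?u \<notin> range emb" by (rule inverse_nonconst[OF z])
  have z0: "z \<noteq> 0" using z rangeI[of emb 0] by (auto simp: emb_hom)
  define \<A> where "\<A> = {A. const_subring A \<and> ?u \<in> A \<and> z \<notin> A}"
  have "range (ev ?u) \<in> \<A>"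
  proof -
    have "const_subring (range (ev ?u))" unfolding const_subring_def
    proof (intro conjI ballI)
      show "range emb \<subseteq> range (ev ?u)" using ev_const[of ?u] by (metis image_subsetI rangeI)
      fix v w assume "v \<in> range (ev ?u)" "w \<in> range (ev ?u)"
      then obtain p q where "v = ev ?u p" "w = ev ?u q" by blast
      then have "v + w = ev ?u (p + q)" "v * w = ev ?u (p * q)" by (simp_all add: ev_add ev_mult)
      then show "v + w \<in> range (ev ?u)" "v * w \<in> range (ev ?u)" by auto
    qed
    moreover have "?u = ev ?u [:0, 1:]" by (simp add: ev_pCons emb_hom)
    then have "?u \<in> range (ev ?u)" by (rule range_eqI)
    moreover have "z \<notin> range (ev ?u)"
    proof
      assume "z \<in> range (ev ?u)"
      then obtain p where "z = ev ?u p" by blast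
      then have "ev ?u (pCons 0 p) = ?u * z" by (simp only: ev_pCons emb_hom add_0_left)
      then have "ev ?u (1 - pCons 0 p) = 0" using z0 by (simp only: ev_diff ev_1 left_inverse) simp
      then have "1 - pCons 0 p = 0" by (rule ev_eq_0[OF u])
      then have "coeff (1 - pCons 0 p) 0 = 0" by simp
      then show False by simp
    qed
    ultimately show ?thesis unfolding \<A>_def by blast
  qed
  then have ne: "\<A> \<noteq> {}" by blast
  have "\<Union>\<C> \<in> \<A>" if C: "\<C> \<noteq> {}" "subset.chain \<A> \<C>" for \<C>
  proof -
    have sub: "\<And>A. A \<in> \<C> \<Longrightarrow> const_subring A \<and> ?u \<in> A \<and> z \<notin> A"
      and total: "\<And>A A'. A \<in> \<C> \<Longrightarrow> A' \<in> \<C> \<Longrightarrow> A \<subseteq> A' \<or> A' \<subseteq> A"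
      using C(2) unfolding subset.chain_def \<A>_def by blast+
    have "const_subring (\<Union>\<C>)" unfolding const_subring_def
    proof (intro conjI ballI)
      show "range emb \<subseteq> \<Union>\<C>" using C(1) sub unfolding const_subring_def by blast
      fix v w assume "v \<in> \<Union>\<C>" "w \<in> \<Union>\<C>"
      then obtain A A' where A: "A \<in> \<C>" "A' \<in> \<C>" "v \<in> A" "w \<in> A'" by blast
      then obtain A'' where "A'' \<in> \<C>" "v \<in> A''" "w \<in> A''" using total[OF A(1,2)] by blast
      then show "v + w \<in> \<Union>\<C>" "v * w \<in> \<Union>\<C>" using sub const_subringD(2,3) by blast+
    qed
    then show ?thesis unfolding \<A>_def using C(1) sub by blast
  qed
  from subset_Zorn_nonempty[OF ne this] obtain B where B: "B \<in> \<A>" "\<And>A. A \<in> \<A> \<Longrightarrow> B \<subseteq> A \<Longrightarrow> A = B" by blast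
  interpret maximal_avoiding X quo z B
    by unfold_locales (use B in \<open>auto simp: \<A>_def\<close>)
  show ?thesis by (rule pole_exists[OF z])
qed

end

section \<open>Local rings\<close>

context proj_curve
begin

lemma local_ringD: "P \<in> X \<Longrightarrow> h \<in> local_ring quo P \<Longrightarrow> \<exists>c. has_val P h c"
  by (simp add: local_ring_iff)

lemma local_ringI: "P \<in> X \<Longrightarrow> has_val P h c \<Longrightarrow> h \<in> local_ring quo P"
  unfolding local_ring_iff by (rule exI)

lemma const_subring_local: assumes P: "P \<in> X" shows "const_subring (local_ring quo P)"
  unfolding const_subring_def
proof (intro conjI ballI)
  show "range emb \<subseteq> local_ring quo P" using local_ringI[OF P has_val_emb] by blast
  fix u v assume uv: "u \<in> local_ring quo P" "v \<in> local_ring quo P"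
  obtain c where c: "has_val P u c" using local_ringD[OF P uv(1)] by blast
  obtain d where d: "has_val P v d" using local_ringD[OF P uv(2)] by blast
  show "u + v \<in> local_ring quo P" by (rule local_ringI[OF P has_val_add[OF P c d]])
  show "u * v \<in> local_ring quo P" by (rule local_ringI[OF P has_val_mult[OF P c d]])
qed

lemma has_val_ev: assumes P: "P \<in> X" and y: "has_val P y c" shows "has_val P (ev y q) (poly q c)"
proof (induction q)
  case 0 show ?case using has_val_emb[of P 0] by (simp add: emb_hom)
next
  case (pCons a q)
  show ?case using has_val_add[OF P has_val_emb has_val_mult[OF P y pCons.IH]] by (simp add: ev_pCons)
qed

lemma has_val_zero_mult: assumes P: "P \<in> X" and "has_val P h 0" "u \<in> local_ring quo P" shows "has_val P (h * u) 0"
proof -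
  obtain c where "has_val P u c" using local_ringD[OF P assms(3)] by blast
  from has_val_mult[OF P assms(2) this] show ?thesis by simp
qed

lemma local_quotient:
  assumes P: "P \<in> X" obtains u v where "u \<in> local_ring quo P" "v \<in> local_ring quo P" "v \<noteq> 0" "z = u / v"
proof -
  obtain b where b: "b \<in> P" "\<exists>i. b i \<noteq> 0" "P = {(\<lambda>i. c * b i) | c. c \<noteq> 0}" using point_rep[OF P] by blast
  then obtain i where bi: "b i \<noteq> 0" by blast
  have i: "affine_chart i" by (rule chartI[OF P b(1) bi])
  obtain e f g where z: "homogeneous e f" "nonvanishing e g" "z = quo f g" using quo_cases by metis
  have l: "quo h (coord_form i ^ e) \<in> local_ring quo P" if h: "homogeneous e h" for h
  proof -
    have "homogeneous e (coord_form i ^ e)" using homogeneous_power[OF coord_form(2), of e i] by simp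
    moreover have "\<not> vanishes_at (coord_form i ^ e) P"
      unfolding vanishes_at_def using b(1) bi by (auto intro!: bexI[of _ b] simp: mpol_eval_power)
    ultimately show ?thesis unfolding local_ring_def form_pair_def using h by blast
  qed
  have "homogeneous e g" using z(2) by (simp add: nonvanishing_def)
  then show thesis using that[OF l l fraction_in_coords(2)[OF i z(1,2)]] z fraction_in_coords(1)[OF i z(1,2)] by simp
qed

lemma local_param_val: "P \<in> X \<Longrightarrow> is_local_param quo P t \<Longrightarrow> has_val P h 0 \<longleftrightarrow> (\<exists>u\<in>local_ring quo P. h = t * u)"
  using local_max_ideal_iff unfolding is_local_param_def by blast

lemma local_param_zero: assumes P: "P \<in> X" and t: "is_local_param quo P t" shows "has_val P t 0"
proof -
  have "\<exists>u\<in>local_ring quo P. t = t * u"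
    by (rule bexI[of _ 1]) (simp_all add: const_subringD(6)[OF const_subring_local[OF P]])
  then show ?thesis using local_param_val[OF P t] by blast
qed

text \<open>If the maximal ideal were zero, the local ring would consist of constants, and so would its field of
  fractions \<open>F\<close>.\<close>

lemma local_param_nonconst:
  assumes P: "P \<in> X" and t: "is_local_param quo P t" shows "t \<notin> range emb"
proof
  assume "t \<in> range emb"
  then obtain c where c: "t = emb c" by blast
  have "has_val P t c" unfolding c by (rule has_val_emb)
  then have "c = 0" by (rule has_val_unique[OF P _ local_param_zero[OF P t]])
  then have t0: "t = 0" using c by (simp add: emb_hom)
  have const: "h \<in> range emb" if h: "h \<in> local_ring quo P" for h
  proof -
    obtain d where d: "has_val P h d" using local_ringD[OF P h] by blast
    have "has_val P (h + emb (- d)) 0" using has_val_add[OF P d has_val_emb[of P "- d"]] by simp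
    then have "h + emb (- d) = 0" unfolding local_param_val[OF P t] t0 by auto
    then have "h = emb d" by (simp add: emb_uminus)
    then show ?thesis by blast
  qed
  have "z \<in> range emb" for z
  proof -
    obtain u v where uv: "u \<in> local_ring quo P" "v \<in> local_ring quo P" "z = u / v" by (rule local_quotient[OF P])
    obtain c d where cd: "u = emb c" "v = emb d" using const[OF uv(1)] const[OF uv(2)] by blast
    have "z = emb (c / d)" unfolding uv(3) cd emb_divide ..
    then show ?thesis by blast
  qed
  then show False using finite_over_some by blast
qed

definition unit_at :: "('n, 'k) ppoint \<Rightarrow> 'f \<Rightarrow> bool" where
  "unit_at P u \<longleftrightarrow> (\<exists>c. c \<noteq> 0 \<and> has_val P u c)"

lemma unit_at_iff:
  assumes P: "P \<in> X" shows "unit_at P u \<longleftrightarrow> u \<in> local_ring quo P - local_max_ideal quo P"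
  unfolding Diff_iff local_ring_iff[OF P] local_max_ideal_iff[OF P]
proof
  assume "unit_at P u"
  then obtain c where c: "c \<noteq> 0" "has_val P u c" unfolding unit_at_def by blast
  then show "(\<exists>c. has_val P u c) \<and> \<not> has_val P u 0" using has_val_unique[OF P c(2), of 0] by auto
next
  assume *: "(\<exists>c. has_val P u c) \<and> \<not> has_val P u 0"
  then obtain c where "has_val P u c" by (elim conjE exE)
  moreover from this have "c \<noteq> 0" using * by auto
  ultimately show "unit_at P u" unfolding unit_at_def by (intro exI conjI)
qed

lemma unit_at_mult:
  assumes P: "P \<in> X" and "unit_at P u" "unit_at P v" shows "unit_at P (u * v)"
proof -
  obtain c d where "c \<noteq> 0" "has_val P u c" "d \<noteq> 0" "has_val P v d" using assms(2,3) unfolding unit_at_def by blast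
  then have "has_val P (u * v) (c * d)" "c * d \<noteq> 0" using has_val_mult[OF P] by simp_all
  then show ?thesis unfolding unit_at_def by blast
qed

lemma unit_at_inverse:
  assumes P: "P \<in> X" and "unit_at P u" shows "unit_at P (inverse u)" "u \<noteq> 0"
proof -
  obtain c where c: "c \<noteq> 0" "has_val P u c" using assms(2) unfolding unit_at_def by blast
  have "inverse c \<noteq> 0" using c(1) by simp
  then show "unit_at P (inverse u)" using has_val_inverse(1)[OF P c(2,1)] unfolding unit_at_def by blast
  show "u \<noteq> 0" by (rule has_val_inverse(2)[OF P c(2,1)])
qed

lemma unit_at_one: "unit_at P 1"
  unfolding unit_at_def using has_val_emb[of P 1] by (intro exI[of _ 1]) (simp add: emb_hom)

lemma unit_at_power: "P \<in> X \<Longrightarrow> unit_at P u \<Longrightarrow> unit_at P (u ^ n)"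
  by (induction n) (auto simp: unit_at_one unit_at_mult)

text \<open>Some power of \<open>t\<close> does not divide \<open>h\<close>: an equation between \<open>h\<close> and \<open>t\<close> makes \<open>h\<close> a divisor of a
  non-zero polynomial in \<open>t\<close>, which is a power of \<open>t\<close> times a unit. This replaces the usual appeal to
  Krull's intersection theorem.\<close>

lemma local_factorization_integral:
  assumes P: "P \<in> X" and t: "is_local_param quo P t" and h: "h \<in> local_ring quo P" "h \<noteq> 0"
  shows "\<exists>n u. unit_at P u \<and> h = t ^ n * u"
proof -
  note L = const_subringD[OF const_subring_local[OF P]]
  have tP: "has_val P t 0" by (rule local_param_zero[OF P t])
  have tL: "t \<in> local_ring quo P" by (rule local_ringI[OF P tP])
  have t0: "t \<noteq> 0" using local_param_nonconst[OF P t] rangeI[of emb 0] by (auto simp: emb_hom)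
  have "\<exists>n. \<forall>w\<in>local_ring quo P. h \<noteq> t ^ n * w"
  proof (cases "h \<in> range emb")
    case True
    then obtain c where c: "h = emb c" by blast
    have "c \<noteq> 0" using h(2) c by (auto simp: emb_hom)
    have hc: "has_val P h c" unfolding c by (rule has_val_emb)
    have "\<not> has_val P h 0" using has_val_unique[OF P hc, of 0] \<open>c \<noteq> 0\<close> by auto
    then show ?thesis unfolding local_param_val[OF P t] by (intro exI[of _ 1]) simp
  next
    case False
    obtain q r where q: "q \<noteq> 0" "ev t q = h * r" "r \<in> local_ring quo P"
    proof -
      obtain q r where qr: "q \<noteq> 0" "ev t q = h * r"
        "\<forall>A. const_subring A \<longrightarrow> h \<in> A \<longrightarrow> t \<in> A \<longrightarrow> r \<in> A"
        using dependence_mod_ideal[OF False, of t] by blast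
      have "r \<in> local_ring quo P" using qr(3) const_subring_local[OF P] h(1) tL by simp
      then show thesis using that qr(1,2) by blast
    qed
    define m where "m = order 0 q"
    obtain q' where q': "q = [:0, 1:] ^ m * q'" "poly q' 0 \<noteq> 0"
      using order_decomp[OF q(1), of 0] by (auto simp: m_def poly_eq_0_iff_dvd)
    have et: "ev t q = t ^ m * ev t q'" unfolding q'(1) by (simp add: ev_mult ev_power ev_pCons emb_hom)
    have "h \<noteq> t ^ Suc m * w" if w: "w \<in> local_ring quo P" for w
    proof
      assume "h = t ^ Suc m * w"
      then have "t ^ m * ev t q' = t ^ m * (t * (w * r))" using q(2) et by (simp add: mult_ac)
      then have "ev t q' = t * (w * r)" using t0 by simp
      then have "has_val P (ev t q') 0" using has_val_zero_mult[OF P tP L(3)[OF w q(3)]] by simp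
      then have "0 = poly q' 0" by (rule has_val_unique[OF P _ has_val_ev[OF P tP]])
      then show False using q'(2) by simp
    qed
    then show ?thesis by blast
  qed
  define n where "n = (LEAST n. \<forall>w\<in>local_ring quo P. h \<noteq> t ^ n * w)"
  have n: "\<forall>w\<in>local_ring quo P. h \<noteq> t ^ n * w"
    unfolding n_def by (rule LeastI_ex) fact
  have "n \<noteq> 0"
  proof
    assume "n = 0"
    moreover have "h \<noteq> t ^ n * h" using n h(1) by (rule bspec)
    ultimately show False by simp
  qed
  then obtain m where m: "n = Suc m" by (cases n) auto
  have "m < n" using m by simp
  from not_less_Least[OF this[unfolded n_def]]
  obtain u where u: "u \<in> local_ring quo P" "h = t ^ m * u" by blast
  have "\<not> has_val P u 0"
  proof
    assume "has_val P u 0"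
    then obtain w where w: "w \<in> local_ring quo P" "u = t * w" using local_param_val[OF P t] by blast
    have "h \<noteq> t ^ n * w" using n w(1) by (rule bspec)
    moreover have "h = t ^ n * w" unfolding u(2) w(2) m by (simp add: mult_ac)
    ultimately show False by (rule notE)
  qed
  then have "unit_at P u"
    unfolding unit_at_iff[OF P] using u(1) local_max_ideal_iff[OF P] by simp
  then show ?thesis using u(2) by (intro exI conjI)
qed

lemma local_factorization:
  assumes P: "P \<in> X" and t: "is_local_param quo P t" and h: "h \<noteq> 0"
  shows "\<exists>n u. unit_at P u \<and> h = t powi n * u"
proof -
  have t0: "t \<noteq> 0" using local_param_nonconst[OF P t] rangeI[of emb 0] by (auto simp: emb_hom)
  obtain u v where uv: "u \<in> local_ring quo P" "v \<in> local_ring quo P" "v \<noteq> 0" "h = u / v" by (rule local_quotient[OF P])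
  then have "u \<noteq> 0" using h by auto
  obtain m u' where m: "unit_at P u'" "u = t ^ m * u'" using local_factorization_integral[OF P t uv(1) \<open>u \<noteq> 0\<close>] by blast
  obtain n v' where n: "unit_at P v'" "v = t ^ n * v'" using local_factorization_integral[OF P t uv(2,3)] by blast
  have "h = t powi (int m - int n) * (u' * inverse v')"
    unfolding uv(4) m(2) n(2) using t0 by (simp add: power_int_diff field_simps)
  moreover have "unit_at P (u' * inverse v')" by (intro unit_at_mult unit_at_inverse P m n)
  ultimately show ?thesis by blast
qed

text \<open>The valuation is defined by a description over all local parameters; these differ by units, so the
  exponent is unique.\<close>

lemma val_at_eq:
  assumes P: "P \<in> X" and t: "is_local_param quo P t" and u: "unit_at P u"
  shows "val_at quo P (t powi n * u) = n"
proof -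
  note L = const_subringD[OF const_subring_local[OF P]]
  have t0: "t \<noteq> 0" if "is_local_param quo P t" for t
    using local_param_nonconst[OF P that] rangeI[of emb 0] by (auto simp: emb_hom)
  have pos: "m \<le> n" if "t powi n * u = t powi m * v" "unit_at P u" "unit_at P v" for m n u v
  proof (rule ccontr)
    assume "\<not> m \<le> n"
    define k where "k = nat (m - n - 1)"
    have k: "m = n + int (Suc k)" using \<open>\<not> m \<le> n\<close> by (simp add: k_def)
    have "t powi m = t powi n * (t * t ^ k)" unfolding k using t0[OF t] by (simp add: power_int_add power_int_add_1)
    then have "u = t * (t ^ k * v)" using that(1) t0[OF t] by simp
    moreover have "t ^ k * v \<in> local_ring quo P" 
    proof (rule L(3)[OF L(4)])
      show "t \<in> local_ring quo P" by (rule local_ringI[OF P local_param_zero[OF P t]])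
      show "v \<in> local_ring quo P" using that(3) local_ringI[OF P] unfolding unit_at_def by blast
    qed
    ultimately have "has_val P u 0" using has_val_zero_mult[OF P local_param_zero[OF P t]] by simp
    then show False using that(2) has_val_unique[OF P] unfolding unit_at_def by blast
  qed
  have uniq: "m = n" if "t powi n * u = t powi m * v" "unit_at P u" "unit_at P v" for m n u v
    using pos[OF that] pos[OF that(1)[symmetric] that(3,2)] by simp
  show ?thesis unfolding val_at_def
  proof (rule the_equality)
    show "\<exists>t' u'. is_local_param quo P t' \<and> u' \<in> local_ring quo P - local_max_ideal quo P \<and> t powi n * u = t' powi n * u'"
      using t u unit_at_iff[OF P] by blast
    fix m assume "\<exists>t' u'. is_local_param quo P t' \<and> u' \<in> local_ring quo P - local_max_ideal quo P \<and> t powi n * u = t' powi m * u'"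
    then obtain t' u' where t': "is_local_param quo P t'" "unit_at P u'" "t powi n * u = t' powi m * u'"
      using unit_at_iff[OF P] by blast
    obtain w where w: "w \<in> local_ring quo P" "t' = t * w"
      using local_param_zero[OF P t'(1)] local_param_val[OF P t] by blast
    obtain w' where w': "w' \<in> local_ring quo P" "t = t' * w'"
      using local_param_zero[OF P t] local_param_val[OF P t'(1)] by blast
    obtain c c' where c: "has_val P w c" "has_val P w' c'" using local_ringD[OF P w(1)] local_ringD[OF P w'(1)] by blast
    have "t' * w' = t * (w * w')" unfolding w(2) by (rule mult.assoc)
    then have "t = t * (w * w')" by (simp only: w'(2)[symmetric])
    then have "w * w' = 1" using t0[OF t] by simp
    then have "c * c' = 1" using has_val_unique[OF P has_val_mult[OF P c]] has_val_emb[of P 1] by (simp add: emb_hom)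
    then have "c \<noteq> 0" by auto
    then have w_unit: "unit_at P w" using c(1) unfolding unit_at_def by (intro exI conjI)
    have "unit_at P (w powi m)"
      by (cases m rule: int_cases2)
        (auto simp: power_int_minus power_inverse intro!: unit_at_power unit_at_inverse P w_unit)
    then have "unit_at P (w powi m * u')" by (intro unit_at_mult P t'(2))
    moreover have "t powi n * u = t powi m * (w powi m * u')"
      unfolding t'(3) w(2) by (simp add: power_int_mult_distrib mult.assoc)
    ultimately show "m = n" using uniq u by blast
  qed
qed

subsection \<open>Finiteness of zeros and poles\<close>

text \<open>At a zero of \<open>h\<close> in a given chart, each affine coordinate takes a value that is a root of a fixed non-zero
  polynomial.\<close>

lemma finite_zeros:
  assumes h: "h \<notin> range emb" shows "finite {P\<in>X. has_val P h 0}"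
proof -
  \<comment> \<open>a polynomial satisfied by the values of the coordinate \<open>j\<close> of chart \<open>i\<close> at the zeros of \<open>h\<close>\<close>
  define q where "q = (\<lambda>i j. SOME q. q \<noteq> 0 \<and> (\<exists>r. ev (affine_coord i j) q = h * r \<and>
     (\<forall>A. const_subring A \<longrightarrow> h \<in> A \<longrightarrow> affine_coord i j \<in> A \<longrightarrow> r \<in> A)))"
  have q: "q i j \<noteq> 0 \<and> (\<exists>r. ev (affine_coord i j) (q i j) = h * r \<and>
     (\<forall>A. const_subring A \<longrightarrow> h \<in> A \<longrightarrow> affine_coord i j \<in> A \<longrightarrow> r \<in> A))" for i j
    unfolding q_def by (rule someI_ex) (use dependence_mod_ideal[OF h, of "affine_coord i j"] in blast)
  define B where "B = (\<lambda>i. PiE UNIV (\<lambda>j. {c. poly (q i j) c = 0}))"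
  have fin: "finite (B i)" for i unfolding B_def using q by (intro finite_PiE) (auto intro: poly_roots_finite)
  have "{P\<in>X. has_val P h 0} \<subseteq> (\<Union>i. (\<lambda>b. {(\<lambda>j. c * b j) | c. c \<noteq> 0}) ` B i)"
  proof
    fix P assume "P \<in> {P\<in>X. has_val P h 0}"
    then have P: "P \<in> X" and hP: "has_val P h 0" by auto
    obtain a where a: "a \<in> P" "\<exists>i. a i \<noteq> 0" "P = {(\<lambda>i. c * a i) | c. c \<noteq> 0}" using point_rep[OF P] by blast
    then obtain i where i: "a i \<noteq> 0" by blast
    define b where "b = (\<lambda>j. a j / a i)"
    have "b \<in> B i" unfolding B_def
    proof (rule PiE_I)
      fix j
      have y: "has_val P (affine_coord i j) (b j)" unfolding b_def by (rule has_val_affine_coord[OF P a(1) i])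
      obtain r where r: "ev (affine_coord i j) (q i j) = h * r"
        "\<And>A. const_subring A \<Longrightarrow> h \<in> A \<Longrightarrow> affine_coord i j \<in> A \<Longrightarrow> r \<in> A" using q by blast
      have "r \<in> local_ring quo P" 
        by (rule r(2)[OF const_subring_local[OF P] local_ringI[OF P hP] local_ringI[OF P y]])
      then have "has_val P (ev (affine_coord i j) (q i j)) 0" unfolding r(1) by (rule has_val_zero_mult[OF P hP])
      then have "poly (q i j) (b j) = 0" using has_val_unique[OF P has_val_ev[OF P y]] by blast
      then show "b j \<in> {c. poly (q i j) c = 0}" by simp
    qed auto
    moreover have "P = {(\<lambda>j. c * b j) | c. c \<noteq> 0}"
    proof (intro equalityI subsetI)
      fix v assume "v \<in> P"
      then obtain c where "c \<noteq> 0" "v = (\<lambda>j. c * a j)" using a(3) by auto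
      then have "c * a i \<noteq> 0" "v = (\<lambda>j. (c * a i) * b j)" using i by (auto simp: b_def)
      then show "v \<in> {(\<lambda>j. c * b j) | c. c \<noteq> 0}" by blast
    next
      fix v assume "v \<in> {(\<lambda>j. c * b j) | c. c \<noteq> 0}"
      then obtain c where "c \<noteq> 0" "v = (\<lambda>j. c * b j)" by blast
      then have "c / a i \<noteq> 0" "v = (\<lambda>j. (c / a i) * a j)" using i by (auto simp: b_def)
      then have "v \<in> {(\<lambda>i. c * a i) | c. c \<noteq> 0}" by blast
      then show "v \<in> P" unfolding a(3) .
    qed
    ultimately show "P \<in> (\<Union>i. (\<lambda>b. {(\<lambda>j. c * b j) | c. c \<noteq> 0}) ` B i)" by blast
  qed
  then show ?thesis by (rule finite_subset) (use fin in auto)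
qed

end

section \<open>Expansions of functions at points\<close>

locale completed_curve = proj_curve X quo
  for X :: "('n::finite, 'k::{alg_closed_field, field_char_0}) ppoint set"
    and quo :: "('n, 'k) mpol \<Rightarrow> ('n, 'k) mpol \<Rightarrow> 'f::field" +
  fixes \<iota> :: "('n, 'k) ppoint \<Rightarrow> 'f \<Rightarrow> 'k fls"
  assumes completion: "\<And>P. P \<in> X \<Longrightarrow> is_completion quo P (\<iota> P)"
begin

lemma expansion_hom:
  assumes P: "P \<in> X"
  shows "\<iota> P (f + h) = \<iota> P f + \<iota> P h" "\<iota> P (f * h) = \<iota> P f * \<iota> P h" "\<iota> P (emb c) = fls_const c"
    "\<iota> P 0 = 0" "\<iota> P 1 = 1" "\<iota> P (f - h) = \<iota> P f - \<iota> P h" "\<iota> P (sum l I) = (\<Sum>i\<in>I. \<iota> P (l i))"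
    "\<iota> P (f ^ m) = \<iota> P f ^ m"
proof -
  show add: "\<iota> P (f + h) = \<iota> P f + \<iota> P h" and mult: "\<iota> P (f * h) = \<iota> P f * \<iota> P h"
    and const: "\<iota> P (emb c) = fls_const c" for f h c
    using completion[OF P] unfolding is_completion_def by blast+
  show zero: "\<iota> P 0 = 0" using const[of 0] by (simp add: emb_hom)
  show one: "\<iota> P 1 = 1" using const[of 1] by (simp add: emb_hom)
  show "\<iota> P (f - h) = \<iota> P f - \<iota> P h" using add[of "f - h" h] by simp
  show "\<iota> P (sum l I) = (\<Sum>i\<in>I. \<iota> P (l i))" by (induction I rule: infinite_finite_induct) (auto simp: add zero)
  show "\<iota> P (f ^ m) = \<iota> P f ^ m" by (induction m) (auto simp: mult one)
qed

lemma expansion_subdegree: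
  "P \<in> X \<Longrightarrow> f \<noteq> 0 \<Longrightarrow> \<iota> P f \<noteq> 0 \<and> fls_subdegree (\<iota> P f) = val_at quo P f"
  using completion unfolding is_completion_def by blast

lemma expansion_dense: assumes P: "P \<in> X" shows "\<exists>f. val_ge (s - \<iota> P f) n"
proof -
  obtain f where "s = \<iota> P f \<or> fls_subdegree (s - \<iota> P f) \<ge> n"
    using completion[OF P] unfolding is_completion_def by blast
  then have "val_ge (s - \<iota> P f) n" by (auto simp: val_ge_def)
  then show ?thesis by (rule exI)
qed

text \<open>From here on orders of functions are read off from their Laurent expansions.\<close>

lemma expansion_val_ge:
  assumes P: "P \<in> X" shows "f \<in> local_ring quo P \<longleftrightarrow> val_ge (\<iota> P f) 0" "has_val P f 0 \<longleftrightarrow> val_ge (\<iota> P f) 1"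
proof -
  obtain t where t: "is_local_param quo P t" using curve P unfolding algebraic_curve_def by blast
  have t0: "t \<noteq> 0" using local_param_nonconst[OF P t] rangeI[of emb 0] by (auto simp: emb_hom)
  have tP: "has_val P t 0" by (rule local_param_zero[OF P t])
  note L = const_subringD[OF const_subring_local[OF P]]
  have "(f \<in> local_ring quo P \<longleftrightarrow> val_ge (\<iota> P f) 0) \<and> (has_val P f 0 \<longleftrightarrow> val_ge (\<iota> P f) 1)"
  proof (cases "f = 0")
    case True
    then show ?thesis using L(5) has_val_emb[of P 0] by (simp add: expansion_hom[OF P] emb_hom)
  next
    case False
    obtain n u where u: "unit_at P u" "f = t powi n * u" using local_factorization[OF P t False] by blast
    have sd: "fls_subdegree (\<iota> P f) = n" "\<iota> P f \<noteq> 0"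
      using expansion_subdegree[OF P False] val_at_eq[OF P t u(1)] u(2) by auto
    have uL: "u \<in> local_ring quo P" and u0: "\<not> has_val P u 0"
      using u(1) unit_at_iff[OF P] local_max_ideal_iff[OF P] by auto
    have tpow: "has_val P (t ^ Suc m * w) 0" if "w \<in> local_ring quo P" for m w
    proof -
      have "has_val P (t * (t ^ m * w)) 0"
        by (rule has_val_zero_mult[OF P tP L(3)[OF L(4)[OF local_ringI[OF P tP]] that]])
      then show ?thesis by (simp add: mult.assoc)
    qed
    have pos: "has_val P f 0" if n: "n \<ge> 1"
    proof -
      define m where "m = nat (n - 1)"
      have "n = int (Suc m)" using n by (simp add: m_def)
      then show ?thesis using tpow[OF uL, of m] u(2) by (simp only: power_int_of_nat)
    qed
    have neg: "f \<notin> local_ring quo P" if n: "n < 0"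
    proof
      assume f: "f \<in> local_ring quo P"
      define m where "m = nat (- n - 1)"
      have m: "n = - int (Suc m)" using n by (simp add: m_def)
      have "t powi n = inverse (t ^ Suc m)" unfolding m power_int_minus power_int_of_nat ..
      then have "t ^ Suc m * f = u" using t0 unfolding u(2) by (simp add: mult.assoc[symmetric] del: power_Suc)
      then show False using tpow[OF f, of m] u0 by simp
    qed
    consider "n \<ge> 1" | "n = 0" | "n < 0" by linarith
    then show ?thesis
    proof cases
      case 1
      then show ?thesis using pos local_ringI[OF P] sd by (auto simp: val_ge_def)
    next
      case 2
      then show ?thesis using uL u0 u(2) sd by (simp add: val_ge_def)
    next
      case 3
      then show ?thesis using neg local_ringI[OF P] sd by (auto simp: val_ge_def)
    qed
  qed
  then show "f \<in> local_ring quo P \<longleftrightarrow> val_ge (\<iota> P f) 0" "has_val P f 0 \<longleftrightarrow> val_ge (\<iota> P f) 1" by auto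
qed

lemma pole_inverse:
  assumes P: "P \<in> X" and f: "f \<notin> local_ring quo P" shows "has_val P (inverse f) 0"
proof -
  have f0: "f \<noteq> 0" using f const_subringD(5)[OF const_subring_local[OF P]] by auto
  have "\<iota> P f \<noteq> 0" using expansion_subdegree[OF P f0] by simp
  have "\<iota> P f * \<iota> P (inverse f) = 1" using f0 by (simp add: expansion_hom[OF P] flip: expansion_hom(2)[OF P])
  then have *: "\<iota> P (inverse f) \<noteq> 0" "fls_subdegree (\<iota> P f * \<iota> P (inverse f)) = 0" by auto
  have "fls_subdegree (\<iota> P f) < 0" using f expansion_val_ge(1)[OF P] by (auto simp: val_ge_def)
  then show ?thesis using * \<open>\<iota> P f \<noteq> 0\<close> unfolding expansion_val_ge(2)[OF P] by (simp add: val_ge_def)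
qed

lemma finite_poles: "finite {P\<in>X. f \<notin> local_ring quo P}"
proof (cases "f \<in> range emb")
  case True
  then have "{P\<in>X. f \<notin> local_ring quo P} = {}" using const_subringD(1)[OF const_subring_local] by blast
  then show ?thesis by (simp only: finite.emptyI)
next
  case False
  have "{P\<in>X. f \<notin> local_ring quo P} \<subseteq> {P\<in>X. has_val P (inverse f) 0}" using pole_inverse by blast
  then show ?thesis using finite_zeros[OF inverse_nonconst[OF False]] by (rule finite_subset)
qed

section \<open>Weak approximation\<close>

text \<open>A form \<open>e\<close> that is non-zero at the new point is added with a coefficient that avoids finitely many bad
  values.\<close>

lemma linear_form_avoiding:
  assumes "finite S" "S \<subseteq> X"
  shows "\<exists>l. \<forall>P\<in>S. \<not> vanishes_at (linear_form l) P"
  using assms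
proof (induction S)
  case empty then show ?case by simp
next
  case (insert P S)
  then obtain l where l: "\<And>P'. P' \<in> S \<Longrightarrow> \<not> vanishes_at (linear_form l) P'" by auto
  obtain a where a: "a \<in> P" using point_nonempty insert.prems by blast
  obtain i where i: "a i \<noteq> 0" using point_has_chart[OF _ a] insert.prems by blast
  define val where "val = (\<lambda>(P' :: ('n, 'k) ppoint) m. mpol_eval (SOME a. a \<in> P') (linear_form m))"
  have val: "vanishes_at (linear_form m) P' \<longleftrightarrow> val P' m = 0" if "P' \<in> insert P S" for P' m
  proof -
    have P': "P' \<in> X" using that insert.prems by blast
    have "(SOME a. a \<in> P') \<in> P'" by (rule someI_ex[OF point_nonempty[OF P']])
    then show ?thesis unfolding val_def by (rule vanishes_iff[OF P' linear_form(2)])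
  qed
  define e where "e = (\<lambda>j. if j = i then 1 else 0 :: 'k)"
  have eP: "val P e \<noteq> 0"
  proof -
    have "mpol_eval a (linear_form e) = a i" unfolding linear_form(1) e_def by (simp add: if_distrib[of "\<lambda>x. x * _"] cong: if_cong)
    then have "\<not> vanishes_at (linear_form e) P" using vanishes_iff[OF _ linear_form(2) a] insert.prems i by auto
    then show ?thesis using val by simp
  qed
  have line: "val P' (\<lambda>j. l j + c * e j) = val P' l + c * val P' e" for P' c
    unfolding val_def linear_form(1) by (simp add: algebra_simps sum.distrib sum_distrib_left)
  have "finite (\<Union>P'\<in>insert P S. {c. val P' l + c * val P' e = 0})"
  proof (rule finite_UN_I)
    show "finite (insert P S)" using insert by simp
    fix P' assume P': "P' \<in> insert P S"
    have "{c. val P' l + c * val P' e = 0} \<subseteq> {- val P' l / val P' e}"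
    proof
      fix c assume c: "c \<in> {c. val P' l + c * val P' e = 0}"
      have "val P' e \<noteq> 0"
      proof
        assume 0: "val P' e = 0"
        moreover have "val P' l + c * val P' e = 0" using c by (rule CollectD)
        ultimately have "val P' l = 0" by simp
        then show False using l[of P'] val[OF P'] eP 0 P' by auto
      qed
      then show "c \<in> {- val P' l / val P' e}" using c by (simp add: field_simps eq_neg_iff_add_eq_0)
    qed
    then show "finite {c. val P' l + c * val P' e = 0}" by (rule finite_subset) simp
  qed
  then obtain c where c: "c \<notin> (\<Union>P'\<in>insert P S. {c. val P' l + c * val P' e = 0})"
    using ex_new_if_finite[OF infinite_UNIV_char_0] by blast
  have "\<not> vanishes_at (linear_form (\<lambda>j. l j + c * e j)) P'" if P': "P' \<in> insert P S" for P'
    using c P' unfolding val[OF P'] line by blast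
  then show ?case by blast
qed

lemma linear_form_separating:
  assumes P: "P \<in> X" "P' \<in> X" "P \<noteq> P'"
  shows "\<exists>l. \<not> vanishes_at (linear_form l) P \<and> vanishes_at (linear_form l) P'"
proof -
  obtain a where a: "a \<in> P" "P = {(\<lambda>i. c * a i) | c. c \<noteq> 0}" using point_rep[OF P(1)] by blast
  obtain b where b: "b \<in> P'" "\<exists>i. b i \<noteq> 0" "P' = {(\<lambda>i. c * b i) | c. c \<noteq> 0}" using point_rep[OF P(2)] by blast
  obtain i where i: "b i \<noteq> 0" using b(2) by blast
  have "\<exists>j. b i * a j - b j * a i \<noteq> 0"
  proof (rule ccontr)
    assume "\<nexists>j. b i * a j - b j * a i \<noteq> 0"
    then have aj: "a j = (a i / b i) * b j" for j using i by (simp add: field_simps)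
    define r where "r = a i / b i"
    have ab: "a = (\<lambda>j. r * b j)" unfolding r_def by (rule ext) (rule aj)
    have r: "r \<noteq> 0"
    proof
      assume "r = 0"
      moreover obtain j where "a j \<noteq> 0" by (rule point_has_chart[OF P(1) a(1)])
      ultimately show False by (simp add: ab)
    qed
    have "P = P'"
    proof (intro equalityI subsetI)
      fix v assume "v \<in> P"
      then obtain c where "c \<noteq> 0" "v = (\<lambda>j. c * a j)" using a(2) by blast
      then have "c * r \<noteq> 0" "v = (\<lambda>j. (c * r) * b j)" using r by (simp_all add: ab mult.assoc)
      then show "v \<in> P'" unfolding b(3) by blast
    next
      fix v assume "v \<in> P'"
      then obtain c where c: "c \<noteq> 0" "v = (\<lambda>j. c * b j)" using b(3) by blast
      then have "c / r \<noteq> 0" "v = (\<lambda>j. (c / r) * a j)" using r by (simp_all add: ab)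
      then show "v \<in> P" unfolding a(2) by blast
    qed
    then show False using P(3) by simp
  qed
  then obtain j where j: "b i * a j - b j * a i \<noteq> 0" by blast
  define l where "l = (\<lambda>m. (if m = j then b i else 0) - (if m = i then b j else 0))"
  have lv: "mpol_eval v (linear_form l) = b i * v j - b j * v i" for v
  proof -
    have "mpol_eval v (linear_form l) = (\<Sum>m\<in>UNIV. (if m = j then b i * v j else 0) - (if m = i then b j * v i else 0))"
      unfolding linear_form(1) l_def by (intro sum.cong) auto
    then show ?thesis by (simp add: sum_subtractf)
  qed
  have "\<not> vanishes_at (linear_form l) P" using vanishes_iff[OF P(1) linear_form(2) a(1)] lv j by simp
  moreover have "vanishes_at (linear_form l) P'" using vanishes_iff[OF P(2) linear_form(2) b(1)] lv by simp
  ultimately show ?thesis by blast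
qed

text \<open>A product of linear forms that separate \<open>P\<close> from the other points, divided by a power of a linear form
  without zeros in \<open>S\<close>.\<close>

lemma function_with_values:
  assumes S: "finite S" "S \<subseteq> X" and P: "P \<in> S"
  shows "\<exists>e. has_val P e 1 \<and> (\<forall>P'\<in>S - {P}. has_val P' e 0)"
proof -
  obtain l0 where l0: "\<And>P. P \<in> S \<Longrightarrow> \<not> vanishes_at (linear_form l0) P" using linear_form_avoiding[OF S] by blast
  have PX: "P \<in> X" using P S by blast
  define h where "h = (\<lambda>l. quo (linear_form l) (linear_form l0))"
  have val: "\<exists>c. has_val P' (h l) c \<and> (c = 0 \<longleftrightarrow> vanishes_at (linear_form l) P')" if "P' \<in> S" for P' l
  proof -
    have P': "P' \<in> X" using that S by blast
    have "h l \<in> local_ring quo P'"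
      unfolding local_ring_def form_pair_def h_def using linear_form(2) l0[OF that] by blast
    then obtain c where c: "has_val P' (h l) c" using local_ringD[OF P'] by blast
    have "c = 0 \<longleftrightarrow> vanishes_at (linear_form l) P'"
    proof
      assume "vanishes_at (linear_form l) P'"
      then have "h l \<in> local_max_ideal quo P'"
        unfolding local_max_ideal_def form_pair_def h_def using linear_form(2) l0[OF that] by blast
      then show "c = 0" using local_max_ideal_iff[OF P'] has_val_unique[OF P' c] by blast
    next
      assume "c = 0"
      obtain a where a: "a \<in> P'" using point_nonempty[OF P'] by blast
      have nv: "nonvanishing 1 (linear_form l0)" unfolding nonvanishing_def using linear_form(2) l0[OF that] P' by blast
      obtain e f g where fg: "homogeneous e f" "nonvanishing e g" "homogeneous e g" "h l = quo f g"
        "\<And>a. a \<in> P' \<Longrightarrow> mpol_eval a g \<noteq> 0" "\<And>a. a \<in> P' \<Longrightarrow> mpol_eval a f = c * mpol_eval a g"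
        using has_valE[OF P' c] by metis
      have "vanishes_at (linear_form l * g - f * linear_form l0) P'"
        using quo_eq(1)[OF linear_form(2) nv fg(1,2)] fg(4) P' unfolding h_def by blast
      then have "mpol_eval a (linear_form l) * mpol_eval a g = 0"
        using fg(6)[OF a] a \<open>c = 0\<close> by (simp add: vanishes_at_def mpol_eval_diff mpol_eval_mult)
      then show "vanishes_at (linear_form l) P'" using vanishes_iff[OF P' linear_form(2) a] fg(5)[OF a] by simp
    qed
    then show ?thesis using c by blast
  qed
  have "\<exists>e c. c \<noteq> 0 \<and> has_val P e c \<and> (\<forall>P'\<in>T. has_val P' e 0) \<and> (\<forall>P'\<in>S. e \<in> local_ring quo P')"
    if "finite T" "T \<subseteq> S - {P}" for T
    using that
  proof (induction T)
    case empty
    show ?case using const_subringD(6)[OF const_subring_local] has_val_emb[of P 1] S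
      by (intro exI[of _ 1]) (auto simp: emb_hom)
  next
    case (insert P' T)
    then have "T \<subseteq> S - {P}" by blast
    from insert.IH[OF this] obtain e c where e': "c \<noteq> 0" "has_val P e c" "\<forall>P'\<in>T. has_val P' e 0"
      "\<forall>P'\<in>S. e \<in> local_ring quo P'" by (elim exE conjE)
    note e = e'(1,2) bspec[OF e'(3)] bspec[OF e'(4)]
    have P': "P' \<in> S" "P' \<in> X" "P \<noteq> P'" using insert.prems S by auto
    obtain l where l: "\<not> vanishes_at (linear_form l) P" "vanishes_at (linear_form l) P'"
      using linear_form_separating[OF PX P'(2,3)] by blast
    obtain d where d: "has_val P (h l) d" "d \<noteq> 0" using val[OF P, of l] l(1) by blast
    have hl: "has_val P' (h l) 0" using val[OF P'(1), of l] l(2) by auto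
    have hL: "h l \<in> local_ring quo P''" if "P'' \<in> S" for P'' using val[OF that, of l] local_ringI S(2) that by blast
    have "has_val P (h l * e) (d * c)" by (rule has_val_mult[OF PX d(1) e(2)])
    moreover have "has_val P'' (h l * e) 0" if "P'' \<in> insert P' T" for P''
    proof (cases "P'' = P'")
      case True then show ?thesis using has_val_zero_mult[OF P'(2) hl e(4)[OF P'(1)]] by simp
    next
      case False
      then have T: "P'' \<in> T" "P'' \<in> S" "P'' \<in> X" using that insert.prems S by auto
      show ?thesis using has_val_zero_mult[OF T(3) e(3)[OF T(1)] hL[OF T(2)]] by (simp add: mult.commute)
    qed
    moreover have "h l * e \<in> local_ring quo P''" if "P'' \<in> S" for P''
    proof -
      have "P'' \<in> X" using that S by blast
      then show ?thesis using const_subringD(3)[OF const_subring_local hL[OF that] e(4)[OF that]] by simp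
    qed
    moreover have "d * c \<noteq> 0" using d(2) e(1) by simp
    ultimately show ?case by (intro exI[of _ "h l * e"] exI[of _ "d * c"]) blast
  qed
  from this[of "S - {P}"] S(1) obtain e c where e: "c \<noteq> 0" "has_val P e c" "\<And>P'. P' \<in> S - {P} \<Longrightarrow> has_val P' e 0"
    by auto
  have "has_val P (emb (inverse c) * e) (inverse c * c)" by (rule has_val_mult[OF PX has_val_emb e(2)])
  then have "has_val P (emb (inverse c) * e) 1" using e(1) by simp
  moreover have "has_val P' (emb (inverse c) * e) 0" if P': "P' \<in> S - {P}" for P'
  proof -
    have "P' \<in> X" using P' S by blast
    from has_val_mult[OF this has_val_emb e(3)[OF P'], of "inverse c"] show ?thesis by simp
  qed
  ultimately show ?thesis by blast
qed

text \<open>If \<open>e\<close> has the required values, \<open>1 - (1 - e\<^sup>N)\<^sup>N\<close> has them to order \<open>N\<close>.\<close>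

lemma approximate_indicator:
  assumes S: "finite S" "S \<subseteq> X" and P: "P \<in> S"
  shows "\<exists>e. val_ge (\<iota> P (1 - e)) (int N) \<and> (\<forall>P'\<in>S - {P}. val_ge (\<iota> P' e) (int N))"
proof -
  obtain e where e: "has_val P e 1" "\<And>P'. P' \<in> S - {P} \<Longrightarrow> has_val P' e 0" using function_with_values[OF S P] by blast
  have PX: "P \<in> X" using P S by blast
  define w where "w = 1 - e ^ N"
  have "has_val P (e ^ N) 1"
  proof (induction N)
    case 0 show ?case using has_val_emb[of P 1] by (simp add: emb_hom)
  next
    case (Suc N) show ?case using has_val_mult[OF PX e(1) Suc] by simp
  qed
  from has_val_add[OF PX has_val_emb[of P 1] has_val_mult[OF PX has_val_emb[of P "- 1"] this]]
  have "has_val P w 0" by (simp add: w_def emb_hom emb_uminus)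
  then have "val_ge (\<iota> P w) 1" using expansion_val_ge(2)[OF PX] by simp
  from val_ge_power[OF this, of N] have "val_ge (\<iota> P (1 - (1 - w ^ N))) (int N)" by (simp add: expansion_hom[OF PX])
  moreover have "val_ge (\<iota> P' (1 - w ^ N)) (int N)" if P': "P' \<in> S - {P}" for P'
  proof -
    have X': "P' \<in> X" using P' S by blast
    have v: "val_ge (\<iota> P' e) 1" using e(2)[OF P'] expansion_val_ge(2)[OF X'] by simp
    have "1 - w ^ N = (1 - w) * (\<Sum>i<N. w ^ i)" by (rule one_diff_power_eq)
    then have eq: "1 - w ^ N = e ^ N * (\<Sum>i<N. w ^ i)" by (simp add: w_def)
    have vN: "val_ge (\<iota> P' (e ^ N)) (int N)" using val_ge_power[OF v, of N] by (simp add: expansion_hom[OF X'])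
    have "val_ge (\<iota> P' (1::'f)) 0" by (simp add: expansion_hom[OF X'] val_ge_iff)
    then have "val_ge (\<iota> P' w) 0" unfolding w_def expansion_hom(6)[OF X']
      by (intro val_ge_diff val_ge_mono[OF vN]) simp_all
    then have "val_ge (\<iota> P' (\<Sum>i<N. w ^ i)) 0"
      unfolding expansion_hom(7,8)[OF X'] using val_ge_power[of "\<iota> P' w" 0] by (intro val_ge_sum) simp
    from val_ge_mult[OF vN this] show ?thesis unfolding eq expansion_hom(2)[OF X'] by simp
  qed
  ultimately show ?thesis by blast
qed

text \<open>Functions approximating the single components exist by density of \<open>F\<close> in its completions. They are glued
  with approximate indicators, taken to an order \<open>M\<close> that outweighs all their poles in \<open>S\<close>.\<close>

theorem weak_approximation:
  assumes S: "finite S" "S \<subseteq> X"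
  shows "\<exists>h. \<forall>P\<in>S. val_ge (v P - \<iota> P h) 0"
proof -
  have "\<forall>P. \<exists>h. P \<in> S \<longrightarrow> val_ge (v P - \<iota> P h) 0" using expansion_dense S by blast
  then obtain h where h: "\<And>P. P \<in> S \<Longrightarrow> val_ge (v P - \<iota> P (h P)) 0" by metis
  obtain M where M: "\<And>P P'. P \<in> S \<Longrightarrow> P' \<in> S \<Longrightarrow> val_ge (\<iota> P' (h P)) (- int M)"
    using val_ge_bound[of "S \<times> S" "\<lambda>(P, P'). \<iota> P' (h P)"] S(1) by auto
  have "\<forall>P. \<exists>e. P \<in> S \<longrightarrow> val_ge (\<iota> P (1 - e)) (int M) \<and> (\<forall>P'\<in>S - {P}. val_ge (\<iota> P' e) (int M))"
    using approximate_indicator[OF S] by blast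
  then obtain e where e: "\<And>P. P \<in> S \<Longrightarrow> val_ge (\<iota> P (1 - e P)) (int M)"
    "\<And>P P'. P \<in> S \<Longrightarrow> P' \<in> S - {P} \<Longrightarrow> val_ge (\<iota> P' (e P)) (int M)" by metis
  have "val_ge (v P - \<iota> P (\<Sum>P'\<in>S. e P' * h P')) 0" if P: "P \<in> S" for P
  proof -
    have PX: "P \<in> X" using P S by blast
    have eq: "v P - \<iota> P (\<Sum>P'\<in>S. e P' * h P')
        = (v P - \<iota> P (h P)) + \<iota> P (1 - e P) * \<iota> P (h P) - (\<Sum>P'\<in>S - {P}. \<iota> P (e P') * \<iota> P (h P'))"
      using S(1) P by (simp add: expansion_hom[OF PX] sum.remove[of S P] algebra_simps)
    have 1: "val_ge (\<iota> P (1 - e P) * \<iota> P (h P)) 0" using val_ge_mult[OF e(1)[OF P] M[OF P P]] by simp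
    have 2: "val_ge (\<Sum>P'\<in>S - {P}. \<iota> P (e P') * \<iota> P (h P')) 0"
    proof (rule val_ge_sum)
      fix P' assume P': "P' \<in> S - {P}"
      then have "val_ge (\<iota> P (e P')) (int M)" "val_ge (\<iota> P (h P')) (- int M)" using e(2)[of P' P] M[of P' P] P by auto
      from val_ge_mult[OF this] show "val_ge (\<iota> P (e P') * \<iota> P (h P')) 0" by simp
    qed
    show ?thesis unfolding eq by (intro val_ge_diff val_ge_add h[OF P] 1 2)
  qed
  then show ?thesis by blast
qed

end

context completed_curve
begin

section \<open>Functions with poles at prescribed points\<close>

text \<open>Near a pole of \<open>x\<close> the top coefficient of a polynomial in \<open>x\<close> dominates.\<close>

lemma pole_polynomial:
  assumes P: "P \<in> X" and u: "has_val P u 0" "u * x = 1" and "degree p \<le> n"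
  shows "has_val P (u ^ n * ev x p) (coeff p n)"
  using assms(4)
proof (induction p arbitrary: n)
  case 0 show ?case using has_val_emb[of P 0] by (simp add: emb_hom)
next
  case (pCons c p)
  have upow: "has_val P (u ^ Suc m) 0" for m
  proof (induction m)
    case (Suc m)
    show ?case using has_val_mult[OF P u(1) Suc] by simp
  qed (use u(1) in simp)
  show ?case
  proof (cases n)
    case 0
    then have "p = 0" using pCons.prems pCons.hyps by (auto split: if_splits)
    then show ?thesis using 0 has_val_emb[of P c] by (simp add: ev_pCons)
  next
    case (Suc m)
    then have "degree p \<le> m" using pCons.prems by (cases "p = 0") auto
    then have "has_val P (emb c * u ^ Suc m + u ^ m * ev x p) (c * 0 + coeff p m)"
      by (intro has_val_add[OF P] has_val_mult[OF P has_val_emb upow] pCons.IH)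
    moreover have "emb c * u ^ Suc m + u ^ m * ev x p = u ^ n * ev x (pCons c p)"
    proof -
      have "u ^ n * ev x (pCons c p) = emb c * u ^ Suc m + u ^ m * ((u * x) * ev x p)"
        unfolding Suc ev_pCons by (simp add: algebra_simps)
      then show ?thesis by (simp add: u(2))
    qed
    ultimately show ?thesis using Suc by simp
  qed
qed

lemma pole_fraction:
  assumes P: "P \<in> X" and x: "x \<notin> local_ring quo P" and d: "d \<noteq> 0" and deg: "degree r \<le> degree d"
  shows "ev x r / ev x d \<in> local_ring quo P"
proof -
  note L = const_subringD[OF const_subring_local[OF P]]
  define u where "u = inverse x"
  have x0: "x \<noteq> 0" using x L(5) by auto
  have u: "has_val P u 0" "u * x = 1" "u \<noteq> 0" using pole_inverse[OF P x] x0 by (auto simp: u_def)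
  have "unit_at P (u ^ degree d * ev x d)"
    unfolding unit_at_def using pole_polynomial[OF P u(1,2) order_refl, of d] d by (intro exI[of _ "lead_coeff d"]) simp
  then have "inverse (u ^ degree d * ev x d) \<in> local_ring quo P"
    using unit_at_inverse(1)[OF P] unit_at_iff[OF P] by blast
  moreover have "u ^ degree d * ev x r \<in> local_ring quo P"
    by (rule local_ringI[OF P pole_polynomial[OF P u(1,2) deg]])
  ultimately have "(u ^ degree d * ev x r) * inverse (u ^ degree d * ev x d) \<in> local_ring quo P" by (rule L(3)[rotated])
  moreover have "(u ^ degree d * ev x r) * inverse (u ^ degree d * ev x d) = ev x r / ev x d"
    using u(3) by (simp add: field_simps)
  ultimately show ?thesis by simp
qed

text \<open>At each pole of \<open>b\<close> where \<open>x\<close> is regular, a power of \<open>x\<close> minus its value there removes the pole.\<close>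

lemma clear_poles:
  "\<exists>D. D \<noteq> 0 \<and> (\<forall>P\<in>X. x \<in> local_ring quo P \<longrightarrow> ev x D * b \<in> local_ring quo P)"
proof -
  define T where "T = {P\<in>X. b \<notin> local_ring quo P} \<inter> {P. x \<in> local_ring quo P}"
  have T: "finite T" "T \<subseteq> X" using finite_poles[of b] by (auto simp: T_def)
  have "\<forall>P. \<exists>c. P \<in> T \<longrightarrow> has_val P x c" using local_ringD unfolding T_def by blast
  then obtain c where c: "\<And>P. P \<in> T \<Longrightarrow> has_val P x (c P)" by metis
  obtain N where N: "\<And>P. P \<in> T \<Longrightarrow> val_ge (\<iota> P b) (- int N)" using val_ge_bound[OF T(1), of "\<lambda>P. \<iota> P b"] by blast
  define D where "D = (\<Prod>P\<in>T. [:- c P, 1:] ^ N)"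
  have "ev x D * b \<in> local_ring quo P" if P: "P \<in> X" and x: "x \<in> local_ring quo P" for P
  proof (cases "P \<in> T")
    case False
    then have "b \<in> local_ring quo P" using P x by (auto simp: T_def)
    then show ?thesis using const_subringD(3,9)[OF const_subring_local[OF P]] x by blast
  next
    case True
    define D' where "D' = (\<Prod>P\<in>T - {P}. [:- c P, 1:] ^ N)"
    have "D = [:- c P, 1:] ^ N * D'" unfolding D_def D'_def by (rule prod.remove[OF T(1) True])
    then have eD: "ev x D = (x - emb (c P)) ^ N * ev x D'"
      by (simp add: ev_mult ev_power ev_pCons emb_hom emb_uminus)
    have "has_val P (x + emb (- c P)) (c P + - c P)" by (rule has_val_add[OF P c[OF True] has_val_emb])
    then have "has_val P (x - emb (c P)) 0" by (simp add: emb_uminus)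
    then have "val_ge (\<iota> P (x - emb (c P))) 1" using expansion_val_ge(2)[OF P] by simp
    from val_ge_power[OF this, of N] have 1: "val_ge (\<iota> P ((x - emb (c P)) ^ N)) (int N)" by (simp add: expansion_hom[OF P])
    have "val_ge (\<iota> P (ev x D')) 0"
      using const_subringD(9)[OF const_subring_local[OF P] x] expansion_val_ge(1)[OF P] by blast
    from val_ge_mult[OF val_ge_mult[OF 1 this] N[OF True]] have "val_ge (\<iota> P (ev x D * b)) 0"
      unfolding eD by (simp add: expansion_hom[OF P])
    then show ?thesis using expansion_val_ge(1)[OF P] by blast
  qed
  moreover have "D \<noteq> 0" unfolding D_def by (simp add: T(1))
  ultimately show ?thesis by blast
qed

text \<open>By \<open>clear_poles\<close> there is a basis \<open>b'\<close> of \<open>F\<close> over \<open>k(x)\<close> that is regular outside \<open>S\<close>. The coefficients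
  of \<open>h\<close> split into a polynomial in \<open>x\<close>, which contributes to \<open>r\<close>, and a proper fraction, which is regular
  on \<open>S\<close>. The bound \<open>M\<close> depends only on the basis.\<close>

lemma function_splitting:
  assumes x: "x \<notin> range emb" and S: "S = {P\<in>X. x \<notin> local_ring quo P}"
  shows "\<exists>M. \<forall>h. \<exists>r. (\<forall>P\<in>X - S. r \<in> local_ring quo P) \<and> (\<forall>P\<in>S. val_ge (\<iota> P (h - r)) (- int M))"
proof -
  interpret x: field_extension "frac_ev x" by (rule field_extension_frac_ev[OF x])
  have fS: "finite S" unfolding S by (rule finite_poles)
  obtain B where B: "finite B" "\<And>h. \<exists>q. h = (\<Sum>b\<in>B. frac_ev x (q b) * b)"
    using finite_over_nonconstant[OF x] unfolding finite_over_def by blast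
  have "\<forall>b. \<exists>D. D \<noteq> 0 \<and> (\<forall>P\<in>X. x \<in> local_ring quo P \<longrightarrow> ev x D * b \<in> local_ring quo P)" using clear_poles by blast
  then obtain D where D: "\<And>b. D b \<noteq> 0" "\<And>b P. P \<in> X \<Longrightarrow> x \<in> local_ring quo P \<Longrightarrow> ev x (D b) * b \<in> local_ring quo P"
    by metis
  define b' where "b' = (\<lambda>b. ev x (D b) * b)"
  obtain M where M: "\<And>P b. P \<in> S \<Longrightarrow> b \<in> B \<Longrightarrow> val_ge (\<iota> P (b' b)) (- int M)"
    using val_ge_bound[of "S \<times> B" "\<lambda>(P, b). \<iota> P (b' b)"] fS B(1) by auto
  have "\<exists>r. (\<forall>P\<in>X - S. r \<in> local_ring quo P) \<and> (\<forall>P\<in>S. val_ge (\<iota> P (h - r)) (- int M))" for h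
  proof -
    obtain q where q: "h = (\<Sum>b\<in>B. frac_ev x (q b) * b)" using B(2) by blast
    have "\<forall>b. \<exists>n d. d \<noteq> 0 \<and> q b / Fract (D b) 1 = Fract n d"
    proof
      fix b
      obtain n d where "q b / Fract (D b) 1 = Fract n d" "d \<noteq> 0" by (cases "q b / Fract (D b) 1") auto
      then show "\<exists>n d. d \<noteq> 0 \<and> q b / Fract (D b) 1 = Fract n d" by blast
    qed
    then obtain n d where nd: "\<And>b. d b \<noteq> 0" "\<And>b. q b / Fract (D b) 1 = Fract (n b) (d b)" by metis
    have D0: "ev x (D b) \<noteq> 0" for b using ev_eq_0[OF x] D(1) by blast
    have qb: "frac_ev x (q b) * b = (ev x (n b) / ev x (d b)) * b' b" for b
    proof -
      have "frac_ev x (q b) / ev x (D b) = ev x (n b) / ev x (d b)"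
        using arg_cong[OF nd(2)[of b], of "frac_ev x"] by (simp add: x.hom_divide frac_ev_Fract[OF x] nd(1))
      then have "frac_ev x (q b) = ev x (n b) / ev x (d b) * ev x (D b)"
        by (simp only: nonzero_divide_eq_eq[OF D0])
      then show ?thesis by (simp add: b'_def)
    qed
    define w where "w = (\<lambda>b. ev x (n b mod d b) / ev x (d b))"
    have div: "ev x (n b) / ev x (d b) = ev x (n b div d b) + w b" for b
    proof -
      have "ev x (d b) \<noteq> 0" using ev_eq_0[OF x] nd(1) by blast
      moreover have "ev x (n b) = ev x (n b div d b) * ev x (d b) + ev x (n b mod d b)"
        by (simp flip: ev_mult ev_add)
      ultimately show ?thesis by (simp add: w_def field_simps)
    qed
    define r where "r = (\<Sum>b\<in>B. ev x (n b div d b) * b' b)"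
    have hr: "h - r = (\<Sum>b\<in>B. w b * b' b)"
      unfolding q qb div r_def sum_subtractf[symmetric] by (intro sum.cong refl) (simp add: algebra_simps)
    have "r \<in> local_ring quo P" if "P \<in> X - S" for P
    proof -
      have P: "P \<in> X" "x \<in> local_ring quo P" using that by (auto simp: S)
      note L = const_subringD[OF const_subring_local[OF P(1)]]
      show ?thesis unfolding r_def b'_def by (intro L(8) L(3) L(9) P(2) D(2) P(1))
    qed
    moreover have "val_ge (\<iota> P (h - r)) (- int M)" if PS: "P \<in> S" for P
    proof -
      have P: "P \<in> X" "x \<notin> local_ring quo P" using PS by (auto simp: S)
      have "val_ge (\<iota> P (w b * b' b)) (- int M)" if "b \<in> B" for b
      proof -
        have "degree (n b mod d b) \<le> degree (d b)" by (cases "n b mod d b = 0") (auto simp: degree_mod_less' nd(1) less_imp_le)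
        then have "w b \<in> local_ring quo P" unfolding w_def by (rule pole_fraction[OF P nd(1)])
        then have "val_ge (\<iota> P (w b)) 0" using expansion_val_ge(1)[OF P(1)] by blast
        from val_ge_mult[OF this M[OF PS that]] show ?thesis by (simp add: expansion_hom[OF P(1)])
      qed
      then show ?thesis unfolding hr expansion_hom(7)[OF P(1)] by (rule val_ge_sum)
    qed
    ultimately show ?thesis by blast
  qed
  then show ?thesis by blast
qed

section \<open>The residue theorem\<close>

definition expand_on :: "('n, 'k) ppoint set \<Rightarrow> 'f \<Rightarrow> ('n, 'k) ppoint \<Rightarrow> 'k fls" where
  "expand_on S r = (\<lambda>P. if P \<in> S then \<iota> P r else 0)"

text \<open>The two evaluations of the trace of the truncated commutator. The space \<open>R\<close> is that of functions
  regular outside \<open>S\<close>, embedded in the product of the completions at \<open>S\<close>; its intersection with the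
  power series consists of the constants.\<close>

theorem residue_theorem_at_poles:
  assumes x: "x \<notin> range emb" and S: "S = {P\<in>X. x \<notin> local_ring quo P}"
    and f: "\<And>P. P \<in> X - S \<Longrightarrow> f \<in> local_ring quo P" and g: "\<And>P. P \<in> X - S \<Longrightarrow> g \<in> local_ring quo P"
  shows "(\<Sum>P\<in>S. fls_residue (\<iota> P f * fls_deriv (\<iota> P g))) = 0"
proof -
  have fS: "finite S" unfolding S by (rule finite_poles)
  have SX: "S \<subseteq> X" by (auto simp: S)
  let ?f = "mult_on S (\<lambda>P. \<iota> P f)" and ?g = "mult_on S (\<lambda>P. \<iota> P g)" and ?Q = "truncate_on S"
  define reg where "reg = {r. \<forall>P\<in>X - S. r \<in> local_ring quo P}"
  define R where "R = expand_on S ` reg"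
  define A where "A = {v :: ('n, 'k) ppoint \<Rightarrow> 'k fls. \<forall>P\<in>S. val_ge (v P) 0}"
  have regD: "r + r' \<in> reg" "r * r' \<in> reg" "emb c \<in> reg" if "r \<in> reg" "r' \<in> reg" for r r' c
    using that const_subringD(1-3)[OF const_subring_local] unfolding reg_def by blast+
  have emb_reg: "emb c \<in> reg" for c using const_subringD(1)[OF const_subring_local] unfolding reg_def by blast
  obtain M0 where M0: "\<And>h. \<exists>r\<in>reg. \<forall>P\<in>S. val_ge (\<iota> P (h - r)) (- int M0)"
    using function_splitting[OF x S] unfolding reg_def by blast
  obtain M1 where M1: "\<And>P. P \<in> S \<Longrightarrow> val_ge (\<iota> P f) (- int M1)" using val_ge_bound[OF fS, of "\<lambda>P. \<iota> P f"] by blast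
  obtain M2 where M2: "\<And>P. P \<in> S \<Longrightarrow> val_ge (\<iota> P g) (- int M2)" using val_ge_bound[OF fS, of "\<lambda>P. \<iota> P g"] by blast
  \<comment> \<open>one bound for the poles of \<open>f\<close>, of \<open>g\<close>, and of the splitting of functions\<close>
  define M where "M = max M0 (max M1 M2)"
  define T where "T = (\<lambda>(p, i) q. if q = p then fls_X_intpow (- int i) else (0 :: 'k fls)) ` (S \<times> {1..M})"
  have fT: "finite T" unfolding T_def using fS by simp
  have trA: "truncate_on S v \<in> A" for v by (simp add: A_def truncate_on_def val_ge_iff)
  have polar: "\<exists>a\<in>A. \<exists>t\<in>series.span T. v = a + t" if v: "\<And>p. p \<in> S \<Longrightarrow> val_ge (v p) (- int M)" for v
  proof -
    obtain t where "t \<in> series.span T" "v = truncate_on S v + t"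
      using polar_decomposition[of S v M, OF fS v] unfolding T_def by blast
    then show ?thesis using trA[of v] by blast
  qed
  have "series.trace (\<lambda>v. ?Q (?f (?Q (?Q (?g (?Q v))))) - ?Q (?g (?Q (?Q (?f (?Q v)))))) = 0"
  proof (rule series.trace_commutator_eq_0_of_complement[where f = ?f and g = ?g and Q = ?Q and R = R and A = A and C = "{expand_on S 1}" and T = T])
    show "series.endo ?f" "series.endo ?g" "series.endo ?Q" by (rule endo_mult_on endo_truncate_on)+
    show "?f (?g v) = ?g (?f v)" for v by (simp add: mult_on_def fun_eq_iff)
    show "series.subspace R"
    proof (rule series.subspaceI)
      have "0 = expand_on S 0" using SX by (auto simp: expand_on_def fun_eq_iff expansion_hom(4) subset_iff)
      moreover have "0 \<in> reg" using emb_reg[of 0] by (simp add: emb_hom)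
      ultimately show "0 \<in> R" unfolding R_def by (rule image_eqI)
      show "u + v \<in> R" if uv: "u \<in> R" "v \<in> R" for u v
      proof -
        obtain r r' where r: "u = expand_on S r" "r \<in> reg" "v = expand_on S r'" "r' \<in> reg" using uv unfolding R_def by blast
        have "u + v = expand_on S (r + r')" using SX by (auto simp: r expand_on_def fun_eq_iff expansion_hom(1) subset_iff)
        then show ?thesis unfolding R_def using regD(1)[OF r(2,4)] by (rule image_eqI)
      qed
      show "series_scale c u \<in> R" if u: "u \<in> R" for c u
      proof -
        obtain r where r: "u = expand_on S r" "r \<in> reg" using u unfolding R_def by blast
        have "series_scale c u = expand_on S (emb c * r)"
          using SX by (auto simp: r expand_on_def series_scale_def fun_eq_iff expansion_hom(2,3) subset_iff)
        then show ?thesis unfolding R_def using regD(2)[OF emb_reg r(2)] by (rule image_eqI)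
      qed
    qed
    have stable: "mult_on S (\<lambda>P. \<iota> P l) u \<in> R" if l: "l \<in> reg" and u: "u \<in> R" for l u
    proof -
      obtain r where r: "u = expand_on S r" "r \<in> reg" using u unfolding R_def by blast
      have "mult_on S (\<lambda>P. \<iota> P l) u = expand_on S (l * r)"
        using SX by (auto simp: r expand_on_def mult_on_def fun_eq_iff expansion_hom(2) subset_iff)
      then show ?thesis unfolding R_def using regD(2)[OF l r(2)] by (rule image_eqI)
    qed
    show "?f r \<in> R" if "r \<in> R" for r using stable[OF _ that] f by (simp add: reg_def)
    show "?g r \<in> R" if "r \<in> R" for r using stable[OF _ that] g by (simp add: reg_def)
    show "series.subspace A"
      by (rule series.subspaceI) (auto simp: A_def val_ge_iff series_scale_def)
    show "?Q v \<in> A" for v by (rule trA)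
    show "?Q a = a" if "a \<in> A" for a
    proof
      fix p
      show "?Q a p = a p"
      proof (cases "p \<in> S")
        case True
        then have "val_ge (a p) 0" using that by (simp add: A_def)
        then show ?thesis using True by (intro fls_eqI) (auto simp: truncate_on_def val_ge_iff)
      qed (simp add: truncate_on_def)
    qed
    show "finite {expand_on S 1}" "finite T" by (simp_all add: fT)
    show "R \<inter> A \<subseteq> series.span {expand_on S 1}"
    proof
      fix v assume v: "v \<in> R \<inter> A"
      then obtain r where r: "v = expand_on S r" "r \<in> reg" unfolding R_def by blast
      have "r \<in> local_ring quo P" if P: "P \<in> X" for P
      proof (cases "P \<in> S")
        case True
        then have "val_ge (\<iota> P r) 0" using v r(1) by (auto simp: A_def expand_on_def)
        then show ?thesis using expansion_val_ge(1)[OF P] by blast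
      next
        case False
        then show ?thesis using r(2) P by (simp add: reg_def)
      qed
      then have "r \<in> range emb" using nonconstant_has_pole by blast
      then obtain c where c: "r = emb c" by blast
      have "v = series_scale c (expand_on S 1)"
        unfolding r(1) c using SX by (auto simp: expand_on_def series_scale_def fun_eq_iff expansion_hom(3,5) subset_iff)
      then show "v \<in> series.span {expand_on S 1}" using series.span_scale[OF series.span_base, of "expand_on S 1" "{expand_on S 1}" c] by simp
    qed
    show "\<exists>r\<in>R. \<exists>a\<in>A. \<exists>t\<in>series.span T. v = r + a + t" for v
    proof -
      obtain h where h: "\<And>P. P \<in> S \<Longrightarrow> val_ge (v P - \<iota> P h) 0" using weak_approximation[OF fS SX] by blast
      obtain r where r: "r \<in> reg" "\<And>P. P \<in> S \<Longrightarrow> val_ge (\<iota> P (h - r)) (- int M0)" using M0 by blast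
      have "val_ge ((v - expand_on S r) P) (- int M)" if P: "P \<in> S" for P
      proof -
        have "P \<in> X" using P SX by blast
        then have eq: "(v - expand_on S r) P = (v P - \<iota> P h) + \<iota> P (h - r)" using P by (simp add: expand_on_def expansion_hom(6))
        show ?thesis unfolding eq
          by (intro val_ge_add val_ge_mono[OF h[OF P]] val_ge_mono[OF r(2)[OF P]]) (auto simp: M_def)
      qed
      from polar[of "v - expand_on S r", OF this] obtain a t where "a \<in> A" "t \<in> series.span T" "v - expand_on S r = a + t" by blast
      moreover from this(3) have "v = expand_on S r + a + t" by (simp add: algebra_simps)
      moreover have "expand_on S r \<in> R" unfolding R_def using r(1) by (rule imageI)
      ultimately show ?thesis by blast
    qed
    have mQ: "\<exists>a\<in>A. \<exists>t\<in>series.span T. mult_on S (\<lambda>P. \<iota> P l) (?Q v) = a + t"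
      if l: "\<And>P. P \<in> S \<Longrightarrow> val_ge (\<iota> P l) (- int M)" for l v
    proof (rule polar)
      fix P assume P: "P \<in> S"
      have "val_ge (fls_regpart_as_fls (v P)) 0" by (simp add: val_ge_iff)
      from val_ge_mult[OF l[OF P] this] show "val_ge (mult_on S (\<lambda>P. \<iota> P l) (?Q v) P) (- int M)"
        using P by (simp add: mult_on_def truncate_on_def)
    qed
    show "\<exists>a\<in>A. \<exists>t\<in>series.span T. ?f (?Q v) = a + t" for v
      by (rule mQ) (rule val_ge_mono[OF M1], auto simp: M_def)
    show "\<exists>a\<in>A. \<exists>t\<in>series.span T. ?g (?Q v) = a + t" for v
      by (rule mQ) (rule val_ge_mono[OF M2], auto simp: M_def)
  qed
  then show ?thesis unfolding trace_truncated_commutator[OF fS] .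
qed

text \<open>For all but finitely many \<open>c\<close> the poles of \<open>f\<close> and \<open>g\<close> do not cancel in \<open>x = f + c g\<close>, so that the
  preceding theorem applies to the set \<open>S\<close> of all these poles.\<close>

theorem residue_theorem:
  "\<exists>S. finite S \<and> S \<subseteq> X \<and> (\<forall>P\<in>X - S. fls_residue (\<iota> P f * fls_deriv (\<iota> P g)) = 0) \<and>
     (\<Sum>P\<in>S. fls_residue (\<iota> P f * fls_deriv (\<iota> P g))) = 0"
proof -
  define S where "S = {P\<in>X. f \<notin> local_ring quo P} \<union> {P\<in>X. g \<notin> local_ring quo P}"
  have fS: "finite S" unfolding S_def by (intro finite_UnI finite_poles)
  have SX: "S \<subseteq> X" by (auto simp: S_def)
  have fg: "f \<in> local_ring quo P" "g \<in> local_ring quo P" if "P \<in> X - S" for P using that by (auto simp: S_def)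
  have off: "fls_residue (\<iota> P f * fls_deriv (\<iota> P g)) = 0" if P: "P \<in> X - S" for P
  proof -
    have "val_ge (\<iota> P f) 0" "val_ge (\<iota> P g) 0" using fg[OF P] expansion_val_ge(1) P by blast+
    moreover from this(2) have "val_ge (fls_deriv (\<iota> P g)) 0" by (rule val_ge_deriv)
    ultimately have "val_ge (\<iota> P f * fls_deriv (\<iota> P g)) (0 + 0)" by (intro val_ge_mult)
    then show ?thesis by (simp add: val_ge_iff)
  qed
  have "(\<Sum>P\<in>S. fls_residue (\<iota> P f * fls_deriv (\<iota> P g))) = 0"
  proof (cases "S = {}")
    case False
    define bad where "bad = (\<lambda>P. {c. f + emb c * g \<in> local_ring quo P})"
    \<comment> \<open>two bad values of \<open>c\<close> at \<open>P\<close> would make \<open>g\<close>, and then \<open>f\<close>, regular at \<open>P\<close>\<close>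
    have "finite (bad P)" if P: "P \<in> S" for P
    proof (rule ccontr)
      assume inf: "infinite (bad P)"
      have PX: "P \<in> X" using P SX by blast
      note L = const_subringD[OF const_subring_local[OF PX]]
      obtain c where c: "c \<in> bad P" using inf by (metis ex_in_conv finite.emptyI)
      obtain c' where c': "c' \<in> bad P" "c' \<noteq> c" using inf by (metis finite.emptyI finite_insert finite_subset insertI1 subsetI insertCI)
      have "emb (inverse (c - c')) * ((f + emb c * g) - (f + emb c' * g)) \<in> local_ring quo P"
        using c c' by (intro L(3) L(1) L(7)) (auto simp: bad_def)
      moreover have "emb (inverse (c - c')) * ((f + emb c * g) - (f + emb c' * g)) = emb (inverse (c - c') * (c - c')) * g"
        by (simp only: emb_hom emb_diff) (simp add: algebra_simps)
      ultimately have gP: "g \<in> local_ring quo P" using c'(2) by (simp add: emb_hom)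
      have "(f + emb c * g) - emb c * g \<in> local_ring quo P" using c gP by (intro L(7) L(3) L(1)) (auto simp: bad_def)
      then have "f \<in> local_ring quo P" by simp
      then show False using gP P by (auto simp: S_def)
    qed
    then have "finite (\<Union>P\<in>S. bad P)" using fS by blast
    then obtain c where c: "c \<notin> (\<Union>P\<in>S. bad P)" using ex_new_if_finite[OF infinite_UNIV_char_0] by blast
    define x where "x = f + emb c * g"
    have Sx: "S = {P\<in>X. x \<notin> local_ring quo P}"
    proof (intro equalityI subsetI)
      show "P \<in> {P\<in>X. x \<notin> local_ring quo P}" if "P \<in> S" for P using that c SX by (auto simp: bad_def x_def)
      fix P assume P: "P \<in> {P\<in>X. x \<notin> local_ring quo P}"
      show "P \<in> S"
      proof (rule ccontr)
        assume "P \<notin> S"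
        then have "P \<in> X - S" using P by blast
        then have "x \<in> local_ring quo P" unfolding x_def
          using fg const_subringD(1-3)[OF const_subring_local[of P]] by blast
        then show False using P by blast
      qed
    qed
    have "x \<notin> range emb"
    proof
      assume "x \<in> range emb"
      then have "S = {}" unfolding Sx using const_subringD(1)[OF const_subring_local] by blast
      then show False using False by simp
    qed
    from residue_theorem_at_poles[OF this Sx fg] show ?thesis by blast
  qed simp
  then show ?thesis using fS SX off by blast
qed

end

section \<open>Kaehler differentials\<close>

lemma lookup_map_mult: "Poly_Mapping.lookup (Poly_Mapping.map ((*) a) \<phi>) f = a * Poly_Mapping.lookup \<phi> f"
  for a :: "'f::field"
  by (simp add: map.rep_eq when_def)

lemma module_finite_support: "module (\<lambda>a. Poly_Mapping.map ((*) (a :: 'f::field)) :: ('f \<Rightarrow>\<^sub>0 'f) \<Rightarrow> _)"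
  by unfold_locales (auto intro!: poly_mapping_eqI simp: lookup_map_mult lookup_add algebra_simps)

text \<open>The restriction map is defined by a description. It exists because the map on formal sums annihilates
  the defining relations, and it is unique because the symbols \<open>df\<close> generate.\<close>

lemma restrict_diff:
  fixes emb :: "'k::field \<Rightarrow> 'f::field" and smul :: "'f \<Rightarrow> 'w::ab_group_add \<Rightarrow> 'w" and j :: "'f \<Rightarrow> 'k fls"
  assumes K: "is_kahler_module emb smul d"
    and j: "\<And>f h. j (f + h) = j f + j h" "\<And>f h. j (f * h) = j f * j h" "\<And>c. j (emb c) = fls_const c" "j 1 = 1"
  defines "L \<equiv> restrict_diff smul d j"
  shows "L (\<omega> + \<omega>') = L \<omega> + L \<omega>'" "L (smul f \<omega>) = j f * L \<omega>" "L (d f) = fls_deriv (j f)"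
proof -
  have vs: "vector_space smul" and span: "module.span smul (range d) = UNIV" and
    rel: "\<And>\<phi>. (\<Sum>f\<in>Poly_Mapping.keys \<phi>. smul (Poly_Mapping.lookup \<phi> f) (d f)) = 0 \<longleftrightarrow> \<phi> \<in> kahler_relations emb"
    using K unfolding is_kahler_module_def by auto
  interpret w: vector_space smul by (rule vs)
  interpret m: module "\<lambda>a. Poly_Mapping.map ((*) (a :: 'f)) :: ('f \<Rightarrow>\<^sub>0 'f) \<Rightarrow> _" by (rule module_finite_support)
  have j0: "j 0 = 0" using j(3)[of 0] j(1)[of 0 0] by (simp only: add_0_right add_cancel_left_left add_cancel_left_right add_cancel_right_right)
  have jm: "j (- f) = - j f" for f using j(1)[of f "- f"] j0 by (simp add: eq_neg_iff_add_eq_0 add.commute)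
  define \<Phi> where "\<Phi> = (\<lambda>\<phi>. \<Sum>f\<in>Poly_Mapping.keys \<phi>. smul (Poly_Mapping.lookup \<phi> f) (d f))"
  define \<Lambda> where "\<Lambda> = (\<lambda>\<phi>. \<Sum>f\<in>Poly_Mapping.keys \<phi>. j (Poly_Mapping.lookup \<phi> f) * fls_deriv (j f))"
  have \<Phi>_alt: "\<Phi> \<phi> = (\<Sum>f\<in>A. smul (Poly_Mapping.lookup \<phi> f) (d f))" if "finite A" "Poly_Mapping.keys \<phi> \<subseteq> A" for A \<phi>
    unfolding \<Phi>_def using that by (intro sum.mono_neutral_left) (auto simp: in_keys_iff)
  have \<Lambda>_alt: "\<Lambda> \<phi> = (\<Sum>f\<in>A. j (Poly_Mapping.lookup \<phi> f) * fls_deriv (j f))" if "finite A" "Poly_Mapping.keys \<phi> \<subseteq> A" for A \<phi>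
    unfolding \<Lambda>_def using that by (intro sum.mono_neutral_left) (auto simp: in_keys_iff j0)
  have \<Phi>_add: "\<Phi> (\<phi> + \<psi>) = \<Phi> \<phi> + \<Phi> \<psi>" and \<Lambda>_add: "\<Lambda> (\<phi> + \<psi>) = \<Lambda> \<phi> + \<Lambda> \<psi>" for \<phi> \<psi>
  proof -
    let ?A = "Poly_Mapping.keys \<phi> \<union> Poly_Mapping.keys \<psi>"
    have A: "finite ?A" "Poly_Mapping.keys (\<phi> + \<psi>) \<subseteq> ?A" "Poly_Mapping.keys \<phi> \<subseteq> ?A" "Poly_Mapping.keys \<psi> \<subseteq> ?A"
      using keys_add[of \<phi> \<psi>] by auto
    show "\<Phi> (\<phi> + \<psi>) = \<Phi> \<phi> + \<Phi> \<psi>"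
      unfolding \<Phi>_alt[OF A(1,2)] \<Phi>_alt[OF A(1,3)] \<Phi>_alt[OF A(1,4)] by (simp add: lookup_add w.scale_left_distrib sum.distrib)
    show "\<Lambda> (\<phi> + \<psi>) = \<Lambda> \<phi> + \<Lambda> \<psi>"
      unfolding \<Lambda>_alt[OF A(1,2)] \<Lambda>_alt[OF A(1,3)] \<Lambda>_alt[OF A(1,4)] by (simp add: lookup_add j(1) distrib_right sum.distrib)
  qed
  have keys_map: "Poly_Mapping.keys (Poly_Mapping.map ((*) a) \<phi>) \<subseteq> Poly_Mapping.keys \<phi>" for a :: 'f and \<phi> :: "'f \<Rightarrow>\<^sub>0 'f"
    by (auto simp: in_keys_iff lookup_map_mult)
  have \<Phi>_scale: "\<Phi> (Poly_Mapping.map ((*) a) \<phi>) = smul a (\<Phi> \<phi>)" for a \<phi>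
    unfolding \<Phi>_alt[OF finite_keys keys_map] by (simp add: \<Phi>_def lookup_map_mult w.scale_sum_right)
  have \<Lambda>_scale: "\<Lambda> (Poly_Mapping.map ((*) a) \<phi>) = j a * \<Lambda> \<phi>" for a \<phi>
    unfolding \<Lambda>_alt[OF finite_keys keys_map] by (simp add: \<Lambda>_def lookup_map_mult j(2) sum_distrib_left mult.assoc)
  have \<Phi>_single: "\<Phi> (Poly_Mapping.single f a) = smul a (d f)" for f a by (subst \<Phi>_alt[of "{f}"]) auto
  have \<Lambda>_single: "\<Lambda> (Poly_Mapping.single f a) = j a * fls_deriv (j f)" for f a by (subst \<Lambda>_alt[of "{f}"]) auto
  have \<Phi>_diff: "\<Phi> (\<phi> - \<psi>) = \<Phi> \<phi> - \<Phi> \<psi>" and \<Lambda>_diff: "\<Lambda> (\<phi> - \<psi>) = \<Lambda> \<phi> - \<Lambda> \<psi>" for \<phi> \<psi>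
    using \<Phi>_add[of "\<phi> - \<psi>" \<psi>] \<Lambda>_add[of "\<phi> - \<psi>" \<psi>] by simp_all
  have \<Lambda>_rel: "\<Lambda> \<phi> = 0" if "\<phi> \<in> kahler_relations emb" for \<phi>
    using that unfolding kahler_relations_def
  proof (induction rule: m.span_induct_alt)
    case base show ?case by (simp add: \<Lambda>_def)
  next
    case (step c x y)
    have "\<Lambda> x = 0" using step.hyps by (auto simp: \<Lambda>_diff \<Lambda>_single j fls_deriv_mult)
    then show ?case using step by (simp add: \<Lambda>_add \<Lambda>_scale)
  qed
  have surj: "\<exists>\<phi>. \<Phi> \<phi> = \<omega>" for \<omega>
  proof -
    have "\<omega> \<in> w.span (range d)" using span by simp
    then show ?thesis
    proof (induction rule: w.span_induct_alt)
      case base show ?case by (rule exI[of _ 0]) (simp add: \<Phi>_def)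
    next
      case (step c x y)
      then obtain f \<phi> where "x = d f" "\<Phi> \<phi> = y" by blast
      then have "\<Phi> (Poly_Mapping.single f c + \<phi>) = smul c x + y" by (simp add: \<Phi>_add \<Phi>_single)
      then show ?case by (rule exI)
    qed
  qed
  define L0 where "L0 = (\<lambda>\<omega>. \<Lambda> (SOME \<phi>. \<Phi> \<phi> = \<omega>))"
  have L0: "L0 (\<Phi> \<phi>) = \<Lambda> \<phi>" for \<phi>
  proof -
    define \<psi> where "\<psi> = (SOME \<psi>. \<Phi> \<psi> = \<Phi> \<phi>)"
    have "\<Phi> \<psi> = \<Phi> \<phi>" unfolding \<psi>_def by (rule someI) (rule refl)
    then have "\<Phi> (\<psi> - \<phi>) = 0" by (simp add: \<Phi>_diff)
    then have "\<psi> - \<phi> \<in> kahler_relations emb" using rel unfolding \<Phi>_def by blast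
    then have "\<Lambda> (\<psi> - \<phi>) = 0" by (rule \<Lambda>_rel)
    then show ?thesis by (simp add: \<Lambda>_diff L0_def \<psi>_def)
  qed
  let ?P = "\<lambda>L. (\<forall>\<omega> \<omega>'. L (\<omega> + \<omega>') = L \<omega> + L \<omega>') \<and> (\<forall>f \<omega>. L (smul f \<omega>) = j f * L \<omega>) \<and>
    (\<forall>f. L (d f) = fls_deriv (j f))"
  have "?P L0"
  proof (intro conjI allI)
    fix \<omega> \<omega>' f
    obtain \<phi> \<psi> where \<phi>: "\<Phi> \<phi> = \<omega>" "\<Phi> \<psi> = \<omega>'" using surj by blast
    show "L0 (\<omega> + \<omega>') = L0 \<omega> + L0 \<omega>'" unfolding \<phi>[symmetric] \<Phi>_add[symmetric] L0 by (rule \<Lambda>_add)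
    show "L0 (smul f \<omega>) = j f * L0 \<omega>" unfolding \<phi>[symmetric] \<Phi>_scale[symmetric] L0 by (rule \<Lambda>_scale)
    have "d f = \<Phi> (Poly_Mapping.single f 1)" by (simp add: \<Phi>_single)
    then show "L0 (d f) = fls_deriv (j f)" by (simp add: L0 \<Lambda>_single j(4))
  qed
  moreover have "L1 = L0" if L1: "?P L1" for L1
  proof
    fix \<omega>
    have L1': "L1 0 = 0" using L1 by (metis add_cancel_left_left add_0_right)
    have "\<omega> \<in> w.span (range d)" using span by simp
    then show "L1 \<omega> = L0 \<omega>"
    proof (induction rule: w.span_induct_alt)
      case base
      have "L0 0 = 0" using L0[of 0] by (simp add: \<Phi>_def \<Lambda>_def)
      then show ?case using L1' by simp
    next
      case (step c x y)
      then obtain f where "x = d f" by blast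
      then show ?case using step L1 \<open>?P L0\<close> by simp
    qed
  qed
  ultimately have "?P L" unfolding L_def restrict_diff_def by (intro theI[of ?P L0])
  then show "L (\<omega> + \<omega>') = L \<omega> + L \<omega>'" "L (smul f \<omega>) = j f * L \<omega>" "L (d f) = fls_deriv (j f)" by blast+
qed

lemma (in completed_curve) residue_theorem_differential:
  assumes K: "is_kahler_module emb smul d"
  shows "\<exists>S. finite S \<and> S \<subseteq> X \<and> (\<forall>P\<in>X - S. fls_residue (restrict_diff smul d (\<iota> P) \<omega>) = 0) \<and>
     (\<Sum>P\<in>S. fls_residue (restrict_diff smul d (\<iota> P) \<omega>)) = 0"
proof -
  let ?res = "\<lambda>\<omega> P. fls_residue (restrict_diff smul d (\<iota> P) \<omega>)"
  have vs: "vector_space smul" and span: "module.span smul (range d) = UNIV"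
    using K unfolding is_kahler_module_def by auto
  interpret w: vector_space smul by (rule vs)
  note L = restrict_diff[OF K expansion_hom(1,2,3,5)]
  have "\<omega> \<in> w.span (range d)" using span by simp
  then show ?thesis
  proof (induction rule: w.span_induct_alt)
    case base
    have "restrict_diff smul d (\<iota> P) 0 = 0" if P: "P \<in> X" for P
      using L(2)[OF P P P P, of 0 0] by (simp add: expansion_hom[OF P])
    then show ?case by (intro exI[of _ "{}"]) simp
  next
    case (step f x y)
    then obtain g where x: "x = d g" by blast
    obtain S where S: "finite S" "S \<subseteq> X" "\<And>P. P \<in> X - S \<Longrightarrow> fls_residue (\<iota> P f * fls_deriv (\<iota> P g)) = 0"
      "(\<Sum>P\<in>S. fls_residue (\<iota> P f * fls_deriv (\<iota> P g))) = 0"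
      using residue_theorem[of f g] by blast
    obtain S' where S': "finite S'" "S' \<subseteq> X" "\<And>P. P \<in> X - S' \<Longrightarrow> ?res y P = 0" "(\<Sum>P\<in>S'. ?res y P) = 0"
      using step.IH by blast
    have split: "?res (smul f x + y) P = fls_residue (\<iota> P f * fls_deriv (\<iota> P g)) + ?res y P" if P: "P \<in> X" for P
      unfolding x L(1)[OF P P P P] L(2)[OF P P P P] L(3)[OF P P P P] by (rule fls_residue_add)
    have "(\<Sum>P\<in>S \<union> S'. ?res (smul f x + y) P)
        = (\<Sum>P\<in>S \<union> S'. fls_residue (\<iota> P f * fls_deriv (\<iota> P g))) + (\<Sum>P\<in>S \<union> S'. ?res y P)"
      unfolding sum.distrib[symmetric] by (intro sum.cong refl split) (use S S' in blast)
    also have "(\<Sum>P\<in>S \<union> S'. fls_residue (\<iota> P f * fls_deriv (\<iota> P g))) = (\<Sum>P\<in>S. fls_residue (\<iota> P f * fls_deriv (\<iota> P g)))"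
      by (rule sum.mono_neutral_right) (use S(1,3) S'(1,2) in blast)+
    also have "(\<Sum>P\<in>S \<union> S'. ?res y P) = (\<Sum>P\<in>S'. ?res y P)"
      by (rule sum.mono_neutral_right) (use S(1,2) S'(1,3) in blast)+
    finally have "(\<Sum>P\<in>S \<union> S'. ?res (smul f x + y) P) = 0" unfolding S(4) S'(4) by simp
    moreover have "?res (smul f x + y) P = 0" if "P \<in> X - (S \<union> S')" for P
    proof -
      have P: "P \<in> X" "P \<in> X - S" "P \<in> X - S'" using that by auto
      show ?thesis unfolding split[OF P(1)] S(3)[OF P(2)] S'(3)[OF P(3)] by simp
    qed
    ultimately show ?case using S(1,2) S'(1,2) by (intro exI[of _ "S \<union> S'"]) blast
  qed
qed

section \<open>Additive multi-valued functions\<close>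

theorem mainTheorem3:
  fixes X :: "('n::finite, 'k::{alg_closed_field, field_char_0}) ppoint set"
    and quo :: "('n, 'k) mpol \<Rightarrow> ('n, 'k) mpol \<Rightarrow> 'f::field"
    and smul :: "'f \<Rightarrow> 'w::ab_group_add \<Rightarrow> 'w"
    and d :: "'f \<Rightarrow> 'w"
    and \<iota> :: "('n, 'k) ppoint \<Rightarrow> 'f \<Rightarrow> 'k fls"
    and g :: nat
    and Q :: "nat \<Rightarrow> ('n, 'k) ppoint"
    and t :: "nat \<Rightarrow> 'k fls"
    and \<omega> :: "nat \<Rightarrow> 'w"
    and \<eta> :: "nat \<Rightarrow> ('n, 'k) ppoint \<Rightarrow> 'k fls"
    and a\<^sub>1 a\<^sub>2 :: "('n, 'k) ppoint \<Rightarrow> 'k fls"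
  assumes curve: "algebraic_curve X quo"
    and kahler: "is_kahler_module (const_fun quo) smul d"
    and completions: "\<And>P. P \<in> X \<Longrightarrow> is_completion quo P (\<iota> P)"
    and genus: "genus X quo smul d \<iota> = g" "g \<ge> 1"
    and points: "\<And>i. i \<in> {1..g} \<Longrightarrow> Q i \<in> X" "inj_on Q {1..g}"
    and nonspecial: "nonspecial X quo smul d \<iota> (sum_of_points g Q)"
    and uniformizers: "\<And>i. i \<in> {1..g} \<Longrightarrow> fls_subdegree (t i) = 1"
    and second_kind: "\<And>j. j \<in> {1..g} \<Longrightarrow>
      \<omega> j \<in> second_kind X smul d \<iota> \<inter> diffs_of_divisor X smul d \<iota> (\<lambda>P. 2 * sum_of_points g Q P)"
    and normalized: "\<And>i j. i \<in> {1..g} \<Longrightarrow> j \<in> {1..g} \<Longrightarrow>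
      val_ge (restrict_diff smul d (\<iota> (Q i)) (\<omega> j)
        - (if i = j then t i powi (-2) * fls_deriv (t i) else 0)) 1"
    and primitives: "\<And>i. i \<in> {1..g} \<Longrightarrow> \<eta> i \<in> adeles X"
      "\<And>i P. i \<in> {1..g} \<Longrightarrow> P \<in> X \<Longrightarrow> fls_deriv (\<eta> i P) = restrict_diff smul d (\<iota> P) (\<omega> i)"
    and additive: "a\<^sub>1 \<in> additive_functions X \<iota> g \<eta>" "a\<^sub>2 \<in> additive_functions X \<iota> g \<eta>"
  shows "c_form X a\<^sub>1 a\<^sub>2 = 0"
proof -
  interpret completed_curve X quo \<iota> by unfold_locales (fact curve, fact completions)
  define L where "L = (\<lambda>P. restrict_diff smul d (\<iota> P))"
  have L: "L P (\<nu> + \<nu>') = L P \<nu> + L P \<nu>'" "L P (smul f \<nu>) = \<iota> P f * L P \<nu>" "L P (d f) = fls_deriv (\<iota> P f)"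
    if P: "P \<in> X" for P \<nu> \<nu>' f
    unfolding L_def by (rule restrict_diff[OF kahler expansion_hom(1,2,3,5)[OF P]])+
  have L_sum: "L P (sum \<nu> I) = (\<Sum>i\<in>I. L P (\<nu> i))" if P: "P \<in> X" for P and \<nu> :: "nat \<Rightarrow> 'w" and I
  proof (induction I rule: infinite_finite_induct)
    case (insert i I) then show ?case by (simp add: L(1)[OF P])
  qed (use L(1)[OF P, of 0 0] in simp_all)
  have \<eta>': "fls_deriv (\<eta> i P) = L P (\<omega> i)" if "i \<in> {1..g}" "P \<in> X" for i P
    unfolding L_def by (rule primitives(2)[OF that])
  have pole_order: "val_ge (L P (\<omega> i)) (- (2 * sum_of_points g Q P))" if "i \<in> {1..g}" "P \<in> X" for i P
    using second_kind[OF that(1)] that(2) unfolding diffs_of_divisor_def L_def by blast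
  have off_diag: "val_ge (L (Q k) (\<omega> i)) 1" if "k \<in> {1..g}" "i \<in> {1..g}" "i \<noteq> k" for i k
  proof -
    have "k \<noteq> i" using that(3) by simp
    then show ?thesis using normalized[OF that(1,2)] unfolding L_def by (simp only: if_False diff_0_right)
  qed
  have div_Q: "sum_of_points g Q (Q k) = 1" if k: "k \<in> {1..g}" for k
  proof -
    have "sum_of_points g Q (Q k) = (\<Sum>i=1..g. if i = k then 1 else 0)"
      unfolding sum_of_points_def using inj_on_eq_iff[OF points(2) _ k] by (intro sum.cong refl) simp
    then show ?thesis using k by simp
  qed
  have div_other: "sum_of_points g Q P = 0" if "P \<notin> Q ` {1..g}" for P
    unfolding sum_of_points_def using that by (intro sum.neutral) auto
  \<comment> \<open>a pole of order at most one of \<open>\<eta> i\<close> against a zero of \<open>d\<eta> j\<close> at \<open>Q k\<close>\<close>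
  have one_sided: "fls_residue (\<eta> i (Q k) * fls_deriv (\<eta> j (Q k))) = 0"
    if k: "k \<in> {1..g}" and i: "i \<in> {1..g}" and j: "j \<in> {1..g}" and "j \<noteq> k" for i j k
  proof -
    have QX: "Q k \<in> X" by (rule points(1)[OF k])
    have "val_ge (fls_deriv (\<eta> i (Q k))) (- 2)"
      using pole_order[OF i QX] div_Q[OF k] by (simp add: \<eta>'[OF i QX])
    then have "val_ge (\<eta> i (Q k)) (- 1)" by (rule val_ge_antideriv) auto
    from val_ge_mult[OF this off_diag[OF k j \<open>j \<noteq> k\<close>]] show ?thesis
      unfolding \<eta>'[OF j QX] by (intro residue_regular) simp
  qed
  have \<eta>\<eta>: "fls_residue (\<eta> i P * fls_deriv (\<eta> j P)) = 0"
    if i: "i \<in> {1..g}" and j: "j \<in> {1..g}" and P: "P \<in> X" for i j P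
  proof (cases "i = j")
    case True then show ?thesis by (simp only: residue_self_deriv)
  next
    case False
    show ?thesis
    proof (cases "P \<in> Q ` {1..g}")
      case True
      then obtain k where k: "k \<in> {1..g}" "P = Q k" by blast
      show ?thesis
      proof (cases "j = k")
        case True
        then have "i \<noteq> k" using False by simp
        then have "fls_residue (\<eta> j (Q k) * fls_deriv (\<eta> i (Q k))) = 0" by (rule one_sided[OF k(1) j i])
        then show ?thesis unfolding k(2) residue_by_parts[of "\<eta> i (Q k)" "\<eta> j (Q k)"] by simp
      next
        case False then show ?thesis unfolding k(2) by (rule one_sided[OF k(1) i j])
      qed
    next
      case False
      have reg: "val_ge (fls_deriv (\<eta> l P)) 0" if "l \<in> {1..g}" for l
        using pole_order[OF that P] div_other[OF False] by (simp add: \<eta>'[OF that P])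
      have "val_ge (\<eta> i P) 0" by (rule val_ge_antideriv[OF reg[OF i]]) auto
      from val_ge_mult[OF this reg[OF j]] show ?thesis by (intro residue_regular) simp
    qed
  qed
  obtain c f where a1: "a\<^sub>1 = (\<lambda>P. (\<Sum>i=1..g. fls_const (c i) * \<eta> i P) + diagonal X \<iota> f P)"
    using additive(1) unfolding additive_functions_def by blast
  obtain c' h where a2: "a\<^sub>2 = (\<lambda>P. (\<Sum>i=1..g. fls_const (c' i) * \<eta> i P) + diagonal X \<iota> h P)"
    using additive(2) unfolding additive_functions_def by blast
  \<comment> \<open>what remains of \<open>a\<^sub>1 da\<^sub>2\<close> once \<open>\<eta>\<^sub>i d\<eta>\<^sub>j\<close> is dropped and \<open>\<eta>\<^sub>i dh\<close> is integrated by parts\<close>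
  define \<nu> where "\<nu> = smul f ((\<Sum>j=1..g. smul (const_fun quo (c' j)) (\<omega> j)) + d h)
    + smul (- h) (\<Sum>i=1..g. smul (const_fun quo (c i)) (\<omega> i))"
  have pointwise: "fls_residue (a\<^sub>1 P * fls_deriv (a\<^sub>2 P)) = fls_residue (L P \<nu>)" if P: "P \<in> X" for P
  proof -
    define A where "A = (\<Sum>i=1..g. fls_const (c i) * \<eta> i P)"
    define B where "B = (\<Sum>i=1..g. fls_const (c' i) * \<eta> i P)"
    have dA: "fls_deriv A = (\<Sum>i=1..g. fls_const (c i) * fls_deriv (\<eta> i P))"
      and dB: "fls_deriv B = (\<Sum>i=1..g. fls_const (c' i) * fls_deriv (\<eta> i P))"
      unfolding A_def B_def fls_deriv_sum by (simp_all add: fls_deriv_mult_const_left)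
    have "L P \<nu> = \<iota> P f * (fls_deriv B + fls_deriv (\<iota> P h)) - \<iota> P h * fls_deriv A"
    proof -
      have "\<iota> P (- h) = - \<iota> P h" using expansion_hom(6)[OF P, of 0 h] expansion_hom(4)[OF P] by simp
      moreover have "L P (\<Sum>i=1..g. smul (const_fun quo (b i)) (\<omega> i)) = (\<Sum>i=1..g. fls_const (b i) * fls_deriv (\<eta> i P))" for b
        unfolding L_sum[OF P] by (intro sum.cong refl) (simp add: L(2)[OF P] expansion_hom(3)[OF P] \<eta>'[OF _ P])
      ultimately show ?thesis unfolding \<nu>_def L[OF P] dA dB by simp
    qed
    moreover have "fls_residue (A * fls_deriv B) = 0"
    proof -
      have "fls_residue (A * fls_deriv B) = (\<Sum>i=1..g. \<Sum>j=1..g. c i * c' j * fls_residue (\<eta> i P * fls_deriv (\<eta> j P)))"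
      proof -
        have "A * fls_deriv B = (\<Sum>i=1..g. \<Sum>j=1..g. fls_const (c i * c' j) * (\<eta> i P * fls_deriv (\<eta> j P)))"
          unfolding dB unfolding A_def sum_product by (intro sum.cong refl) (simp add: mult_ac flip: fls_const_mult_const)
        then show ?thesis by (simp add: fls_nth_sum)
      qed
      also have "\<dots> = 0" using \<eta>\<eta>[OF _ _ P] by (intro sum.neutral ballI) simp
      finally show ?thesis .
    qed
    moreover have "fls_residue (A * fls_deriv (\<iota> P h)) = - fls_residue (\<iota> P h * fls_deriv A)"
      by (rule residue_by_parts)
    moreover have "a\<^sub>1 P * fls_deriv (a\<^sub>2 P)
        = A * fls_deriv B + A * fls_deriv (\<iota> P h) + \<iota> P f * (fls_deriv B + fls_deriv (\<iota> P h))"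
      unfolding a1 a2 A_def[symmetric] B_def[symmetric] using P by (simp add: diagonal_def algebra_simps)
    ultimately show ?thesis by simp
  qed
  obtain S where S: "finite S" "S \<subseteq> X" "\<And>P. P \<in> X - S \<Longrightarrow> fls_residue (L P \<nu>) = 0" "(\<Sum>P\<in>S. fls_residue (L P \<nu>)) = 0"
    using residue_theorem_differential[OF kahler, of \<nu>] unfolding L_def by blast
  have "(\<Sum>P | P \<in> X \<and> fls_residue (a\<^sub>1 P * fls_deriv (a\<^sub>2 P)) \<noteq> 0. fls_residue (a\<^sub>1 P * fls_deriv (a\<^sub>2 P)))
      = (\<Sum>P | P \<in> X \<and> fls_residue (L P \<nu>) \<noteq> 0. fls_residue (L P \<nu>))"
    using pointwise by (intro sum.cong) auto
  also have "\<dots> = (\<Sum>P\<in>S. fls_residue (L P \<nu>))"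
    using S(1-3) by (intro sum.mono_neutral_left) auto
  finally show ?thesis unfolding c_form_def S(4) by simp
qed

end
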